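(* Let $x=(x_n)_{n\in\mathbb{N}}$ and $y=(y_n)_{n\in\mathbb{N}}$ be sequences in $\hat{\mathbb{P}}$ such that $x_1=1_{\mathbb{P}}$ and, for all $n\in\mathbb{N}$, $y_n\neq 0_{\mathbb{P}}$, $y_n$ is independent of $x_{n+1}$ and $x_n=x_{n+1}\lor y_n$. Let $B:=\bigcup_{n\in\mathbb{N}}B_n$, where $B_n:=\{\lor C:C\subset\{y_1,\ldots,y_n,x_{n+1}\}\}$ (with $\lor\emptyset=0_{\mathbb{P}}$); $B$ is a noise Boolean algebra. Suppose that for all $n\in\mathbb{N}$, $y_n=\sigma(\eta_n)$ for an equiprobable random sign $\eta_n$, and that $\bigwedge_{n\in\mathbb{N}}x_n=0_{\mathbb{P}}$. For $n\in\mathbb{N}$ set $H_n:=\mathrm{L}^2(\mathbb{P}|_{x_n})^\circ$. Consider the condition $$(\ast)\qquad B^\circ=\mathrm{Cl}(B)^\circ\ \text{ and the spectral measure } \mu \text{ of } B \text{ is purely atomic.}$$ (i) Either for all $n\in\mathbb{N}$, $H_n=\{0\}$; or for all $n\in\mathbb{N}$ there is an, up to a prefactor of $\pm1$ a.s.-$\mathbb{P}$ unique, equiprobable random sign $\xi_n$ such that $H_n=\mathrm{lin}(\xi_n)$, and the prefactors $\pm1$ may be chosen so that $\xi_n=\eta_n\xi_{n+1}$ for all $n\in\mathbb{N}$. (ii) Suppose the second option of (i) prevails. Then $B^\circ=B$ and $\bigoplus_{z\in B}\mathrm{L}^2(\mathbb{P}|_z)^\circ=\mathrm{L}^2(\mathbb{P}|_{\sigma(\xi_n:n\in\mathbb{N})})$.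 Moreover $\sigma(\xi_n:n\in\mathbb{N})=1_{\mathbb{P}}$ if and only if $(\ast)$ holds true, in which case $x_n=\sigma(\xi_k:k\in\mathbb{N},k\geq n)$ for all $n\in\mathbb{N}$. (iii) If $(\ast)$ holds, then $x$ is of product type, i.e. there is a sequence $(z_n)_{n\in\mathbb{N}}$ of independent elements of $\hat{\mathbb{P}}$ such that $x_n=\bigvee_{k\geq n}z_k$ for all $n\in\mathbb{N}$.
   Context: All $\mathrm{L}^p$ and Hilbert spaces are real. $(\Omega,\mathcal{F},\mathbb{P})$ is an essentially separable probability space: some countable subset of $\mathcal{F}$ together with the $\mathbb{P}$-null sets generates $\mathcal{F}$. $\sigma(\cdots)$ denotes the $\sigma$-field generated by the indicated objects and by the null sets of the relevant measure. An equiprobable random sign is a random variable taking the values $1$ and $-1$ with probability $1/2$ each; $\mathrm{lin}$ denotes linear span. $\hat{\mathbb{P}}$ is the lattice of all complete sub-$\sigma$-fields of $\mathcal{F}$ (those containing $0_{\mathbb{P}}:=\mathbb{P}^{-1}(\{0,1\})$), ordered by inclusion, with bottom $0_{\mathbb{P}}$, top $1_{\mathbb{P}}:=\mathcal{F}$, meet $\land=\cap$ and join $\lor$ = generated $\sigma$-field. For $x\in\hat{\mathbb{P}}$, $\mathbb{P}_x$ is the conditional expectation operator on $\mathrm{L}^2(\mathbb{P})$ given $x$. $\hat{\mathbb{P}}$ carries the topology of strong operator convergence of the $\mathbb{P}_x$: $x_n\to x$ iff $\mathbb{P}_{x_n}f\to\mathbb{P}_xf$ in $\mathrm{L}^2(\mathbb{P})$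 for all $f\in\mathrm{L}^2(\mathbb{P})$. A noise Boolean algebra under $\mathbb{P}$ is a non-empty distributive sublattice $B$ of $\hat{\mathbb{P}}$ every element $x$ of which admits an $x'\in B$ independent of $x$ with $x\lor x'=1_{\mathbb{P}}$. $\mathrm{Cl}(B)$ is the closure of $B$ in $\hat{\mathbb{P}}$. For $x\in\mathrm{Cl}(B)$, $\mathrm{L}^2(\mathbb{P}|_x)^\circ$ is the orthogonal complement in $\mathrm{L}^2(\mathbb{P}|_x)$ of the closure of the linear span of $\bigcup\{\mathrm{L}^2(\mathbb{P}|_y):y\in\mathrm{Cl}(B),\,y\subsetneq x\}$. $\mathrm{Cl}(B)^\circ:=\{x\in\mathrm{Cl}(B):\mathrm{L}^2(\mathbb{P}|_x)^\circ\ne\{0\}\}$ and $B^\circ:=B\cap\mathrm{Cl}(B)^\circ$. Spectral measure. Let $\mathcal{A}$ be the strong operator closure of the real linear span of $\{\mathbb{P}_x:x\in B\}$. A standard measure space is the completion of a $\sigma$-finite measure on a standard Borel space, possibly adjoined with an extra null set. A spectral resolution $((S,\Sigma,\mu);\Psi)$ of $B$ consists of a standard measure space $(S,\Sigma,\mu)$ and a unitary isomorphism $\Psi$ of $\mathrm{L}^2(\mathbb{P})$ onto the direct integral $\int_S^\oplus H_s\,\mu(\mathrm{d}s)$ of a $\mu$-measurable field of $\mu$-a.e. non-zero separable Hilbert spaces, carrying $\mathcal{A}$ onto the algebra of diagonalizable operators. It always exists; $\mu$ is called the spectral measure, and pure atomicity of $\mu$ does not depend on the choice of the spectral resolution. 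*)

theory Defs
  imports "HOL-Probability.Probability"
begin

section \<open>Complete sub-sigma-fields\<close>

text \<open>A sub-sigma-field of \<open>sets M\<close> is represented by the set of its events.\<close>

definition essentially_separable :: "'a measure \<Rightarrow> bool" where
  "essentially_separable M \<longleftrightarrow>
     (\<exists>C. countable C \<and> C \<subseteq> sets M \<and> sets M = sigma_sets (space M) (C \<union> null_sets M))"

definition trivial_field :: "'a measure \<Rightarrow> 'a set set" where
  "trivial_field M = {A \<in> sets M. measure M A \<in> {0, 1}}"

definition complete_subfields :: "'a measure \<Rightarrow> 'a set set set" where
  "complete_subfields M =
     {x. sigma_algebra (space M) x \<and> trivial_field M \<subseteq> x \<and> x \<subseteq> sets M}"

definition Join :: "'a measure \<Rightarrow> 'a set set set \<Rightarrow> 'a set set" where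
  "Join M C = sigma_sets (space M) (trivial_field M \<union> \<Union>C)"

definition sigma_rv :: "'a measure \<Rightarrow> (nat \<Rightarrow> 'a \<Rightarrow> real) \<Rightarrow> nat set \<Rightarrow> 'a set set" where
  "sigma_rv M \<xi> I =
     sigma_sets (space M) (null_sets M \<union> (\<Union>n\<in>I. {\<xi> n -` A \<inter> space M | A. A \<in> sets borel}))"

definition random_sign :: "'a measure \<Rightarrow> ('a \<Rightarrow> real) \<Rightarrow> bool" where
  "random_sign M \<xi> \<longleftrightarrow> \<xi> \<in> borel_measurable M \<and>
     measure M {\<omega> \<in> space M. \<xi> \<omega> = 1} = 1 / 2 \<and>
     measure M {\<omega> \<in> space M. \<xi> \<omega> = - 1} = 1 / 2"

definition noise_Boolean_algebra :: "'a measure \<Rightarrow> 'a set set set \<Rightarrow> bool" where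
  "noise_Boolean_algebra M B \<longleftrightarrow>
     B \<noteq> {} \<and> B \<subseteq> complete_subfields M \<and>
     (\<forall>x\<in>B. \<forall>y\<in>B. x \<inter> y \<in> B \<and> Join M {x, y} \<in> B) \<and>
     (\<forall>x\<in>B. \<forall>y\<in>B. \<forall>z\<in>B. x \<inter> Join M {y, z} = Join M {x \<inter> y, x \<inter> z}) \<and>
     (\<forall>x\<in>B. \<exists>x'\<in>B. prob_space.indep_set M x x' \<and> Join M {x, x'} = sets M)"


section \<open>The Hilbert space of square-integrable functions\<close>

text \<open>Elements of \<open>L\<^sup>2\<close> are represented by functions, and identities between them are
  understood almost everywhere. Closures, lines and the spaces \<open>L\<^sup>2\<close> of complete
  sub-sigma-fields are closed under measurable modification on a null set, so equality between
  such sets of functions is equality of the corresponding sets of classes.\<close>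

definition L2 :: "'a measure \<Rightarrow> ('a \<Rightarrow> real) set" where
  "L2 M = {f \<in> borel_measurable M. integrable M (\<lambda>\<omega>. (f \<omega>)\<^sup>2)}"

definition L2_inner :: "'a measure \<Rightarrow> ('a \<Rightarrow> real) \<Rightarrow> ('a \<Rightarrow> real) \<Rightarrow> real" where
  "L2_inner M f g = (\<integral>\<omega>. f \<omega> * g \<omega> \<partial>M)"

definition L2_norm :: "'a measure \<Rightarrow> ('a \<Rightarrow> real) \<Rightarrow> real" where
  "L2_norm M f = sqrt (\<integral>\<omega>. (f \<omega>)\<^sup>2 \<partial>M)"

definition L2_zero :: "'a measure \<Rightarrow> ('a \<Rightarrow> real) set" where
  "L2_zero M = {f \<in> borel_measurable M. AE \<omega> in M. f \<omega> = 0}"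

definition L2_line :: "'a measure \<Rightarrow> ('a \<Rightarrow> real) \<Rightarrow> ('a \<Rightarrow> real) set" where
  "L2_line M \<xi> = {f \<in> borel_measurable M. \<exists>c. AE \<omega> in M. f \<omega> = c * \<xi> \<omega>}"

definition lin_span :: "('a \<Rightarrow> real) set \<Rightarrow> ('a \<Rightarrow> real) set" where
  "lin_span G = {\<lambda>\<omega>. \<Sum>g\<in>F. c g * g \<omega> | F c. finite F \<and> F \<subseteq> G}"

definition L2_closure :: "'a measure \<Rightarrow> ('a \<Rightarrow> real) set \<Rightarrow> ('a \<Rightarrow> real) set" where
  "L2_closure M G = {f \<in> L2 M. \<forall>\<epsilon>>0. \<exists>g\<in>G. L2_norm M (\<lambda>\<omega>. f \<omega> - g \<omega>) < \<epsilon>}"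

definition subfield_measure :: "'a measure \<Rightarrow> 'a set set \<Rightarrow> 'a measure" where
  "subfield_measure M x = restr_to_subalg M (sigma (space M) x)"

definition L2_sub :: "'a measure \<Rightarrow> 'a set set \<Rightarrow> ('a \<Rightarrow> real) set" where
  "L2_sub M x = L2 (subfield_measure M x)"

definition cexp :: "'a measure \<Rightarrow> 'a set set \<Rightarrow> ('a \<Rightarrow> real) \<Rightarrow> 'a \<Rightarrow> real" where
  "cexp M x f = real_cond_exp M (sigma (space M) x) f"

text \<open>Internal Hilbert-space direct sum: pairwise orthogonal summands, closed linear span.\<close>

definition is_L2_direct_sum ::
    "'a measure \<Rightarrow> 'i set \<Rightarrow> ('i \<Rightarrow> ('a \<Rightarrow> real) set) \<Rightarrow> ('a \<Rightarrow> real) set \<Rightarrow> bool" where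
  "is_L2_direct_sum M I V W \<longleftrightarrow>
     (\<forall>i\<in>I. \<forall>j\<in>I. i \<noteq> j \<longrightarrow> (\<forall>f\<in>V i. \<forall>g\<in>V j. L2_inner M f g = 0)) \<and>
     L2_closure M (lin_span (\<Union>i\<in>I. V i)) = W"


lemma cexp_L2:
  assumes M: "prob_space M" and x: "x \<in> complete_subfields M" and f: "f \<in> L2 M"
  shows "cexp M x f \<in> L2 M"
proof -
  interpret prob_space M by fact
  have x': "sigma_algebra (space M) x" "x \<subseteq> sets M" using x by (auto simp: complete_subfields_def)
  then have xP: "x \<subseteq> Pow (space M)" using sets.space_closed by blast
  have sets_x: "sets (sigma (space M) x) = x"
    using x' xP by (simp add: sigma_algebra.sigma_sets_eq)
  interpret finite_measure_subalgebra M "sigma (space M) x"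
    by unfold_locales (use x' xP sets_x in \<open>auto simp: subalgebra_def\<close>)
  have fm [measurable]: "f \<in> borel_measurable M" and f2: "integrable M (\<lambda>\<omega>. (f \<omega>)\<^sup>2)"
    using f by (auto simp: L2_def)
  have f1: "integrable M f" by (rule square_integrable_imp_integrable[OF fm f2])
  have "integrable M (\<lambda>\<omega>. (real_cond_exp M (sigma (space M) x) f \<omega>)\<^sup>2)"
    by (rule integrable_convex_cond_exp[where I = UNIV and q = "\<lambda>t. t\<^sup>2", OF f1])
       (auto simp: f2 convex_power2)
  then show ?thesis by (simp add: L2_def cexp_def)
qed

lemma L2_diff:
  assumes "f \<in> L2 M" "g \<in> L2 M"
  shows "(\<lambda>\<omega>. f \<omega> - g \<omega>) \<in> L2 M"
proof -
  have [measurable]: "f \<in> borel_measurable M" "g \<in> borel_measurable M"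
    and i: "integrable M (\<lambda>\<omega>. (f \<omega>)\<^sup>2)" "integrable M (\<lambda>\<omega>. (g \<omega>)\<^sup>2)"
    using assms by (auto simp: L2_def)
  have "integrable M (\<lambda>\<omega>. (f \<omega> - g \<omega>)\<^sup>2)"
  proof (rule Bochner_Integration.integrable_bound[where f = "\<lambda>\<omega>. 2 * (f \<omega>)\<^sup>2 + 2 * (g \<omega>)\<^sup>2"])
    show "AE \<omega> in M. norm ((f \<omega> - g \<omega>)\<^sup>2) \<le> norm (2 * (f \<omega>)\<^sup>2 + 2 * (g \<omega>)\<^sup>2)"
    proof (rule AE_I2)
      fix \<omega>
      have "(f \<omega> - g \<omega>)\<^sup>2 + (f \<omega> + g \<omega>)\<^sup>2 = 2 * (f \<omega>)\<^sup>2 + 2 * (g \<omega>)\<^sup>2"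
        by (simp add: power2_eq_square algebra_simps)
      then have "(f \<omega> - g \<omega>)\<^sup>2 \<le> 2 * (f \<omega>)\<^sup>2 + 2 * (g \<omega>)\<^sup>2"
        using zero_le_power2[of "f \<omega> + g \<omega>"] by linarith
      then show "norm ((f \<omega> - g \<omega>)\<^sup>2) \<le> norm (2 * (f \<omega>)\<^sup>2 + 2 * (g \<omega>)\<^sup>2)" by simp
    qed
  qed (use i in auto)
  then show ?thesis by (auto simp: L2_def)
qed

lemma L2_norm_triangle:
  assumes f: "f \<in> L2 M" and g: "g \<in> L2 M"
  shows "L2_norm M (\<lambda>\<omega>. f \<omega> + g \<omega>) \<le> L2_norm M f + L2_norm M g"
proof -
  have [measurable]: "f \<in> borel_measurable M" "g \<in> borel_measurable M"
    and i: "integrable M (\<lambda>\<omega>. (f \<omega>)\<^sup>2)" "integrable M (\<lambda>\<omega>. (g \<omega>)\<^sup>2)"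
    using assms by (auto simp: L2_def)
  define a b where "a = L2_norm M f" and "b = L2_norm M g"
  have ab: "0 \<le> a" "0 \<le> b" "a\<^sup>2 = (\<integral>\<omega>. (f \<omega>)\<^sup>2 \<partial>M)" "b\<^sup>2 = (\<integral>\<omega>. (g \<omega>)\<^sup>2 \<partial>M)"
    by (auto simp: a_def b_def L2_norm_def)
  have le: "L2_norm M (\<lambda>\<omega>. f \<omega> + g \<omega>) \<le> (a + \<epsilon>) + (b + \<epsilon>)" if e: "0 < \<epsilon>" for \<epsilon>
  proof -
    define p q where "p = a + \<epsilon>" and "q = b + \<epsilon>"
    have pq: "0 < p" "0 < q" "a\<^sup>2 \<le> p\<^sup>2" "b\<^sup>2 \<le> q\<^sup>2"
      using ab(1,2) e by (auto simp: p_def q_def intro!: power_mono)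
    have ptw: "(u + v)\<^sup>2 \<le> (1 + q / p) * u\<^sup>2 + (1 + p / q) * v\<^sup>2" for u v :: real
    proof -
      have "0 \<le> (q * u - p * v)\<^sup>2 / (p * q)" using pq by simp
      also have "\<dots> = (1 + q / p) * u\<^sup>2 + (1 + p / q) * v\<^sup>2 - (u + v)\<^sup>2"
        using pq by (simp add: field_simps power2_eq_square)
      finally show ?thesis by simp
    qed
    have "(\<integral>\<omega>. (f \<omega> + g \<omega>)\<^sup>2 \<partial>M) \<le> (\<integral>\<omega>. (1 + q / p) * (f \<omega>)\<^sup>2 + (1 + p / q) * (g \<omega>)\<^sup>2 \<partial>M)"
      by (rule integral_mono') (use i pq ptw in auto)
    also have "\<dots> = (1 + q / p) * a\<^sup>2 + (1 + p / q) * b\<^sup>2" using i ab by simp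
    also have "\<dots> \<le> (1 + q / p) * p\<^sup>2 + (1 + p / q) * q\<^sup>2"
      using pq by (intro add_mono mult_left_mono) auto
    also have "\<dots> = (p + q)\<^sup>2" using pq by (simp add: field_simps power2_eq_square)
    finally show ?thesis using pq unfolding L2_norm_def p_def[symmetric] q_def[symmetric]
      by (simp add: real_le_lsqrt)
  qed
  show ?thesis
  proof (rule field_le_epsilon)
    fix e :: real assume "0 < e"
    then show "L2_norm M (\<lambda>\<omega>. f \<omega> + g \<omega>) \<le> L2_norm M f + L2_norm M g + e"
      using le[of "e / 2"] by (simp add: a_def b_def)
  qed
qed


section \<open>The strong operator topology and the spaces attached to the closure\<close>

definition strong_topology :: "'a measure \<Rightarrow> 'a set set topology" where
  "strong_topology M = topology_generated_by
     {{y \<in> complete_subfields M. L2_norm M (\<lambda>\<omega>. cexp M y f \<omega> - cexp M x f \<omega>) < \<epsilon>} | x f \<epsilon>.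
       x \<in> complete_subfields M \<and> f \<in> L2 M \<and> 0 < \<epsilon>}"

lemma topspace_strong_topology: "topspace (strong_topology M) = complete_subfields M"
proof -
  have "(\<lambda>_. 0) \<in> L2 M" by (auto simp: L2_def)
  moreover have "x \<in> {y \<in> complete_subfields M.
      L2_norm M (\<lambda>\<omega>. cexp M y (\<lambda>_. 0) \<omega> - cexp M x (\<lambda>_. 0) \<omega>) < 1}"
    if "x \<in> complete_subfields M" for x using that by (simp add: L2_norm_def)
  ultimately show ?thesis
    unfolding strong_topology_def topology_generated_by_topspace
    by safe (rule UnionI, blast intro: zero_less_one, simp add: L2_norm_def)
qed

lemma limitin_strong_topology:
  assumes M: "prob_space M" and X: "\<And>n. X n \<in> complete_subfields M"
    and x: "x \<in> complete_subfields M"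
  shows "limitin (strong_topology M) X x sequentially \<longleftrightarrow>
           (\<forall>f\<in>L2 M. (\<lambda>n. L2_norm M (\<lambda>\<omega>. cexp M (X n) f \<omega> - cexp M x f \<omega>)) \<longlonglongrightarrow> 0)"
    (is "?L \<longleftrightarrow> ?R")
proof
  assume L: ?L
  show ?R
  proof (intro ballI tendstoI)
    fix f and e :: real assume f: "f \<in> L2 M" and e: "0 < e"
    let ?U = "{y \<in> complete_subfields M. L2_norm M (\<lambda>\<omega>. cexp M y f \<omega> - cexp M x f \<omega>) < e}"
    have "openin (strong_topology M) ?U"
      unfolding strong_topology_def
      by (rule topology_generated_by_Basis) (use f e x in blast)
    moreover have "x \<in> ?U" using x e by (simp add: L2_norm_def)
    ultimately have "\<forall>\<^sub>F n in sequentially. X n \<in> ?U" using L by (auto simp: limitin_def)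
    then show "\<forall>\<^sub>F n in sequentially. dist (L2_norm M (\<lambda>\<omega>. cexp M (X n) f \<omega> - cexp M x f \<omega>)) 0 < e"
      by eventually_elim (simp add: L2_norm_def)
  qed
next
  assume R: ?R
  have "\<forall>\<^sub>F n in sequentially. X n \<in> U"
    if "generate_topology_on {{y \<in> complete_subfields M. L2_norm M (\<lambda>\<omega>. cexp M y f \<omega> - cexp M z f \<omega>) < \<epsilon>} | z f \<epsilon>.
       z \<in> complete_subfields M \<and> f \<in> L2 M \<and> 0 < \<epsilon>} U" "x \<in> U" for U
    using that
  proof (induction rule: generate_topology_on.induct)
    case (Int a b) then show ?case by (auto intro: eventually_conj)
  next
    case (UN K)
    then obtain k where k: "k \<in> K" "x \<in> k" by blast
    then have "\<forall>\<^sub>F n in sequentially. X n \<in> k" using UN by blast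
    then show ?case by eventually_elim (use k in blast)
  next
    case (Basis s)
    then obtain z f \<epsilon> where z: "z \<in> complete_subfields M" and f: "f \<in> L2 M" and
      s: "s = {y \<in> complete_subfields M. L2_norm M (\<lambda>\<omega>. cexp M y f \<omega> - cexp M z f \<omega>) < \<epsilon>}"
      by blast
    let ?d = "\<lambda>u v. L2_norm M (\<lambda>\<omega>. cexp M u f \<omega> - cexp M v f \<omega>)"
    have "0 < \<epsilon> - ?d x z" using Basis(2) s by simp
    then have "\<forall>\<^sub>F n in sequentially. dist (?d (X n) x) 0 < \<epsilon> - ?d x z"
      using R f by (intro tendstoD) auto
    then show ?case
    proof eventually_elim
      case (elim n)
      have "?d (X n) z \<le> ?d (X n) x + ?d x z"
        using L2_norm_triangle[OF L2_diff[OF cexp_L2[OF M X[of n] f] cexp_L2[OF M x f]]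
            L2_diff[OF cexp_L2[OF M x f] cexp_L2[OF M z f]]] by simp
      then show ?case using elim X s by (simp add: L2_norm_def)
    qed
  qed auto
  then show ?L
    unfolding limitin_def
    unfolding topspace_strong_topology
    unfolding strong_topology_def openin_topology_generated_by_iff using x by blast
qed

definition Cl :: "'a measure \<Rightarrow> 'a set set set \<Rightarrow> 'a set set set" where
  "Cl M B = strong_topology M closure_of B"

definition L2_circ :: "'a measure \<Rightarrow> 'a set set set \<Rightarrow> 'a set set \<Rightarrow> ('a \<Rightarrow> real) set" where
  "L2_circ M B x =
     {f \<in> L2_sub M x.
        \<forall>g \<in> L2_closure M (lin_span (\<Union>y\<in>{y \<in> Cl M B. y \<subset> x}. L2_sub M y)). L2_inner M f g = 0}"

definition Cl_circ :: "'a measure \<Rightarrow> 'a set set set \<Rightarrow> 'a set set set" where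
  "Cl_circ M B = {x \<in> Cl M B. L2_circ M B x \<noteq> L2_zero M}"

definition circ :: "'a measure \<Rightarrow> 'a set set set \<Rightarrow> 'a set set set" where
  "circ M B = B \<inter> Cl_circ M B"


section \<open>Operator algebra of a noise Boolean algebra\<close>

definition L2_operator :: "'a measure \<Rightarrow> (('a \<Rightarrow> real) \<Rightarrow> 'a \<Rightarrow> real) \<Rightarrow> bool" where
  "L2_operator M T \<longleftrightarrow>
     (\<forall>f\<in>L2 M. T f \<in> L2 M) \<and>
     (\<forall>f\<in>L2 M. \<forall>g\<in>L2 M. AE \<omega> in M. T (\<lambda>\<omega>. f \<omega> + g \<omega>) \<omega> = T f \<omega> + T g \<omega>) \<and>
     (\<forall>c. \<forall>f\<in>L2 M. AE \<omega> in M. T (\<lambda>\<omega>. c * f \<omega>) \<omega> = c * T f \<omega>) \<and>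
     (\<exists>K. \<forall>f\<in>L2 M. L2_norm M (T f) \<le> K * L2_norm M f)"

definition cexp_span ::
    "'a measure \<Rightarrow> 'a set set set \<Rightarrow> (('a \<Rightarrow> real) \<Rightarrow> 'a \<Rightarrow> real) set" where
  "cexp_span M B = {\<lambda>f \<omega>. \<Sum>x\<in>C. c x * cexp M x f \<omega> | C c. finite C \<and> C \<subseteq> B}"

definition noise_operators ::
    "'a measure \<Rightarrow> 'a set set set \<Rightarrow> (('a \<Rightarrow> real) \<Rightarrow> 'a \<Rightarrow> real) set" where
  "noise_operators M B =
     {T. L2_operator M T \<and>
         (\<forall>F \<epsilon>. finite F \<and> F \<subseteq> L2 M \<and> 0 < \<epsilon> \<longrightarrow>
            (\<exists>A\<in>cexp_span M B. \<forall>f\<in>F. L2_norm M (\<lambda>\<omega>. T f \<omega> - A f \<omega>) < \<epsilon>))}"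


section \<open>Spectral resolutions\<close>

definition standard_borel_measure :: "'s measure \<Rightarrow> bool" where
  "standard_borel_measure N \<longleftrightarrow>
     (\<exists>X. topspace X = space N \<and> completely_metrizable_space X \<and> separable_space X \<and>
          sets N = sigma_sets (space N) {U. openin X U})"

text \<open>\<open>Z\<close> is the adjoined null set; completeness of \<open>S\<close> makes all its subsets measurable.\<close>

definition standard_measure_space :: "'s measure \<Rightarrow> bool" where
  "standard_measure_space S \<longleftrightarrow>
     complete_measure S \<and>
     (\<exists>Z\<in>null_sets S. \<exists>N. standard_borel_measure N \<and> sigma_finite_measure N \<and>
        restrict_space S (space S - Z) = completion N)"

definition measure_atom :: "'s measure \<Rightarrow> 's set \<Rightarrow> bool" where
  "measure_atom S A \<longleftrightarrow> A \<in> sets S \<and> emeasure S A > 0 \<and>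
     (\<forall>E\<in>sets S. E \<subseteq> A \<longrightarrow> emeasure S E = 0 \<or> emeasure S (A - E) = 0)"

definition purely_atomic :: "'s measure \<Rightarrow> bool" where
  "purely_atomic S \<longleftrightarrow>
     (\<forall>E\<in>sets S. emeasure S E > 0 \<longrightarrow> (\<exists>A. measure_atom S A \<and> A \<subseteq> E))"

text \<open>A real Hilbert space is given by a linear subspace \<open>V\<close> of an arbitrary real vector
  space type, which supplies only the linear structure, together with an inner product \<open>ip\<close>
  on \<open>V\<close>. This allows Hilbert spaces that vary with a parameter.\<close>

definition real_Hilbert_space ::
    "'h::real_vector set \<Rightarrow> ('h \<Rightarrow> 'h \<Rightarrow> real) \<Rightarrow> bool" where
  "real_Hilbert_space V ip \<longleftrightarrow>
     subspace V \<and>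
     (\<forall>u\<in>V. \<forall>v\<in>V. ip u v = ip v u) \<and>
     (\<forall>u\<in>V. \<forall>v\<in>V. \<forall>w\<in>V. ip (u + v) w = ip u w + ip v w) \<and>
     (\<forall>c. \<forall>u\<in>V. \<forall>v\<in>V. ip (c *\<^sub>R u) v = c * ip u v) \<and>
     (\<forall>u\<in>V. u \<noteq> 0 \<longrightarrow> 0 < ip u u) \<and>
     (\<forall>X::nat \<Rightarrow> 'h. range X \<subseteq> V \<and>
          (\<forall>\<epsilon>>0. \<exists>N. \<forall>m\<ge>N. \<forall>n\<ge>N. sqrt (ip (X m - X n) (X m - X n)) < \<epsilon>) \<longrightarrow>
          (\<exists>l\<in>V. (\<lambda>n. sqrt (ip (X n - l) (X n - l))) \<longlonglongrightarrow> 0))"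

text \<open>Measurable field of separable Hilbert spaces in the sense of Dixmier: \<open>\<Gamma>\<close> is the
  space of measurable vector fields, and the fundamental sequence \<open>e\<close> in particular makes every
  \<open>V s\<close> separable.\<close>

definition measurable_field ::
    "'s measure \<Rightarrow> ('s \<Rightarrow> 'h::real_vector set) \<Rightarrow> ('s \<Rightarrow> 'h \<Rightarrow> 'h \<Rightarrow> real) \<Rightarrow> ('s \<Rightarrow> 'h) set \<Rightarrow> bool"
where
  "measurable_field S V ip \<Gamma> \<longleftrightarrow>
     (\<forall>s\<in>space S. real_Hilbert_space (V s) (ip s)) \<and>
     (\<forall>v\<in>\<Gamma>. \<forall>s\<in>space S. v s \<in> V s) \<and>
     (\<forall>v\<in>\<Gamma>. \<forall>w\<in>\<Gamma>. (\<lambda>s. v s + w s) \<in> \<Gamma>) \<and>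
     (\<forall>c. \<forall>v\<in>\<Gamma>. (\<lambda>s. c *\<^sub>R v s) \<in> \<Gamma>) \<and>
     (\<forall>v\<in>\<Gamma>. (\<lambda>s. sqrt (ip s (v s) (v s))) \<in> borel_measurable S) \<and>
     (\<forall>v. (\<forall>s\<in>space S. v s \<in> V s) \<and>
          (\<forall>w\<in>\<Gamma>. (\<lambda>s. ip s (v s) (w s)) \<in> borel_measurable S) \<longrightarrow> v \<in> \<Gamma>) \<and>
     (\<exists>e::nat \<Rightarrow> 's \<Rightarrow> 'h. range e \<subseteq> \<Gamma> \<and>
        (\<forall>s\<in>space S. \<forall>v\<in>V s. \<forall>\<epsilon>>0. \<exists>w\<in>span (range (\<lambda>n. e n s)).
            sqrt (ip s (v - w) (v - w)) < \<epsilon>))"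

definition direct_integral ::
    "'s measure \<Rightarrow> ('s \<Rightarrow> 'h \<Rightarrow> 'h \<Rightarrow> real) \<Rightarrow> ('s \<Rightarrow> 'h) set \<Rightarrow> ('s \<Rightarrow> 'h) set" where
  "direct_integral S ip \<Gamma> = {v \<in> \<Gamma>. integrable S (\<lambda>s. ip s (v s) (v s))}"

definition unitary_onto_direct_integral ::
    "'a measure \<Rightarrow> 's measure \<Rightarrow> ('s \<Rightarrow> 'h::real_vector \<Rightarrow> 'h \<Rightarrow> real) \<Rightarrow> ('s \<Rightarrow> 'h) set \<Rightarrow>
     (('a \<Rightarrow> real) \<Rightarrow> 's \<Rightarrow> 'h) \<Rightarrow> bool" where
  "unitary_onto_direct_integral M S ip \<Gamma> \<Psi> \<longleftrightarrow>
     (\<forall>f\<in>L2 M. \<Psi> f \<in> direct_integral S ip \<Gamma>) \<and>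
     (\<forall>f\<in>L2 M. \<forall>g\<in>L2 M. AE s in S. \<Psi> (\<lambda>\<omega>. f \<omega> + g \<omega>) s = \<Psi> f s + \<Psi> g s) \<and>
     (\<forall>c. \<forall>f\<in>L2 M. AE s in S. \<Psi> (\<lambda>\<omega>. c * f \<omega>) s = c *\<^sub>R \<Psi> f s) \<and>
     (\<forall>f\<in>L2 M. \<forall>g\<in>L2 M. (\<integral>s. ip s (\<Psi> f s) (\<Psi> g s) \<partial>S) = L2_inner M f g) \<and>
     (\<forall>v\<in>direct_integral S ip \<Gamma>. \<exists>f\<in>L2 M. AE s in S. \<Psi> f s = v s)"

text \<open>The operator \<open>T\<close> on \<open>L2 M\<close>, transported by \<open>\<Psi>\<close>, is multiplication by an essentially
  bounded measurable scalar function \<open>\<phi>\<close>.\<close>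

definition diagonalized_by ::
    "'a measure \<Rightarrow> 's measure \<Rightarrow> (('a \<Rightarrow> real) \<Rightarrow> 's \<Rightarrow> 'h::real_vector) \<Rightarrow>
     (('a \<Rightarrow> real) \<Rightarrow> 'a \<Rightarrow> real) \<Rightarrow> bool" where
  "diagonalized_by M S \<Psi> T \<longleftrightarrow>
     (\<exists>\<phi>\<in>borel_measurable S. (\<exists>K. AE s in S. \<bar>\<phi> s\<bar> \<le> K) \<and>
        (\<forall>f\<in>L2 M. AE s in S. \<Psi> (T f) s = (\<phi> s :: real) *\<^sub>R \<Psi> f s))"

text \<open>The last clause says that \<open>\<Psi>\<close> carries the operator algebra of \<open>B\<close> onto the
  algebra of all diagonalizable operators on the direct integral.\<close>

definition spectral_resolution ::
    "'a measure \<Rightarrow> 'a set set set \<Rightarrow> 's measure \<Rightarrow> ('s \<Rightarrow> 'h::real_vector set) \<Rightarrow>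
     ('s \<Rightarrow> 'h \<Rightarrow> 'h \<Rightarrow> real) \<Rightarrow> ('s \<Rightarrow> 'h) set \<Rightarrow> (('a \<Rightarrow> real) \<Rightarrow> 's \<Rightarrow> 'h) \<Rightarrow> bool" where
  "spectral_resolution M B S V ip \<Gamma> \<Psi> \<longleftrightarrow>
     standard_measure_space S \<and>
     measurable_field S V ip \<Gamma> \<and>
     (AE s in S. V s \<noteq> {0}) \<and>
     unitary_onto_direct_integral M S ip \<Gamma> \<Psi> \<and>
     noise_operators M B = {T. L2_operator M T \<and> diagonalized_by M S \<Psi> T}"

text \<open>The condition \<open>(\<ast>)\<close>; \<open>S\<close> is the spectral measure of a spectral resolution of \<open>B\<close>.\<close>

definition star_condition :: "'a measure \<Rightarrow> 'a set set set \<Rightarrow> 's measure \<Rightarrow> bool" where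
  "star_condition M B S \<longleftrightarrow> circ M B = Cl_circ M B \<and> purely_atomic S"


section \<open>Noise Boolean algebra of a decreasing sequence\<close>

text \<open>Sequences are indexed from \<open>0\<close>, so that \<open>x 0\<close>, \<open>y 0\<close> are the first terms.\<close>

definition sequence_algebra ::
    "'a measure \<Rightarrow> (nat \<Rightarrow> 'a set set) \<Rightarrow> (nat \<Rightarrow> 'a set set) \<Rightarrow> 'a set set set" where
  "sequence_algebra M x y = (\<Union>n. {Join M C | C. C \<subseteq> insert (x (Suc n)) (y ` {..n})})"

definition product_type :: "'a measure \<Rightarrow> (nat \<Rightarrow> 'a set set) \<Rightarrow> bool" where
  "product_type M x \<longleftrightarrow>
     (\<exists>z. (\<forall>n. z n \<in> complete_subfields M) \<and> prob_space.indep_sets M z UNIV \<and>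
          (\<forall>n. x n = Join M {z k | k. n \<le> k}))"

end

(* Conditional expectations on the elements of B commute, so f is an eigenvector of all of them
   precisely when it lies in one of the spaces L2_circ M B w with w in Cl M B, where w is the
   intersection of the b in B that fix f.

   The space of level n is eta n times the space of level n + 1. Hence the product of two of its
   elements is unchanged if both are multiplied by eta n, eta (n + 1), ..., so it is measurable
   with respect to every x m and is therefore constant: the space is {0} or the line of a sign.

   If mu is purely atomic, vectors carried by an atom are common eigenvectors and they are total;
   if moreover no w outside B occurs, L2 is the span of the spaces of the elements of B, that is,
   of products of the xi n (or of the eta n in the degenerate case). Conversely, if these products
   are total, then every operator of the algebra is diagonal in them, and the support of each of
   them in the spectral space is an atom.

   Signs that generate everything, each of them independent of the next x, generate every x n:
   a vector of L2 of x n that is orthogonal to the products of the later signs is orthogonal to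
   all products, because the first earlier sign can be integrated out. *)

theory Submission
  imports Defs
begin

section \<open>The inner product space of square-integrable functions\<close>

text \<open>A trivial tail does not say which signs generate the fields. Suppose that independent
  signs \<xi> k generate everything, that \<open>x n\<close> is generated by those with k \<ge> n,
  and that \<eta> n is the product of \<xi> n and \<xi> (n + 1). Then all hypotheses hold, yet the
  \<eta> n together cannot see a simultaneous change of sign of all \<xi> k. So the \<eta> n need
  not generate, and \<open>star_condition\<close> has to enter through totality of the spaces
  \<open>L2_circ\<close>.

  The elements of the closure outside \<open>B\<close> are never described. What is needed about
  them is an alternative (every field of \<open>B\<close> kills f or fixes g) that survives strong
  limits. The only elements of the closure that are constructed are intersections of decreasing
  sequences in \<open>B\<close>; these suffice because \<open>B\<close> is countable and closed
  under intersection.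

  The spectral resolution is arbitrary, with fibres that vary from point to point. Two facts link it
  to probability: multiplication by an indicator belongs to the algebra, and a conditional
  expectation, being idempotent, becomes multiplication by a function that is 0 or 1 on the support
  of any vector.\<close>

lemma L2_measurable [measurable_dest]: "f \<in> L2 M \<Longrightarrow> f \<in> borel_measurable M"
  by (simp add: L2_def)

lemma L2_mult_integrable:
  assumes "f \<in> L2 M" "g \<in> L2 M"
  shows "integrable M (\<lambda>\<omega>. f \<omega> * g \<omega>)"
proof (rule Bochner_Integration.integrable_bound[where f = "\<lambda>\<omega>. (f \<omega>)\<^sup>2 + (g \<omega>)\<^sup>2"])
  show "AE \<omega> in M. norm (f \<omega> * g \<omega>) \<le> norm ((f \<omega>)\<^sup>2 + (g \<omega>)\<^sup>2)"
  proof (rule AE_I2)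
    fix \<omega>
    have "2 * (\<bar>f \<omega>\<bar> * \<bar>g \<omega>\<bar>) \<le> (f \<omega>)\<^sup>2 + (g \<omega>)\<^sup>2"
      using sum_squares_bound[of "\<bar>f \<omega>\<bar>" "\<bar>g \<omega>\<bar>"] by (simp add: mult.assoc)
    moreover have "0 \<le> \<bar>f \<omega>\<bar> * \<bar>g \<omega>\<bar>" by simp
    ultimately have "\<bar>f \<omega>\<bar> * \<bar>g \<omega>\<bar> \<le> (f \<omega>)\<^sup>2 + (g \<omega>)\<^sup>2" by linarith
    then show "norm (f \<omega> * g \<omega>) \<le> norm ((f \<omega>)\<^sup>2 + (g \<omega>)\<^sup>2)"
      by (simp add: abs_mult)
  qed
qed (use assms in \<open>auto simp: L2_def\<close>)

lemma L2_zero_fun: "(\<lambda>_. 0) \<in> L2 M"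
  by (simp add: L2_def)

lemma L2_cmult: "f \<in> L2 M \<Longrightarrow> (\<lambda>\<omega>. c * f \<omega>) \<in> L2 M"
  by (auto simp: L2_def power_mult_distrib)

lemma L2_add:
  assumes "f \<in> L2 M" "g \<in> L2 M"
  shows "(\<lambda>\<omega>. f \<omega> + g \<omega>) \<in> L2 M"
  using L2_diff[OF assms(1) L2_cmult[OF assms(2), of "- 1"]] by simp

lemma L2_sum: "(\<And>i. i \<in> I \<Longrightarrow> f i \<in> L2 M) \<Longrightarrow> (\<lambda>\<omega>. \<Sum>i\<in>I. f i \<omega>) \<in> L2 M"
  by (induction I rule: infinite_finite_induct) (auto simp: L2_zero_fun L2_add)

lemma L2_bounded_mult:
  assumes f: "f \<in> L2 M" and [measurable]: "s \<in> borel_measurable M" and s: "AE \<omega> in M. \<bar>s \<omega>\<bar> \<le> K"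
  shows "(\<lambda>\<omega>. s \<omega> * f \<omega>) \<in> L2 M"
proof -
  have "integrable M (\<lambda>\<omega>. (s \<omega> * f \<omega>)\<^sup>2)"
  proof (rule Bochner_Integration.integrable_bound[where f = "\<lambda>\<omega>. K\<^sup>2 * (f \<omega>)\<^sup>2"])
    show "AE \<omega> in M. norm ((s \<omega> * f \<omega>)\<^sup>2) \<le> norm (K\<^sup>2 * (f \<omega>)\<^sup>2)"
      using s
    proof eventually_elim
      case (elim \<omega>)
      then have "(s \<omega>)\<^sup>2 \<le> K\<^sup>2" by (simp add: abs_le_square_iff[symmetric])
      then show ?case by (auto simp: power_mult_distrib intro: mult_right_mono)
    qed
  qed (use f in \<open>auto simp: L2_def\<close>)
  then show ?thesis using L2_measurable[OF f] by (simp add: L2_def)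
qed

lemma L2_indicator_mult:
  assumes "f \<in> L2 M" "E \<in> sets M"
  shows "(\<lambda>\<omega>. indicator E \<omega> * f \<omega>) \<in> L2 M"
  using assms by (intro L2_bounded_mult[where K = 1]) (auto split: split_indicator)

lemma L2_cong_AE:
  assumes "f \<in> L2 M" "g \<in> borel_measurable M" "AE \<omega> in M. f \<omega> = g \<omega>"
  shows "g \<in> L2 M"
proof -
  have "integrable M (\<lambda>\<omega>. (f \<omega>)\<^sup>2) \<longleftrightarrow> integrable M (\<lambda>\<omega>. (g \<omega>)\<^sup>2)"
    using assms by (intro integrable_cong_AE) (auto simp: L2_def)
  then show ?thesis using assms by (auto simp: L2_def)
qed

lemma L2_inner_commute: "L2_inner M f g = L2_inner M g f"
  by (simp add: L2_inner_def mult.commute)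

lemma L2_inner_cmult_left: "L2_inner M (\<lambda>\<omega>. c * f \<omega>) g = c * L2_inner M f g"
  by (simp add: L2_inner_def mult.assoc)

lemma L2_inner_add_left:
  assumes "f \<in> L2 M" "g \<in> L2 M" "h \<in> L2 M"
  shows "L2_inner M (\<lambda>\<omega>. f \<omega> + g \<omega>) h = L2_inner M f h + L2_inner M g h"
  using L2_mult_integrable[OF assms(1,3)] L2_mult_integrable[OF assms(2,3)]
  by (simp add: L2_inner_def distrib_right)

lemma L2_inner_diff_left:
  assumes "f \<in> L2 M" "g \<in> L2 M" "h \<in> L2 M"
  shows "L2_inner M (\<lambda>\<omega>. f \<omega> - g \<omega>) h = L2_inner M f h - L2_inner M g h"
  using L2_mult_integrable[OF assms(1,3)] L2_mult_integrable[OF assms(2,3)]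
  by (simp add: L2_inner_def left_diff_distrib)

lemma L2_inner_sum_left:
  assumes "\<And>i. i \<in> I \<Longrightarrow> f i \<in> L2 M" "h \<in> L2 M"
  shows "L2_inner M (\<lambda>\<omega>. \<Sum>i\<in>I. f i \<omega>) h = (\<Sum>i\<in>I. L2_inner M (f i) h)"
  using assms
proof (induction I rule: infinite_finite_induct)
  case (insert i I)
  then show ?case by (simp add: L2_inner_add_left L2_sum)
qed (auto simp: L2_inner_def)

lemma L2_inner_cong:
  assumes "f \<in> borel_measurable M" "f' \<in> borel_measurable M"
    "g \<in> borel_measurable M" "g' \<in> borel_measurable M"
    "AE \<omega> in M. f \<omega> = f' \<omega>" "AE \<omega> in M. g \<omega> = g' \<omega>"
  shows "L2_inner M f g = L2_inner M f' g'"
  unfolding L2_inner_def using assms by (intro integral_cong_AE) auto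

lemma L2_norm_nonneg [simp]: "0 \<le> L2_norm M f"
  by (simp add: L2_norm_def)

lemma L2_norm_power2: "(L2_norm M f)\<^sup>2 = L2_inner M f f"
  by (simp add: L2_norm_def L2_inner_def power2_eq_square)

lemma L2_norm_eq_0_iff: "f \<in> L2 M \<Longrightarrow> L2_norm M f = 0 \<longleftrightarrow> (AE \<omega> in M. f \<omega> = 0)"
  using integral_nonneg_eq_0_iff_AE[of M "\<lambda>\<omega>. (f \<omega>)\<^sup>2"] by (simp add: L2_norm_def L2_def)

lemma L2_norm_cong:
  assumes "f \<in> borel_measurable M" "g \<in> borel_measurable M" "AE \<omega> in M. f \<omega> = g \<omega>"
  shows "L2_norm M f = L2_norm M g"
proof -
  have "(\<integral>\<omega>. (f \<omega>)\<^sup>2 \<partial>M) = (\<integral>\<omega>. (g \<omega>)\<^sup>2 \<partial>M)" using assms by (intro integral_cong_AE) auto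
  then show ?thesis by (simp add: L2_norm_def)
qed

lemma L2_norm_cmult: "L2_norm M (\<lambda>\<omega>. c * f \<omega>) = \<bar>c\<bar> * L2_norm M f"
  by (simp add: L2_norm_def power_mult_distrib real_sqrt_mult)

lemma L2_norm_minus_commute: "L2_norm M (\<lambda>\<omega>. f \<omega> - g \<omega>) = L2_norm M (\<lambda>\<omega>. g \<omega> - f \<omega>)"
  by (simp add: L2_norm_def power2_commute)

lemma L2_norm_triangle_diff:
  assumes "f \<in> L2 M" "g \<in> L2 M" "h \<in> L2 M"
  shows "L2_norm M (\<lambda>\<omega>. f \<omega> - h \<omega>) \<le> L2_norm M (\<lambda>\<omega>. f \<omega> - g \<omega>) + L2_norm M (\<lambda>\<omega>. g \<omega> - h \<omega>)"
  using L2_norm_triangle[OF L2_diff[OF assms(1,2)] L2_diff[OF assms(2,3)]] by simp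

lemma L2_norm_add_power2:
  assumes "f \<in> L2 M" "g \<in> L2 M"
  shows "(L2_norm M (\<lambda>\<omega>. f \<omega> + g \<omega>))\<^sup>2 = (L2_norm M f)\<^sup>2 + 2 * L2_inner M f g + (L2_norm M g)\<^sup>2"
proof -
  let ?fg = "\<lambda>\<omega>. f \<omega> + g \<omega>"
  have "L2_inner M ?fg ?fg = L2_inner M f ?fg + L2_inner M g ?fg"
    by (intro L2_inner_add_left assms L2_add)
  also have "L2_inner M f ?fg = L2_inner M f f + L2_inner M g f"
    by (subst L2_inner_commute) (intro L2_inner_add_left assms L2_add)
  also have "L2_inner M g ?fg = L2_inner M f g + L2_inner M g g"
    by (subst L2_inner_commute) (intro L2_inner_add_left assms L2_add)
  finally show ?thesis by (simp add: L2_norm_power2 L2_inner_commute[of M g f])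
qed

lemma L2_norm_diff_power2:
  assumes "f \<in> L2 M" "g \<in> L2 M"
  shows "(L2_norm M (\<lambda>\<omega>. f \<omega> - g \<omega>))\<^sup>2 = (L2_norm M f)\<^sup>2 - 2 * L2_inner M f g + (L2_norm M g)\<^sup>2"
proof -
  have "L2_inner M f (\<lambda>\<omega>. - 1 * g \<omega>) = - L2_inner M f g"
    by (subst L2_inner_commute, subst L2_inner_cmult_left) (simp add: L2_inner_commute)
  then show ?thesis
    using L2_norm_add_power2[OF assms(1) L2_cmult[OF assms(2), of "- 1"]] L2_norm_cmult[of M "- 1" g]
    by simp
qed

text \<open>Squaring the triangle inequality, which was proved without Cauchy-Schwarz, gives the
  upper bound; replacing f by -f gives the absolute value.\<close>

lemma L2_inner_le_norm:
  assumes "f \<in> L2 M" "g \<in> L2 M"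
  shows "\<bar>L2_inner M f g\<bar> \<le> L2_norm M f * L2_norm M g"
proof -
  have le: "L2_inner M f g \<le> L2_norm M f * L2_norm M g" if "f \<in> L2 M" "g \<in> L2 M" for f g
  proof -
    have "(L2_norm M (\<lambda>\<omega>. f \<omega> + g \<omega>))\<^sup>2 \<le> (L2_norm M f + L2_norm M g)\<^sup>2"
      using L2_norm_triangle[OF that] by (intro power_mono) auto
    then show ?thesis unfolding L2_norm_add_power2[OF that] by (simp add: power2_sum)
  qed
  from le[OF assms] le[OF L2_cmult[OF assms(1), of "- 1"] assms(2)]
  show ?thesis using L2_norm_cmult[of M "- 1" f] L2_inner_cmult_left[of M "- 1" f g] by simp
qed

section \<open>Finite linear combinations\<close>

lemma lin_span_base: "g \<in> G \<Longrightarrow> g \<in> lin_span G"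
  unfolding lin_span_def by (rule CollectI, rule exI[of _ "{g}"], rule exI[of _ "\<lambda>_. 1"]) simp

lemma lin_span_add:
  assumes "g \<in> lin_span G" "h \<in> lin_span G"
  shows "(\<lambda>\<omega>. g \<omega> + h \<omega>) \<in> lin_span G"
proof -
  obtain F c where F: "finite F" "F \<subseteq> G" and g: "g = (\<lambda>\<omega>. \<Sum>u\<in>F. c u * u \<omega>)"
    using assms(1) unfolding lin_span_def mem_Collect_eq by (elim exE conjE)
  obtain F' c' where F': "finite F'" "F' \<subseteq> G" and h: "h = (\<lambda>\<omega>. \<Sum>u\<in>F'. c' u * u \<omega>)"
    using assms(2) unfolding lin_span_def mem_Collect_eq by (elim exE conjE)
  \<comment> \<open>Both coefficient families are extended by zero to F \<union> F', where a common
    element receives the sum of its coefficients.\<close>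
  let ?d = "\<lambda>u. (if u \<in> F then c u else 0) + (if u \<in> F' then c' u else 0)"
  have "(\<Sum>u\<in>F \<union> F'. ?d u * u \<omega>) = g \<omega> + h \<omega>" for \<omega>
  proof -
    have "(\<Sum>u\<in>F. c u * u \<omega>) = (\<Sum>u\<in>F \<union> F'. (if u \<in> F then c u else 0) * u \<omega>)"
      using F(1) F'(1) by (intro sum.mono_neutral_cong_left) auto
    moreover have "(\<Sum>u\<in>F'. c' u * u \<omega>) = (\<Sum>u\<in>F \<union> F'. (if u \<in> F' then c' u else 0) * u \<omega>)"
      using F(1) F'(1) by (intro sum.mono_neutral_cong_left) auto
    ultimately show ?thesis by (simp only: g h distrib_right sum.distrib)
  qed
  then have "(\<lambda>\<omega>. g \<omega> + h \<omega>) = (\<lambda>\<omega>. \<Sum>u\<in>F \<union> F'. ?d u * u \<omega>)" by simp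
  then show ?thesis
    unfolding lin_span_def using F F' by (intro CollectI exI[of _ "F \<union> F'"] exI[of _ ?d]) simp
qed

lemma lin_span_cmult:
  assumes "g \<in> lin_span G"
  shows "(\<lambda>\<omega>. a * g \<omega>) \<in> lin_span G"
proof -
  obtain F c where F: "finite F" "F \<subseteq> G" and g: "g = (\<lambda>\<omega>. \<Sum>u\<in>F. c u * u \<omega>)"
    using assms unfolding lin_span_def mem_Collect_eq by (elim exE conjE)
  have "(\<lambda>\<omega>. a * g \<omega>) = (\<lambda>\<omega>. \<Sum>u\<in>F. (a * c u) * u \<omega>)"
    unfolding g by (simp only: sum_distrib_left mult.assoc)
  then show ?thesis
    unfolding lin_span_def using F by (intro CollectI exI[of _ F] exI[of _ "\<lambda>u. a * c u"]) simp
qed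


section \<open>Completeness and orthogonal projection\<close>

context prob_space
begin

abbreviation ae_eq :: "('a \<Rightarrow> 'b) \<Rightarrow> ('a \<Rightarrow> 'b) \<Rightarrow> bool" (infix "\<doteq>" 50) where
  "f \<doteq> g \<equiv> AE \<omega> in M. f \<omega> = g \<omega>"

lemma L2_const: "(\<lambda>_. c) \<in> L2 M"
  by (simp add: L2_def)

lemma L2_integrable: "f \<in> L2 M \<Longrightarrow> integrable M f"
  using L2_mult_integrable[OF _ L2_const[of 1], of f] by simp

lemma L2_bounded:
  assumes [measurable]: "s \<in> borel_measurable M" and "AE \<omega> in M. \<bar>s \<omega>\<bar> \<le> K"
  shows "s \<in> L2 M"
  using L2_bounded_mult[OF L2_const[of 1] assms] by simp

lemma L2_indicator: "E \<in> sets M \<Longrightarrow> (indicator E :: 'a \<Rightarrow> real) \<in> L2 M"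
  by (rule L2_bounded[where K = 1]) (auto split: split_indicator)

lemma integral_abs_le_L2_norm:
  assumes f: "f \<in> L2 M"
  shows "(\<integral>\<omega>. \<bar>f \<omega>\<bar> \<partial>M) \<le> L2_norm M f"
proof -
  have abs: "(\<lambda>\<omega>. \<bar>f \<omega>\<bar>) \<in> L2 M" using f by (auto simp: L2_def)
  have "(\<integral>\<omega>. \<bar>f \<omega>\<bar> \<partial>M) = L2_inner M (\<lambda>\<omega>. \<bar>f \<omega>\<bar>) (\<lambda>_. 1)" by (simp add: L2_inner_def)
  also have "\<dots> \<le> L2_norm M (\<lambda>\<omega>. \<bar>f \<omega>\<bar>) * L2_norm M (\<lambda>_. 1)"
    using L2_inner_le_norm[OF abs L2_const[of 1]] by linarith
  also have "\<dots> = L2_norm M f" by (simp add: L2_norm_def prob_space)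
  finally show ?thesis .
qed

text \<open>Riesz-Fischer. Along a subsequence with geometrically small increments the telescoping
  series converges absolutely almost everywhere; Fatou's lemma turns its limit into a limit in norm
  of the whole sequence.\<close>

theorem L2_complete:
  assumes X: "\<And>n. X n \<in> L2 M"
    and Cauchy: "\<And>e. 0 < e \<Longrightarrow> \<exists>N. \<forall>m\<ge>N. \<forall>n\<ge>N. L2_norm M (\<lambda>\<omega>. X m \<omega> - X n \<omega>) < e"
  obtains l where "l \<in> L2 M" "(\<lambda>n. L2_norm M (\<lambda>\<omega>. X n \<omega> - l \<omega>)) \<longlonglongrightarrow> 0"
proof -
  have [measurable]: "X n \<in> borel_measurable M" for n using X by (rule L2_measurable)
  obtain N where N: "\<And>k m n. m \<ge> N k \<Longrightarrow> n \<ge> N k \<Longrightarrow> L2_norm M (\<lambda>\<omega>. X m \<omega> - X n \<omega>) < (1/2)^k"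
    using Cauchy[of "(1/2)^k" for k] by (metis zero_less_power half_gt_zero zero_less_one)
  \<comment> \<open>Summing N makes \<open>r\<close> monotone and at least \<open>N\<close>; the
    added k gives \<open>k \<le> r k\<close>, so that \<open>j \<ge> N k\<close> suffices for
    \<open>r j \<ge> N k\<close>.\<close>
  define r where "r = (\<lambda>k. (\<Sum>i\<le>k. N i) + k)"
  have rN: "N k \<le> r k" for k
    using member_le_sum[of k "{..k}" N] by (simp add: r_def trans_le_add1)
  have r_mono: "r k \<le> r (Suc k)" for k by (simp add: r_def)
  have r_ge: "k \<le> r k" for k by (simp add: r_def)
  define d where "d = (\<lambda>k \<omega>. X (r (Suc k)) \<omega> - X (r k) \<omega>)"
  have dL: "d k \<in> L2 M" for k unfolding d_def by (intro L2_diff X)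
  have [measurable]: "d k \<in> borel_measurable M" for k using dL by (rule L2_measurable)
  have d1: "(\<integral>\<^sup>+\<omega>. ennreal \<bar>d k \<omega>\<bar> \<partial>M) \<le> ennreal ((1/2)^k)" for k
  proof -
    have "(\<integral>\<^sup>+\<omega>. ennreal \<bar>d k \<omega>\<bar> \<partial>M) = ennreal (\<integral>\<omega>. \<bar>d k \<omega>\<bar> \<partial>M)"
      using L2_integrable[OF dL] by (intro nn_integral_eq_integral) auto
    also have "(\<integral>\<omega>. \<bar>d k \<omega>\<bar> \<partial>M) \<le> L2_norm M (d k)" by (rule integral_abs_le_L2_norm[OF dL])
    also have "\<dots> \<le> (1/2)^k"
      unfolding d_def using N[of k "r (Suc k)" "r k"] rN[of k] r_mono[of k] by simp
    finally show ?thesis by (simp add: ennreal_leI)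
  qed
  have "(\<integral>\<^sup>+\<omega>. (\<Sum>k. ennreal \<bar>d k \<omega>\<bar>) \<partial>M) = (\<Sum>k. \<integral>\<^sup>+\<omega>. ennreal \<bar>d k \<omega>\<bar> \<partial>M)"
    by (rule nn_integral_suminf) simp
  also have "\<dots> \<le> (\<Sum>k. ennreal ((1/2)^k))" by (intro suminf_le d1) auto
  also have "\<dots> = ennreal (\<Sum>k. (1/2)^k)" by (rule suminf_ennreal2) (auto simp: summable_geometric)
  also have "\<dots> < \<top>" by simp
  finally have "(\<integral>\<^sup>+\<omega>. (\<Sum>k. ennreal \<bar>d k \<omega>\<bar>) \<partial>M) \<noteq> \<infinity>" by simp
  then have "AE \<omega> in M. (\<Sum>k. ennreal \<bar>d k \<omega>\<bar>) \<noteq> \<infinity>"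
    by (rule nn_integral_PInf_AE[rotated]) simp
  then have conv: "AE \<omega> in M. convergent (\<lambda>k. X (r k) \<omega>)"
  proof eventually_elim
    case (elim \<omega>)
    then have "summable (\<lambda>k. \<bar>d k \<omega>\<bar>)" by (intro summable_suminf_not_top) auto
    then have "summable (\<lambda>k. d k \<omega>)" by (rule summable_rabs_cancel)
    then have "convergent (\<lambda>n. \<Sum>k<n. d k \<omega>)" by (simp add: summable_iff_convergent)
    moreover have "(\<Sum>k<n. d k \<omega>) = X (r n) \<omega> - X (r 0) \<omega>" for n
      unfolding d_def by (rule sum_lessThan_telescope)
    ultimately have "convergent (\<lambda>n. X (r n) \<omega> - X (r 0) \<omega> + X (r 0) \<omega>)"
      by (intro convergent_add) (auto simp: convergent_const)
    then show ?case by simp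
  qed
  \<comment> \<open>Where the sequence diverges, \<open>lim\<close> is an arbitrary value; this
    happens on a null set only.\<close>
  define l where "l = (\<lambda>\<omega>. lim (\<lambda>k. X (r k) \<omega>))"
  have [measurable]: "l \<in> borel_measurable M" unfolding l_def by measurable
  have lim: "AE \<omega> in M. (\<lambda>k. X (r k) \<omega>) \<longlonglongrightarrow> l \<omega>"
    using conv by eventually_elim (simp add: l_def convergent_LIMSEQ_iff)
  have fatou: "(\<integral>\<^sup>+\<omega>. ennreal ((X m \<omega> - l \<omega>)\<^sup>2) \<partial>M) \<le> ennreal (((1/2)^k)\<^sup>2)" if "m \<ge> N k" for m k
  proof -
    have "(\<integral>\<^sup>+\<omega>. ennreal ((X m \<omega> - l \<omega>)\<^sup>2) \<partial>M)
        = (\<integral>\<^sup>+\<omega>. liminf (\<lambda>j. ennreal ((X m \<omega> - X (r j) \<omega>)\<^sup>2)) \<partial>M)"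
    proof (rule nn_integral_cong_AE)
      show "AE \<omega> in M. ennreal ((X m \<omega> - l \<omega>)\<^sup>2) = liminf (\<lambda>j. ennreal ((X m \<omega> - X (r j) \<omega>)\<^sup>2))"
        using lim
      proof eventually_elim
        case (elim \<omega>)
        then have "(\<lambda>j. ennreal ((X m \<omega> - X (r j) \<omega>)\<^sup>2)) \<longlonglongrightarrow> ennreal ((X m \<omega> - l \<omega>)\<^sup>2)"
          by (intro tendsto_ennrealI tendsto_intros)
        then show ?case by (intro lim_imp_Liminf[symmetric]) auto
      qed
    qed
    also have "\<dots> \<le> liminf (\<lambda>j. \<integral>\<^sup>+\<omega>. ennreal ((X m \<omega> - X (r j) \<omega>)\<^sup>2) \<partial>M)"
      by (rule nn_integral_liminf) measurable
    also have "\<dots> \<le> limsup (\<lambda>j. \<integral>\<^sup>+\<omega>. ennreal ((X m \<omega> - X (r j) \<omega>)\<^sup>2) \<partial>M)"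
      by (rule Liminf_le_Limsup) simp
    also have "\<dots> \<le> ennreal (((1/2)^k)\<^sup>2)"
    proof (rule Limsup_bounded)
      have "(\<integral>\<^sup>+\<omega>. ennreal ((X m \<omega> - X (r j) \<omega>)\<^sup>2) \<partial>M) \<le> ennreal (((1/2)^k)\<^sup>2)" if "j \<ge> N k" for j
      proof -
        have "(\<integral>\<^sup>+\<omega>. ennreal ((X m \<omega> - X (r j) \<omega>)\<^sup>2) \<partial>M) = ennreal (\<integral>\<omega>. (X m \<omega> - X (r j) \<omega>)\<^sup>2 \<partial>M)"
          using L2_diff[OF X X, of m "r j"] by (intro nn_integral_eq_integral) (auto simp: L2_def)
        also have "(\<integral>\<omega>. (X m \<omega> - X (r j) \<omega>)\<^sup>2 \<partial>M) = (L2_norm M (\<lambda>\<omega>. X m \<omega> - X (r j) \<omega>))\<^sup>2"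
          by (simp add: L2_norm_def)
        also have "\<dots> \<le> ((1/2)^k)\<^sup>2"
          using N[of k m "r j"] \<open>m \<ge> N k\<close> that r_ge[of j] by (intro power_mono) auto
        finally show ?thesis by (simp add: ennreal_leI)
      qed
      then show "\<forall>\<^sub>F j in sequentially. (\<integral>\<^sup>+\<omega>. ennreal ((X m \<omega> - X (r j) \<omega>)\<^sup>2) \<partial>M) \<le> ennreal (((1/2)^k)\<^sup>2)"
        by (auto simp: eventually_sequentially)
    qed
    finally show ?thesis .
  qed
  have diffL: "(\<lambda>\<omega>. X m \<omega> - l \<omega>) \<in> L2 M" if "m \<ge> N k" for m k
  proof -
    have "(\<integral>\<^sup>+\<omega>. ennreal (norm ((X m \<omega> - l \<omega>)\<^sup>2)) \<partial>M) < \<infinity>"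
      using fatou[OF that] by (auto simp: ennreal_less_top intro: le_less_trans)
    then have "integrable M (\<lambda>\<omega>. (X m \<omega> - l \<omega>)\<^sup>2)" by (intro integrableI_bounded) auto
    then show ?thesis by (simp add: L2_def)
  qed
  have lL: "l \<in> L2 M"
    using L2_diff[OF X[of "N 0"] diffL[of 0 "N 0"]] by simp
  have norm_le: "L2_norm M (\<lambda>\<omega>. X m \<omega> - l \<omega>) \<le> (1/2)^k" if "m \<ge> N k" for m k
  proof -
    have "ennreal (\<integral>\<omega>. (X m \<omega> - l \<omega>)\<^sup>2 \<partial>M) \<le> ennreal (((1/2)^k)\<^sup>2)"
      using fatou[OF that] diffL[OF that]
      by (subst nn_integral_eq_integral[symmetric]) (auto simp: L2_def)
    then have "(\<integral>\<omega>. (X m \<omega> - l \<omega>)\<^sup>2 \<partial>M) \<le> ((1/2)^k)\<^sup>2" by (subst (asm) ennreal_le_iff) auto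
    then show ?thesis unfolding L2_norm_def by (intro real_le_lsqrt) auto
  qed
  have "(\<lambda>n. L2_norm M (\<lambda>\<omega>. X n \<omega> - l \<omega>)) \<longlonglongrightarrow> 0"
  proof (rule LIMSEQ_I)
    fix e :: real assume "0 < e"
    then obtain k where k: "(1/2)^k < e" using real_arch_pow_inv[of e "1/2"] by auto
    have "norm (L2_norm M (\<lambda>\<omega>. X n \<omega> - l \<omega>) - 0) < e" if "n \<ge> N k" for n
      using norm_le[OF that] k by simp
    then show "\<exists>no. \<forall>n\<ge>no. norm (L2_norm M (\<lambda>\<omega>. X n \<omega> - l \<omega>) - 0) < e" by blast
  qed
  with lL show thesis by (rule that)
qed

text \<open>\<open>G\<close> need not be closed, so the nearest point is found only in its closure.
  The parallelogram law, applied to the differences from f, makes a minimizing sequence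
  Cauchy.\<close>

theorem L2_projection:
  assumes G: "G \<subseteq> L2 M" "G \<noteq> {}"
    and add: "\<And>g h. g \<in> G \<Longrightarrow> h \<in> G \<Longrightarrow> (\<lambda>\<omega>. g \<omega> + h \<omega>) \<in> G"
    and cmult: "\<And>c g. g \<in> G \<Longrightarrow> (\<lambda>\<omega>. c * g \<omega>) \<in> G"
    and f: "f \<in> L2 M"
  obtains v where "v \<in> L2_closure M G" "\<And>h. h \<in> G \<Longrightarrow> L2_inner M (\<lambda>\<omega>. f \<omega> - v \<omega>) h = 0"
proof -
  define D where "D = (\<lambda>g. (L2_norm M (\<lambda>\<omega>. f \<omega> - g \<omega>))\<^sup>2)"
  define \<delta> where "\<delta> = (INF g\<in>G. D g)"
  have bdd: "bdd_below (D ` G)" by (rule bdd_belowI[of _ 0]) (auto simp: D_def)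
  have \<delta>_le: "\<delta> \<le> D g" if "g \<in> G" for g
    unfolding \<delta>_def using bdd that by (rule cINF_lower)
  have "\<exists>g\<in>G. D g < \<delta> + 1 / real (Suc n)" for n
    using cInf_lessD[of "D ` G" "\<delta> + 1 / real (Suc n)"] G(2) by (auto simp: \<delta>_def)
  then obtain g where gG: "\<And>n. g n \<in> G" and gD: "\<And>n. D (g n) < \<delta> + 1 / real (Suc n)" by metis
  have gL: "g n \<in> L2 M" for n using gG G by blast
  have par: "(L2_norm M (\<lambda>\<omega>. g m \<omega> - g n \<omega>))\<^sup>2 \<le> 2 / real (Suc m) + 2 / real (Suc n)" for m n
  proof -
    let ?a = "\<lambda>\<omega>. f \<omega> - g m \<omega>" and ?b = "\<lambda>\<omega>. f \<omega> - g n \<omega>"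
    \<comment> \<open>The midpoint of \<open>g m\<close> and \<open>g n\<close> lies in
      \<open>G\<close>, so its distance to f is at least the infimum; this bounds the norm of
      \<open>?a\<close> + \<open>?b\<close> from below.\<close>
    let ?h = "\<lambda>\<omega>. (1/2) * (g m \<omega> + g n \<omega>)"
    have ab: "?a \<in> L2 M" "?b \<in> L2 M" by (intro L2_diff f gL)+
    have eq: "(\<lambda>\<omega>. ?a \<omega> + ?b \<omega>) = (\<lambda>\<omega>. 2 * (f \<omega> - ?h \<omega>))" by (auto simp: field_simps)
    have arith: "n3 \<le> 2 * u + 2 * v"
      if "S = 4 * h" "\<delta> \<le> h" "S = a + 2 * i + b" "n3 = a - 2 * i + b" "a < \<delta> + u" "b < \<delta> + v"
      for S h a b i n3 u v :: real using that by linarith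
    have 1: "(L2_norm M (\<lambda>\<omega>. ?a \<omega> + ?b \<omega>))\<^sup>2 = 4 * D ?h"
      unfolding eq L2_norm_cmult D_def power_mult_distrib by simp
    have 2: "\<delta> \<le> D ?h" by (intro \<delta>_le cmult add gG)
    have "(L2_norm M (\<lambda>\<omega>. ?a \<omega> - ?b \<omega>))\<^sup>2 \<le> 2 * (1 / real (Suc m)) + 2 * (1 / real (Suc n))"
      by (rule arith[OF 1 2 L2_norm_add_power2[OF ab] L2_norm_diff_power2[OF ab]
            gD[of m, unfolded D_def] gD[of n, unfolded D_def]])
    moreover have "L2_norm M (\<lambda>\<omega>. ?a \<omega> - ?b \<omega>) = L2_norm M (\<lambda>\<omega>. g m \<omega> - g n \<omega>)"
      by (subst L2_norm_minus_commute) simp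
    ultimately show ?thesis by simp
  qed
  have Cauchy: "\<exists>N. \<forall>m\<ge>N. \<forall>n\<ge>N. L2_norm M (\<lambda>\<omega>. g m \<omega> - g n \<omega>) < e" if "0 < e" for e
  proof -
    obtain N where N: "4 / e\<^sup>2 < real N" using reals_Archimedean2 by blast
    have "L2_norm M (\<lambda>\<omega>. g m \<omega> - g n \<omega>) < e" if "m \<ge> N" "n \<ge> N" for m n
    proof -
      have arith: "z < E" if "z \<le> a + b" "a \<le> c" "b \<le> c" "c + c = d" "d < E" for a b c d z E :: real
        using that by linarith
      have "4 / e\<^sup>2 < real (Suc N)" using N by simp
      then have 1: "4 / real (Suc N) < e\<^sup>2" using \<open>0 < e\<close> by (simp add: field_simps)
      have 2: "2 / real (Suc N) + 2 / real (Suc N) = 4 / real (Suc N)" by simp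
      have le: "2 / real (Suc k) \<le> 2 / real (Suc N)" if "k \<ge> N" for k
        using that by (intro divide_left_mono) auto
      have "(L2_norm M (\<lambda>\<omega>. g m \<omega> - g n \<omega>))\<^sup>2 < e\<^sup>2"
        by (rule arith[OF par le[OF \<open>m \<ge> N\<close>] le[OF \<open>n \<ge> N\<close>] 2 1])
      then show ?thesis by (rule power2_less_imp_less) (use \<open>0 < e\<close> in simp)
    qed
    then show ?thesis by blast
  qed
  obtain v where v: "v \<in> L2 M" and lim: "(\<lambda>n. L2_norm M (\<lambda>\<omega>. g n \<omega> - v \<omega>)) \<longlonglongrightarrow> 0"
    using L2_complete[of g] gL Cauchy by blast
  \<comment> \<open>The infimum bounds distances to points of \<open>G\<close> only. The points
    \<open>g n\<close> + t h belong to \<open>G\<close> and approach v + t h.\<close>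
  have lower: "\<delta> \<le> (L2_norm M (\<lambda>\<omega>. (f \<omega> - v \<omega>) - t * h \<omega>))\<^sup>2" if h: "h \<in> G" for h t
  proof -
    have hL: "h \<in> L2 M" using h G by blast
    let ?u = "\<lambda>\<omega>. (f \<omega> - v \<omega>) - t * h \<omega>"
    have uL: "?u \<in> L2 M" by (intro L2_diff L2_cmult f v hL)
    have le: "sqrt \<delta> \<le> L2_norm M ?u + L2_norm M (\<lambda>\<omega>. g n \<omega> - v \<omega>)" for n
    proof -
      have "(\<lambda>\<omega>. g n \<omega> + t * h \<omega>) \<in> G" by (intro add cmult gG h)
      then have "\<delta> \<le> (L2_norm M (\<lambda>\<omega>. f \<omega> - (g n \<omega> + t * h \<omega>)))\<^sup>2"
        using \<delta>_le by (simp add: D_def)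
      then have "sqrt \<delta> \<le> L2_norm M (\<lambda>\<omega>. f \<omega> - (g n \<omega> + t * h \<omega>))"
        by (rule real_le_lsqrt[rotated]) simp
      also have "(\<lambda>\<omega>. f \<omega> - (g n \<omega> + t * h \<omega>)) = (\<lambda>\<omega>. ?u \<omega> + (v \<omega> - g n \<omega>))" by auto
      also have "L2_norm M \<dots> \<le> L2_norm M ?u + L2_norm M (\<lambda>\<omega>. v \<omega> - g n \<omega>)"
        by (intro L2_norm_triangle uL L2_diff v gL)
      finally show ?thesis by (simp add: L2_norm_minus_commute[of M v])
    qed
    have "sqrt \<delta> \<le> L2_norm M ?u + 0"
      by (rule LIMSEQ_le_const[OF tendsto_add[OF tendsto_const lim]]) (use le in auto)
    then show ?thesis using sqrt_le_D by simp
  qed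
  have upper: "(L2_norm M (\<lambda>\<omega>. f \<omega> - v \<omega>))\<^sup>2 \<le> \<delta>"
  proof -
    have \<delta>0: "0 \<le> \<delta>" unfolding \<delta>_def using G(2) by (intro cINF_greatest) (auto simp: D_def)
    have le: "L2_norm M (\<lambda>\<omega>. f \<omega> - v \<omega>) \<le> sqrt (\<delta> + 1 / real (Suc n)) + L2_norm M (\<lambda>\<omega>. g n \<omega> - v \<omega>)" for n
    proof -
      have "L2_norm M (\<lambda>\<omega>. f \<omega> - g n \<omega>) \<le> sqrt (\<delta> + 1 / real (Suc n))"
        using gD[of n] by (intro real_le_rsqrt) (simp add: D_def)
      then show ?thesis using L2_norm_triangle_diff[OF f gL v, of n] by linarith
    qed
    have "(\<lambda>n. sqrt (\<delta> + 1 / real (Suc n)) + L2_norm M (\<lambda>\<omega>. g n \<omega> - v \<omega>)) \<longlonglongrightarrow> sqrt (\<delta> + 0) + 0"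
      by (intro tendsto_add tendsto_real_sqrt tendsto_const lim LIMSEQ_Suc[OF lim_1_over_n])
    then have "L2_norm M (\<lambda>\<omega>. f \<omega> - v \<omega>) \<le> sqrt \<delta>"
      using LIMSEQ_le_const[OF _ exI[of _ 0]] le by fastforce
    then have "(L2_norm M (\<lambda>\<omega>. f \<omega> - v \<omega>))\<^sup>2 \<le> (sqrt \<delta>)\<^sup>2" by (rule power_mono) simp
    then show ?thesis using \<delta>0 by simp
  qed
  have orth: "L2_inner M (\<lambda>\<omega>. f \<omega> - v \<omega>) h = 0" if h: "h \<in> G" for h
  proof (rule ccontr)
    have hL: "h \<in> L2 M" using h G by blast
    let ?u = "\<lambda>\<omega>. f \<omega> - v \<omega>" and ?N = "(L2_norm M h)\<^sup>2"
    let ?i = "L2_inner M (\<lambda>\<omega>. f \<omega> - v \<omega>) h"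
    have q: "0 \<le> t\<^sup>2 * ?N - 2 * t * ?i" for t
    proof -
      have "L2_inner M ?u (\<lambda>\<omega>. t * h \<omega>) = t * ?i"
        by (simp add: L2_inner_commute[of M ?u] L2_inner_cmult_left)
      then have "(L2_norm M (\<lambda>\<omega>. ?u \<omega> - t * h \<omega>))\<^sup>2 = (L2_norm M ?u)\<^sup>2 - 2 * t * ?i + t\<^sup>2 * ?N"
        using L2_norm_diff_power2[OF L2_diff[OF f v] L2_cmult[OF hL, of t]]
        by (simp add: L2_norm_cmult power_mult_distrib)
      then show ?thesis using lower[OF h, of t] upper by simp
    qed
    assume i: "?i \<noteq> 0"
    \<comment> \<open>The quadratic is smallest at \<open>?i\<close> / \<open>?N\<close>; adding 1
      to the denominator avoids division by zero and still makes the value negative.\<close>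
    define t where "t = ?i / (?N + 1)"
    have p: "0 < ?N + 1" using zero_le_power2[of "L2_norm M h"] by linarith
    have ti: "?i = t * (?N + 1)" using p by (simp add: t_def)
    have "t\<^sup>2 * ?N - 2 * t * ?i = - (t\<^sup>2 * (?N + 2))"
      unfolding ti by (simp add: power2_eq_square algebra_simps)
    moreover have "0 < t\<^sup>2 * (?N + 2)" using i p by (simp add: t_def)
    ultimately show False using q[of t] by linarith
  qed
  have "v \<in> L2_closure M G"
  proof -
    have "\<exists>h\<in>G. L2_norm M (\<lambda>\<omega>. v \<omega> - h \<omega>) < e" if "0 < e" for e
    proof -
      obtain n where "L2_norm M (\<lambda>\<omega>. g n \<omega> - v \<omega>) < e"
        using LIMSEQ_D[OF lim \<open>0 < e\<close>] by auto
      then show ?thesis using gG L2_norm_minus_commute by metis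
    qed
    then show ?thesis using v by (auto simp: L2_closure_def)
  qed
  then show thesis using orth by (rule that)
qed

section \<open>Complete sub-sigma-fields and their conditional expectations\<close>

abbreviation CS :: "'a set set set" where "CS \<equiv> complete_subfields M"

lemma null_sets_trivial_field: "N \<in> null_sets M \<Longrightarrow> N \<in> trivial_field M"
  by (auto simp: trivial_field_def measure_eq_0_null_sets)

lemma trivial_field_iff:
  "E \<in> trivial_field M \<longleftrightarrow> E \<in> sets M \<and> ((AE \<omega> in M. \<omega> \<notin> E) \<or> (AE \<omega> in M. \<omega> \<in> E))"
proof -
  have "prob E = 0 \<longleftrightarrow> (AE \<omega> in M. \<omega> \<notin> E)" if "E \<in> sets M"
    using that by (simp add: AE_iff_measurable[of E M] prob_eq_0)
  moreover have "prob E = 1 \<longleftrightarrow> (AE \<omega> in M. \<omega> \<in> E)" if "E \<in> sets M"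
    using prob_eq_1[OF that] .
  ultimately show ?thesis by (auto simp: trivial_field_def)
qed

lemma CS_sigma_algebra: "x \<in> CS \<Longrightarrow> sigma_algebra (space M) x"
  and CS_trivial: "x \<in> CS \<Longrightarrow> trivial_field M \<subseteq> x"
  and CS_sets: "x \<in> CS \<Longrightarrow> x \<subseteq> sets M"
  by (auto simp: complete_subfields_def)

lemma CS_null: "x \<in> CS \<Longrightarrow> N \<in> null_sets M \<Longrightarrow> N \<in> x"
  using CS_trivial null_sets_trivial_field by blast

lemma sets_in_CS: "sets M \<in> CS"
  by (auto simp: complete_subfields_def trivial_field_def sets.sigma_algebra_axioms)

lemma Int_in_CS:
  assumes "I \<noteq> {}" "\<And>i. i \<in> I \<Longrightarrow> x i \<in> CS"
  shows "(\<Inter>i\<in>I. x i) \<in> CS"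
proof -
  have "sigma_algebra (space M) (\<Inter>i\<in>I. x i)"
    unfolding sigma_algebra_iff2
  proof (intro conjI ballI allI impI)
    obtain i where "i \<in> I" using assms(1) by blast
    then show "(\<Inter>i\<in>I. x i) \<subseteq> Pow (space M)"
      using CS_sets[OF assms(2)] sets.space_closed by blast
  qed (use CS_sigma_algebra[OF assms(2)] in \<open>auto simp: sigma_algebra_iff2 image_subset_iff\<close>)
  moreover have "trivial_field M \<subseteq> (\<Inter>i\<in>I. x i)" using CS_trivial[OF assms(2)] by blast
  moreover have "(\<Inter>i\<in>I. x i) \<subseteq> sets M" using assms(1) CS_sets[OF assms(2)] by blast
  ultimately show ?thesis by (simp add: complete_subfields_def)
qed

text \<open>Null sets are enough among the generators: an event of probability one is the complement
  of a null set.\<close>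

lemma sigma_in_CS:
  assumes "G \<subseteq> sets M" "null_sets M \<subseteq> G"
  shows "sigma_sets (space M) G \<in> CS"
proof -
  have "E \<in> sigma_sets (space M) G" if E: "E \<in> trivial_field M" for E
  proof (cases "AE \<omega> in M. \<omega> \<notin> E")
    case True
    then have "E \<in> null_sets M" using E by (simp add: trivial_field_iff AE_iff_null_sets)
    then show ?thesis using assms by auto
  next
    case False
    then have "AE \<omega> in M. \<omega> \<notin> space M - E" and Es: "E \<in> sets M"
      using E by (auto simp: trivial_field_iff)
    then have "space M - E \<in> null_sets M" by (simp add: AE_iff_null_sets)
    then have "space M - (space M - E) \<in> sigma_sets (space M) G"
      using assms by (intro sigma_sets.Compl sigma_sets.Basic) auto
    then show ?thesis using sets.sets_into_space[OF Es] by (simp add: double_diff)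
  qed
  moreover have "sigma_sets (space M) G \<subseteq> sets M" using assms(1) by (rule sets.sigma_sets_subset)
  moreover have "sigma_algebra (space M) (sigma_sets (space M) G)"
    using assms(1) sets.space_closed by (intro sigma_algebra_sigma_sets) blast
  ultimately show ?thesis by (auto simp: complete_subfields_def)
qed

lemma sigma_least_CS: "x \<in> CS \<Longrightarrow> G \<subseteq> x \<Longrightarrow> sigma_sets (space M) G \<subseteq> x"
  using sigma_algebra.sigma_sets_subset[OF CS_sigma_algebra] by blast

lemma Join_in_CS: "C \<subseteq> CS \<Longrightarrow> Join M C \<in> CS"
  unfolding Join_def using CS_sets null_sets_trivial_field
  by (intro sigma_in_CS) (auto simp: trivial_field_def)

lemma Join_upper: "a \<in> C \<Longrightarrow> a \<subseteq> Join M C"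
  by (auto simp: Join_def)

lemma Join_least: "x \<in> CS \<Longrightarrow> (\<And>a. a \<in> C \<Longrightarrow> a \<subseteq> x) \<Longrightarrow> Join M C \<subseteq> x"
  unfolding Join_def using CS_trivial by (intro sigma_least_CS) auto

lemma Join_mono: "C \<subseteq> D \<Longrightarrow> Join M C \<subseteq> Join M D"
  unfolding Join_def by (intro sigma_sets_mono') auto

lemma Join_Un_Join:
  assumes "C \<subseteq> CS" "D \<subseteq> CS"
  shows "Join M (insert (Join M C) D) = Join M (C \<union> D)"
proof
  show "Join M (insert (Join M C) D) \<subseteq> Join M (C \<union> D)"
  proof (rule Join_least)
    show "Join M (C \<union> D) \<in> CS" using assms by (intro Join_in_CS) auto
    show "a \<subseteq> Join M (C \<union> D)" if "a \<in> insert (Join M C) D" for a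
      using that Join_mono[of C "C \<union> D"] Join_upper[of a "C \<union> D"] by auto
  qed
  show "Join M (C \<union> D) \<subseteq> Join M (insert (Join M C) D)"
  proof (rule Join_least)
    show "Join M (insert (Join M C) D) \<in> CS" using assms Join_in_CS[OF assms(1)] by (intro Join_in_CS) auto
    show "a \<subseteq> Join M (insert (Join M C) D)" if "a \<in> C \<union> D" for a
      using that Join_upper[of a C] Join_upper[of "Join M C" "insert (Join M C) D"]
        Join_upper[of a "insert (Join M C) D"] by auto
  qed
qed

lemma Join_Join:
  assumes "C \<subseteq> CS" "D \<subseteq> CS"
  shows "Join M {Join M C, Join M D} = Join M (C \<union> D)"
proof -
  have "Join M {Join M C, Join M D} = Join M (C \<union> {Join M D})"
    using assms Join_in_CS by (intro Join_Un_Join) auto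
  also have "\<dots> = Join M (insert (Join M D) C)" by simp
  also have "\<dots> = Join M (D \<union> C)" using assms by (intro Join_Un_Join)
  finally show ?thesis by (simp add: Un_commute)
qed

text \<open>The trivial field is already a sigma-field. A countable union of its events is almost
  sure as soon as one member is, and null otherwise.\<close>

lemma Join_empty: "Join M {} = trivial_field M"
proof -
  have "sigma_sets (space M) (trivial_field M) \<subseteq> trivial_field M"
  proof
    fix E assume "E \<in> sigma_sets (space M) (trivial_field M)"
    then show "E \<in> trivial_field M"
    proof (induction rule: sigma_sets.induct)
      case (Compl a)
      then show ?case by (auto simp: trivial_field_iff)
    next
      case (Union A)
      show ?case
      proof (cases "\<exists>i. AE \<omega> in M. \<omega> \<in> A i")
        case True
        then have "AE \<omega> in M. \<omega> \<in> (\<Union>i. A i)" by (auto elim: eventually_mono)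
        then show ?thesis using Union.IH by (auto simp: trivial_field_iff)
      next
        case False
        then have "\<forall>i. AE \<omega> in M. \<omega> \<notin> A i" using Union.IH by (auto simp: trivial_field_iff)
        then have "AE \<omega> in M. \<forall>i. \<omega> \<notin> A i" by (simp add: AE_all_countable)
        then show ?thesis using Union.IH by (auto simp: trivial_field_iff)
      qed
    qed (auto simp: trivial_field_iff)
  qed
  then show ?thesis by (auto simp: Join_def)
qed

lemma trivial_in_CS: "trivial_field M \<in> CS"
  using Join_in_CS[of "{}"] by (simp add: Join_empty)

lemma Join_singleton: "x \<in> CS \<Longrightarrow> Join M {x} = x"
  using Join_upper[of x "{x}"] Join_least[of x "{x}"] by auto

lemma sets_sigma_CS: "x \<in> CS \<Longrightarrow> sets (sigma (space M) x) = x"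
  using CS_sets[of x] sets.space_closed sigma_algebra.sigma_sets_eq[OF CS_sigma_algebra, of x]
  by (subst sets_measure_of) auto

lemma subalgebra_CS: "x \<in> CS \<Longrightarrow> subalgebra M (sigma (space M) x)"
  using CS_sets by (simp add: subalgebra_def sets_sigma_CS space_measure_of_conv)

lemma subalgebra_mono_CS: "x \<in> CS \<Longrightarrow> y \<in> CS \<Longrightarrow> x \<subseteq> y \<Longrightarrow> subalgebra (sigma (space M) y) (sigma (space M) x)"
  by (simp add: subalgebra_def sets_sigma_CS space_measure_of_conv)

lemma finite_measure_subalgebra_CS: "x \<in> CS \<Longrightarrow> finite_measure_subalgebra M (sigma (space M) x)"
  by unfold_locales (rule subalgebra_CS)

lemma sigma_finite_subalgebra_CS: "x \<in> CS \<Longrightarrow> sigma_finite_subalgebra M (sigma (space M) x)"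
  by (intro finite_measure_subalgebra_is_sigma_finite finite_measure_subalgebra_CS)

section \<open>Square-integrable functions over a complete sub-sigma-field\<close>

lemma L2_sub_iff:
  assumes x: "x \<in> CS"
  shows "f \<in> L2_sub M x \<longleftrightarrow> f \<in> L2 M \<and> f \<in> borel_measurable (sigma (space M) x)"
proof -
  note sub = subalgebra_CS[OF x]
  have "f \<in> borel_measurable (restr_to_subalg M (sigma (space M) x)) \<longleftrightarrow> f \<in> borel_measurable (sigma (space M) x)"
    using measurable_in_subalg[OF sub] measurable_in_subalg'[OF sub] by blast
  moreover have "integrable (restr_to_subalg M (sigma (space M) x)) (\<lambda>\<omega>. (f \<omega>)\<^sup>2) \<longleftrightarrow> integrable M (\<lambda>\<omega>. (f \<omega>)\<^sup>2)"
    if "f \<in> borel_measurable (sigma (space M) x)"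
    using that integrable_in_subalg[OF sub, of "\<lambda>\<omega>. (f \<omega>)\<^sup>2"] integrable_from_subalg[OF sub, of "\<lambda>\<omega>. (f \<omega>)\<^sup>2"]
    by auto
  ultimately show ?thesis
    using measurable_from_subalg[OF sub, of f]
    unfolding L2_sub_def subfield_measure_def L2_def mem_Collect_eq by blast
qed

lemma L2_sub_L2: "x \<in> CS \<Longrightarrow> f \<in> L2_sub M x \<Longrightarrow> f \<in> L2 M"
  by (simp add: L2_sub_iff)

lemma L2_sub_sets: "L2_sub M (sets M) = L2 M"
proof -
  have meas: "borel_measurable (sigma (space M) (sets M)) = borel_measurable M"
    by (rule measurable_cong_sets) (simp_all only: sets_sigma_CS[OF sets_in_CS])
  have "f \<in> L2_sub M (sets M) \<longleftrightarrow> f \<in> L2 M" for f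
    unfolding L2_sub_iff[OF sets_in_CS] meas using L2_measurable[of f M] by blast
  then show ?thesis by blast
qed

text \<open>Two events that agree almost surely differ by null sets, which every complete field
  contains. This is what makes \<open>L2_sub\<close> stable under modification on a null
  set.\<close>

lemma CS_modification:
  assumes x: "x \<in> CS" and E: "E \<in> x" and E': "E' \<in> sets M"
    and ae: "AE \<omega> in M. \<omega> \<in> E \<longleftrightarrow> \<omega> \<in> E'"
  shows "E' \<in> x"
proof -
  interpret X: sigma_algebra "space M" x by (rule CS_sigma_algebra[OF x])
  have Es: "E \<in> sets M" using E CS_sets[OF x] by blast
  have "AE \<omega> in M. \<omega> \<notin> E - E'" "AE \<omega> in M. \<omega> \<notin> E' - E"
    using ae by (auto elim: eventually_mono)
  then have "E - E' \<in> null_sets M" "E' - E \<in> null_sets M"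
    using Es E' by (simp_all add: AE_iff_null_sets)
  then have "(E - (E - E')) \<union> (E' - E) \<in> x" using E CS_null[OF x] by blast
  moreover have "(E - (E - E')) \<union> (E' - E) = E'" by blast
  ultimately show ?thesis by simp
qed

lemma L2_sub_cong_AE:
  assumes x: "x \<in> CS" and f: "f \<in> L2_sub M x" and g [measurable]: "g \<in> borel_measurable M"
    and ae: "f \<doteq> g"
  shows "g \<in> L2_sub M x"
proof -
  have f': "f \<in> L2 M" "f \<in> borel_measurable (sigma (space M) x)" using f x by (auto simp: L2_sub_iff)
  have "g \<in> borel_measurable (sigma (space M) x)"
  proof (rule measurableI)
    fix A :: "real set" assume A: "A \<in> sets borel"
    have "f -` A \<inter> space M \<in> x"
      using measurable_sets[OF f'(2) A] by (simp add: sets_sigma_CS[OF x] space_measure_of_conv)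
    moreover have "g -` A \<inter> space M \<in> sets M" using A by measurable
    moreover have "AE \<omega> in M. \<omega> \<in> f -` A \<inter> space M \<longleftrightarrow> \<omega> \<in> g -` A \<inter> space M"
      using ae by eventually_elim auto
    ultimately have "g -` A \<inter> space M \<in> x" by (rule CS_modification[OF x])
    then show "g -` A \<inter> space (sigma (space M) x) \<in> sets (sigma (space M) x)"
      by (simp add: sets_sigma_CS[OF x] space_measure_of_conv)
  qed simp
  then show ?thesis using L2_cong_AE[OF f'(1) g ae] x by (simp add: L2_sub_iff)
qed

lemma L2_sub_indicator: "x \<in> CS \<Longrightarrow> E \<in> x \<Longrightarrow> (indicator E :: 'a \<Rightarrow> real) \<in> L2_sub M x"
  using CS_sets[of x] by (auto simp: L2_sub_iff sets_sigma_CS L2_indicator intro!: borel_measurable_indicator)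

lemma indicator_in_L2_sub_iff:
  assumes x: "x \<in> CS" and E: "E \<in> sets M"
  shows "(indicator E :: 'a \<Rightarrow> real) \<in> L2_sub M x \<longleftrightarrow> E \<in> x"
proof
  assume "(indicator E :: 'a \<Rightarrow> real) \<in> L2_sub M x"
  then have "(indicator E :: 'a \<Rightarrow> real) \<in> borel_measurable (sigma (space M) x)"
    using x by (simp add: L2_sub_iff)
  then have "E \<inter> space (sigma (space M) x) \<in> sets (sigma (space M) x)"
    by (simp add: borel_measurable_indicator_iff)
  then show "E \<in> x" using sets.sets_into_space[OF E] by (simp add: sets_sigma_CS[OF x] Int_absorb2 space_measure_of_conv)
qed (rule L2_sub_indicator[OF x])

lemma L2_sub_subset_iff:
  assumes "x \<in> CS" "y \<in> CS"
  shows "L2_sub M x \<subseteq> L2_sub M y \<longleftrightarrow> x \<subseteq> y"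
proof
  assume *: "L2_sub M x \<subseteq> L2_sub M y"
  show "x \<subseteq> y"
  proof
    fix E assume "E \<in> x"
    then have "(indicator E :: 'a \<Rightarrow> real) \<in> L2_sub M y" "E \<in> sets M"
      using * L2_sub_indicator[OF assms(1)] CS_sets[OF assms(1)] by auto
    then show "E \<in> y" using indicator_in_L2_sub_iff[OF assms(2)] by blast
  qed
next
  assume "x \<subseteq> y"
  then show "L2_sub M x \<subseteq> L2_sub M y"
    using measurable_from_subalg[OF subalgebra_mono_CS[OF assms]] by (auto simp: L2_sub_iff assms)
qed

lemma L2_sub_mono: "x \<in> CS \<Longrightarrow> y \<in> CS \<Longrightarrow> x \<subseteq> y \<Longrightarrow> f \<in> L2_sub M x \<Longrightarrow> f \<in> L2_sub M y"
  using L2_sub_subset_iff by blast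

text \<open>Measurability in \<open>L2_sub\<close> is exact and not up to null sets, so every
  preimage lies in all fields of the family at once.\<close>

lemma L2_sub_INT:
  assumes I: "I \<noteq> {}" and x: "\<And>i. i \<in> I \<Longrightarrow> x i \<in> CS" and f: "\<And>i. i \<in> I \<Longrightarrow> f \<in> L2_sub M (x i)"
  shows "f \<in> L2_sub M (\<Inter>i\<in>I. x i)"
proof -
  have w: "(\<Inter>i\<in>I. x i) \<in> CS" using I x by (rule Int_in_CS)
  have "f \<in> borel_measurable (sigma (space M) (\<Inter>i\<in>I. x i))"
  proof (rule measurableI)
    fix A :: "real set" assume A: "A \<in> sets borel"
    have "f -` A \<inter> space M \<in> x i" if i: "i \<in> I" for i
      using measurable_sets[of f "sigma (space M) (x i)" borel, OF _ A] f[OF i]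
      by (simp add: L2_sub_iff[OF x[OF i]] sets_sigma_CS[OF x[OF i]] space_measure_of_conv)
    then have "f -` A \<inter> space M \<in> (\<Inter>i\<in>I. x i)" by blast
    then show "f -` A \<inter> space (sigma (space M) (\<Inter>i\<in>I. x i)) \<in> sets (sigma (space M) (\<Inter>i\<in>I. x i))"
      by (simp only: sets_sigma_CS[OF w] space_measure_of_conv)
  qed simp
  moreover obtain i where "i \<in> I" using I by blast
  then have "f \<in> L2 M" using L2_sub_L2[OF x f] by blast
  ultimately show ?thesis by (simp only: L2_sub_iff[OF w] simp_thms)
qed

lemma L2_sub_const: "x \<in> CS \<Longrightarrow> (\<lambda>_. c) \<in> L2_sub M x"
  by (simp add: L2_sub_iff L2_const)

lemma L2_sub_diff: "x \<in> CS \<Longrightarrow> f \<in> L2_sub M x \<Longrightarrow> g \<in> L2_sub M x \<Longrightarrow> (\<lambda>\<omega>. f \<omega> - g \<omega>) \<in> L2_sub M x"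
  by (auto simp: L2_sub_iff L2_diff)

lemma L2_sub_cmult: "x \<in> CS \<Longrightarrow> f \<in> L2_sub M x \<Longrightarrow> (\<lambda>\<omega>. c * f \<omega>) \<in> L2_sub M x"
  by (auto simp: L2_sub_iff L2_cmult)

lemma L2_sub_bounded_mult:
  assumes "x \<in> CS" "f \<in> L2_sub M x" "s \<in> L2_sub M x" "AE \<omega> in M. \<bar>s \<omega>\<bar> \<le> K"
  shows "(\<lambda>\<omega>. s \<omega> * f \<omega>) \<in> L2_sub M x"
  using assms L2_bounded_mult[of f M s K] L2_measurable[of s M] by (auto simp: L2_sub_iff)

section \<open>Conditional expectation as an orthogonal projection\<close>

lemma cexp_L2_sub: "x \<in> CS \<Longrightarrow> f \<in> L2 M \<Longrightarrow> cexp M x f \<in> L2_sub M x"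
  using cexp_L2[OF prob_space_axioms, of x f] by (simp add: L2_sub_iff) (simp add: cexp_def)

lemma cexp_in_L2: "x \<in> CS \<Longrightarrow> f \<in> L2 M \<Longrightarrow> cexp M x f \<in> L2 M"
  by (rule cexp_L2[OF prob_space_axioms])

lemma cexp_inner:
  assumes x: "x \<in> CS" and f: "f \<in> L2 M" and g: "g \<in> L2_sub M x"
  shows "L2_inner M (cexp M x f) g = L2_inner M f g"
proof -
  interpret sigma_finite_subalgebra M "sigma (space M) x" by (rule sigma_finite_subalgebra_CS[OF x])
  have "L2_inner M g (cexp M x f) = L2_inner M g f"
    unfolding L2_inner_def cexp_def
    by (rule real_cond_exp_intg(2)) (use f g x in \<open>auto simp: L2_sub_iff L2_mult_integrable L2_measurable\<close>)
  then show ?thesis by (simp add: L2_inner_commute)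
qed

lemma cexp_self_adjoint:
  assumes "x \<in> CS" "f \<in> L2 M" "g \<in> L2 M"
  shows "L2_inner M (cexp M x f) g = L2_inner M f (cexp M x g)"
  using cexp_inner[OF assms(1,2) cexp_L2_sub[OF assms(1,3)]]
    cexp_inner[OF assms(1,3) cexp_L2_sub[OF assms(1,2)]]
  by (simp add: L2_inner_commute)

lemma cexp_charact:
  assumes x: "x \<in> CS" and f: "f \<in> L2 M" and h: "h \<in> L2_sub M x"
    and eq: "\<And>E. E \<in> x \<Longrightarrow> L2_inner M f (indicator E) = L2_inner M h (indicator E)"
  shows "cexp M x f \<doteq> h"
proof -
  interpret sigma_finite_subalgebra M "sigma (space M) x" by (rule sigma_finite_subalgebra_CS[OF x])
  have h': "h \<in> L2 M" "h \<in> borel_measurable (sigma (space M) x)" using h x by (auto simp: L2_sub_iff)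
  show ?thesis unfolding cexp_def
  proof (rule real_cond_exp_charact)
    fix A assume "A \<in> sets (sigma (space M) x)"
    then show "(LINT \<omega>:A|M. f \<omega>) = (LINT \<omega>:A|M. h \<omega>)"
      using eq[of A] by (simp add: sets_sigma_CS[OF x] L2_inner_def set_lebesgue_integral_def mult.commute)
  qed (use f h' L2_integrable in auto)
qed

lemma cexp_F_meas: "x \<in> CS \<Longrightarrow> f \<in> L2_sub M x \<Longrightarrow> cexp M x f \<doteq> f"
  by (rule cexp_charact) (auto simp: L2_sub_L2)

lemma L2_sub_iff_cexp:
  assumes x: "x \<in> CS" and f: "f \<in> L2 M"
  shows "f \<in> L2_sub M x \<longleftrightarrow> cexp M x f \<doteq> f"
  using cexp_F_meas[OF x, of f] L2_sub_cong_AE[OF x cexp_L2_sub[OF x f] L2_measurable[OF f]] by blast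

lemma cexp_cong:
  assumes "x \<in> CS" "f \<in> borel_measurable M" "g \<in> borel_measurable M" "f \<doteq> g"
  shows "cexp M x f \<doteq> cexp M x g"
proof -
  interpret sigma_finite_subalgebra M "sigma (space M) x" by (rule sigma_finite_subalgebra_CS[OF assms(1)])
  show ?thesis unfolding cexp_def by (rule real_cond_exp_cong[OF assms(4,2,3)])
qed

lemma cexp_add:
  assumes "x \<in> CS" "f \<in> L2 M" "g \<in> L2 M"
  shows "cexp M x (\<lambda>\<omega>. f \<omega> + g \<omega>) \<doteq> (\<lambda>\<omega>. cexp M x f \<omega> + cexp M x g \<omega>)"
proof -
  interpret sigma_finite_subalgebra M "sigma (space M) x" by (rule sigma_finite_subalgebra_CS[OF assms(1)])
  show ?thesis unfolding cexp_def by (intro real_cond_exp_add L2_integrable assms)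
qed

lemma cexp_diff:
  assumes "x \<in> CS" "f \<in> L2 M" "g \<in> L2 M"
  shows "cexp M x (\<lambda>\<omega>. f \<omega> - g \<omega>) \<doteq> (\<lambda>\<omega>. cexp M x f \<omega> - cexp M x g \<omega>)"
proof -
  interpret sigma_finite_subalgebra M "sigma (space M) x" by (rule sigma_finite_subalgebra_CS[OF assms(1)])
  show ?thesis unfolding cexp_def by (intro real_cond_exp_diff L2_integrable assms)
qed

lemma cexp_cmult:
  assumes "x \<in> CS" "f \<in> L2 M"
  shows "cexp M x (\<lambda>\<omega>. c * f \<omega>) \<doteq> (\<lambda>\<omega>. c * cexp M x f \<omega>)"
proof -
  interpret sigma_finite_subalgebra M "sigma (space M) x" by (rule sigma_finite_subalgebra_CS[OF assms(1)])
  show ?thesis unfolding cexp_def by (intro real_cond_exp_cmult L2_integrable assms)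
qed

lemma cexp_bounded_mult:
  assumes x: "x \<in> CS" and "f \<in> L2 M" "s \<in> L2_sub M x" "AE \<omega> in M. \<bar>s \<omega>\<bar> \<le> K"
  shows "cexp M x (\<lambda>\<omega>. s \<omega> * f \<omega>) \<doteq> (\<lambda>\<omega>. s \<omega> * cexp M x f \<omega>)"
proof -
  interpret sigma_finite_subalgebra M "sigma (space M) x" by (rule sigma_finite_subalgebra_CS[OF x])
  show ?thesis unfolding cexp_def
    by (rule real_cond_exp_mult) (use assms in \<open>auto simp: L2_sub_iff L2_mult_integrable L2_measurable\<close>)
qed

lemma cexp_tower:
  assumes "x \<in> CS" "y \<in> CS" "x \<subseteq> y" "f \<in> L2 M"
  shows "cexp M x (cexp M y f) \<doteq> cexp M x f"
proof -
  interpret sigma_finite_subalgebra M "sigma (space M) x" by (rule sigma_finite_subalgebra_CS[OF assms(1)])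
  show ?thesis
    using real_cond_exp_nested_subalg[OF subalgebra_CS[OF assms(2)] subalgebra_mono_CS[OF assms(1-3)]
        L2_integrable[OF assms(4)]]
    unfolding cexp_def by auto
qed

lemma cexp_norm_le:
  assumes x: "x \<in> CS" and f: "f \<in> L2 M"
  shows "L2_norm M (cexp M x f) \<le> L2_norm M f"
proof (rule ccontr)
  let ?a = "L2_norm M (cexp M x f)" and ?b = "L2_norm M f"
  assume less: "\<not> ?a \<le> ?b"
  have "?a\<^sup>2 = L2_inner M f (cexp M x f)"
    unfolding L2_norm_power2 by (rule cexp_inner[OF x f cexp_L2_sub[OF x f]])
  also have "\<dots> \<le> ?b * ?a" using L2_inner_le_norm[OF f cexp_in_L2[OF x f]] by linarith
  also have "\<dots> < ?a * ?a" using less by (intro mult_strict_right_mono) (auto intro: le_less_trans[of 0 ?b])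
  finally show False by (simp add: power2_eq_square)
qed

lemma cexp_diff_norm_le:
  assumes x: "x \<in> CS" and "f \<in> L2 M" "g \<in> L2 M"
  shows "L2_norm M (\<lambda>\<omega>. cexp M x f \<omega> - cexp M x g \<omega>) \<le> L2_norm M (\<lambda>\<omega>. f \<omega> - g \<omega>)"
proof -
  have "L2_norm M (\<lambda>\<omega>. cexp M x f \<omega> - cexp M x g \<omega>) = L2_norm M (cexp M x (\<lambda>\<omega>. f \<omega> - g \<omega>))"
    by (intro L2_norm_cong L2_measurable L2_diff cexp_in_L2 assms AE_symmetric[OF cexp_diff[OF assms]])
  then show ?thesis using cexp_norm_le[OF x L2_diff[OF assms(2,3)]] by simp
qed

text \<open>Read as orthogonality, the vanishing of a conditional expectation is visibly inherited
  by smaller fields.\<close>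

lemma cexp_eq_0_iff:
  assumes x: "x \<in> CS" and f: "f \<in> L2 M"
  shows "cexp M x f \<doteq> (\<lambda>_. 0) \<longleftrightarrow> (\<forall>g\<in>L2_sub M x. L2_inner M f g = 0)"
proof
  assume *: "cexp M x f \<doteq> (\<lambda>_. 0)"
  show "\<forall>g\<in>L2_sub M x. L2_inner M f g = 0"
  proof
    fix g assume g: "g \<in> L2_sub M x"
    have "L2_inner M f g = L2_inner M (cexp M x f) g" by (rule cexp_inner[OF x f g, symmetric])
    also have "\<dots> = L2_inner M (\<lambda>_. 0) g"
      using * by (intro L2_inner_cong L2_measurable cexp_in_L2 x f L2_zero_fun L2_sub_L2[OF x g]) auto
    finally show "L2_inner M f g = 0" by (simp add: L2_inner_def)
  qed
next
  assume "\<forall>g\<in>L2_sub M x. L2_inner M f g = 0"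
  then show "cexp M x f \<doteq> (\<lambda>_. 0)"
    using L2_sub_indicator[OF x]
    by (intro cexp_charact x f L2_sub_const) (auto simp: L2_inner_def[of M "\<lambda>_. 0"])
qed

lemma cexp_trivial:
  assumes f: "f \<in> L2 M"
  shows "cexp M (trivial_field M) f \<doteq> (\<lambda>_. expectation f)"
proof (rule cexp_charact[OF trivial_in_CS f L2_sub_const[OF trivial_in_CS]])
  fix E assume E: "E \<in> trivial_field M"
  then have "(AE \<omega> in M. \<omega> \<notin> E) \<or> (AE \<omega> in M. \<omega> \<in> E)" by (simp add: trivial_field_iff)
  then show "L2_inner M f (indicator E) = L2_inner M (\<lambda>_. expectation f) (indicator E)"
  proof
    assume "AE \<omega> in M. \<omega> \<notin> E"
    then have "(indicator E :: 'a \<Rightarrow> real) \<doteq> (\<lambda>_. 0)" by eventually_elim simp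
    then have "L2_inner M g (indicator E) = L2_inner M g (\<lambda>_. 0)" if "g \<in> L2 M" for g
      using E that by (intro L2_inner_cong) (auto simp: trivial_field_def L2_measurable)
    then have "L2_inner M g (indicator E) = 0" if "g \<in> L2 M" for g
      using that by (simp add: L2_inner_def[of M g "\<lambda>_. 0"])
    then show ?thesis using f L2_const by simp
  next
    assume "AE \<omega> in M. \<omega> \<in> E"
    then have "(indicator E :: 'a \<Rightarrow> real) \<doteq> (\<lambda>_. 1)" by eventually_elim simp
    then have "L2_inner M g (indicator E) = L2_inner M g (\<lambda>_. 1)" if "g \<in> L2 M" for g
      using E that by (intro L2_inner_cong) (auto simp: trivial_field_def L2_measurable)
    then have "L2_inner M g (indicator E) = expectation g" if "g \<in> L2 M" for g
      using that by (simp add: L2_inner_def[of M g "\<lambda>_. 1"])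
    then show ?thesis using f L2_const by (simp add: prob_space)
  qed
qed

lemma L2_sub_trivial:
  "f \<in> L2_sub M (trivial_field M) \<longleftrightarrow> f \<in> borel_measurable M \<and> (\<exists>c. f \<doteq> (\<lambda>_. c))"
proof
  assume f: "f \<in> L2_sub M (trivial_field M)"
  then have fL: "f \<in> L2 M" by (rule L2_sub_L2[OF trivial_in_CS])
  have "f \<doteq> (\<lambda>_. expectation f)"
    using cexp_F_meas[OF trivial_in_CS f] cexp_trivial[OF fL] by eventually_elim simp
  then show "f \<in> borel_measurable M \<and> (\<exists>c. f \<doteq> (\<lambda>_. c))" using L2_measurable[OF fL] by blast
next
  assume "f \<in> borel_measurable M \<and> (\<exists>c. f \<doteq> (\<lambda>_. c))"
  then obtain c where f: "f \<in> borel_measurable M" and "f \<doteq> (\<lambda>_. c)" by blast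
  then have "(\<lambda>_. c) \<doteq> f" by (elim AE_symmetric)
  then show "f \<in> L2_sub M (trivial_field M)"
    by (rule L2_sub_cong_AE[OF trivial_in_CS L2_sub_const[OF trivial_in_CS] f])
qed

text \<open>Reverse martingale convergence by Hilbert space geometry. The kernels of the projections
  increase with k. The part of f orthogonal to all of them is fixed by every projection and so lives
  on the intersection; the remaining part is approximated by vectors that are eventually
  killed.\<close>

theorem cexp_decreasing_limit:
  assumes c: "\<And>k. c k \<in> CS" and dec: "\<And>k. c (Suc k) \<subseteq> c k" and f: "f \<in> L2 M"
  shows "(\<lambda>k. L2_norm M (\<lambda>\<omega>. cexp M (c k) f \<omega> - cexp M (\<Inter>k. c k) f \<omega>)) \<longlonglongrightarrow> 0"
proof -
  define w where "w = (\<Inter>k. c k)"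
  have w: "w \<in> CS" unfolding w_def by (intro Int_in_CS c) auto
  have wc: "w \<subseteq> c k" for k by (auto simp: w_def)
  have dec': "c m \<subseteq> c k" if "k \<le> m" for k m using that by (rule lift_Suc_antimono_le[of c, OF dec])
  define G where "G = {h \<in> L2 M. \<exists>k. cexp M (c k) h \<doteq> (\<lambda>_. 0)}"
  have vanish: "cexp M (c m) h \<doteq> (\<lambda>_. 0)" if "cexp M (c k) h \<doteq> (\<lambda>_. 0)" "k \<le> m" "h \<in> L2 M" for k m h
  proof -
    have "\<forall>g\<in>L2_sub M (c k). L2_inner M h g = 0" using cexp_eq_0_iff[OF c that(3)] that(1) by blast
    then have "\<forall>g\<in>L2_sub M (c m). L2_inner M h g = 0" using L2_sub_mono[OF c c dec'[OF that(2)]] by blast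
    then show ?thesis using cexp_eq_0_iff[OF c that(3)] by blast
  qed
  have add: "(\<lambda>\<omega>. g \<omega> + h \<omega>) \<in> G" if "g \<in> G" "h \<in> G" for g h
  proof -
    obtain k m where km: "cexp M (c k) g \<doteq> (\<lambda>_. 0)" "cexp M (c m) h \<doteq> (\<lambda>_. 0)" "g \<in> L2 M" "h \<in> L2 M"
      using \<open>g \<in> G\<close> \<open>h \<in> G\<close> by (auto simp: G_def)
    have "cexp M (c (max k m)) g \<doteq> (\<lambda>_. 0)" "cexp M (c (max k m)) h \<doteq> (\<lambda>_. 0)"
      by (rule vanish[OF km(1) _ km(3)] vanish[OF km(2) _ km(4)], simp)+
    with cexp_add[OF c km(3,4), of "max k m"] have "cexp M (c (max k m)) (\<lambda>\<omega>. g \<omega> + h \<omega>) \<doteq> (\<lambda>_. 0)"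
      by eventually_elim simp
    then show ?thesis using L2_add[OF km(3,4)] by (auto simp: G_def)
  qed
  have cmult: "(\<lambda>\<omega>. t * h \<omega>) \<in> G" if hG: "h \<in> G" for h t
  proof -
    obtain k where k: "cexp M (c k) h \<doteq> (\<lambda>_. 0)" "h \<in> L2 M" using hG by (auto simp: G_def)
    have "cexp M (c k) (\<lambda>\<omega>. t * h \<omega>) \<doteq> (\<lambda>_. 0)"
      using cexp_cmult[OF c k(2), of k t] k(1) by eventually_elim simp
    then show ?thesis using L2_cmult[OF k(2)] by (auto simp: G_def)
  qed
  have "cexp M (c 0) (\<lambda>_. 0) \<doteq> (\<lambda>_. 0)" by (rule cexp_F_meas[OF c L2_sub_const[OF c]])
  then have "(\<lambda>_. 0) \<in> G" using L2_zero_fun by (auto simp: G_def)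
  then obtain u where u: "u \<in> L2_closure M G"
    and orth: "\<And>h. h \<in> G \<Longrightarrow> L2_inner M (\<lambda>\<omega>. f \<omega> - u \<omega>) h = 0"
    using L2_projection[of G f] add cmult f unfolding G_def by blast
  have uL: "u \<in> L2 M" using u by (simp add: L2_closure_def)
  let ?v = "\<lambda>\<omega>. f \<omega> - u \<omega>"
  have vL: "?v \<in> L2 M" by (rule L2_diff[OF f uL])
  have vk: "?v \<in> L2_sub M (c k)" for k
  proof -
    \<comment> \<open>The residual of \<open>?v\<close> lies in \<open>G\<close>, hence is
      orthogonal to \<open>?v\<close>; as a residual it is also orthogonal to the projection of
      \<open>?v\<close>. So it is orthogonal to itself.\<close>
    let ?h = "\<lambda>\<omega>. ?v \<omega> - cexp M (c k) ?v \<omega>"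
    have cv: "cexp M (c k) ?v \<in> L2 M" by (rule cexp_in_L2[OF c vL])
    have hL: "?h \<in> L2 M" by (rule L2_diff[OF vL cv])
    have h0: "cexp M (c k) ?h \<doteq> (\<lambda>_. 0)"
      using cexp_diff[OF c vL cv, of k] cexp_F_meas[OF c cexp_L2_sub[OF c vL], of k]
      by eventually_elim simp
    then have hG: "?h \<in> G" using hL by (auto simp: G_def)
    have "L2_inner M (cexp M (c k) ?v) ?h = L2_inner M ?h (cexp M (c k) ?v)" by (rule L2_inner_commute)
    also have "\<dots> = 0" using h0 cexp_L2_sub[OF c vL] by (simp add: cexp_eq_0_iff[OF c hL])
    finally have "L2_inner M ?h ?h = 0"
      using orth[OF hG] by (subst L2_inner_diff_left[OF vL cv hL]) simp
    then have "L2_norm M ?h = 0" by (simp add: L2_norm_power2[symmetric])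
    then have "?h \<doteq> (\<lambda>_. 0)" by (simp add: L2_norm_eq_0_iff[OF hL])
    then have "cexp M (c k) ?v \<doteq> ?v" by eventually_elim simp
    then show ?thesis by (simp add: L2_sub_iff_cexp[OF c vL])
  qed
  have vw: "?v \<in> L2_sub M w" unfolding w_def by (rule L2_sub_INT[OF _ c vk]) simp
  have lim0: "\<exists>N. \<forall>k\<ge>N. L2_norm M (cexp M (c k) u) < e" if "0 < e" for e
  proof -
    obtain h where "h \<in> G" and he: "L2_norm M (\<lambda>\<omega>. u \<omega> - h \<omega>) < e"
      using u \<open>0 < e\<close> by (auto simp: L2_closure_def)
    then obtain N where N: "cexp M (c N) h \<doteq> (\<lambda>_. 0)" and hL: "h \<in> L2 M" by (auto simp: G_def)
    have "L2_norm M (cexp M (c k) u) < e" if "k \<ge> N" for k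
    proof -
      have "L2_norm M (cexp M (c k) u) = L2_norm M (\<lambda>\<omega>. cexp M (c k) u \<omega> - cexp M (c k) h \<omega>)"
        by (intro L2_norm_cong L2_measurable L2_diff cexp_in_L2 c uL hL)
          (use vanish[OF N that hL] in eventually_elim, simp)
      also have "\<dots> \<le> L2_norm M (\<lambda>\<omega>. u \<omega> - h \<omega>)" by (rule cexp_diff_norm_le[OF c uL hL])
      finally show ?thesis using he by simp
    qed
    then show ?thesis by blast
  qed
  have u0: "cexp M w u \<doteq> (\<lambda>_. 0)"
  proof -
    have "L2_norm M (cexp M w u) < e" if "0 < e" for e
    proof -
      obtain k where k: "L2_norm M (cexp M (c k) u) < e" using lim0[OF \<open>0 < e\<close>] by blast
      have "L2_norm M (cexp M w u) = L2_norm M (cexp M w (cexp M (c k) u))"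
        by (intro L2_norm_cong L2_measurable cexp_in_L2 w c uL AE_symmetric[OF cexp_tower[OF w c wc uL]])
      also have "\<dots> \<le> L2_norm M (cexp M (c k) u)" by (intro cexp_norm_le w cexp_in_L2 c uL)
      finally show ?thesis using k by simp
    qed
    then have "L2_norm M (cexp M w u) \<le> 0" using field_le_epsilon[of "L2_norm M (cexp M w u)" 0]
      by (simp add: less_imp_le)
    then show ?thesis
      using L2_norm_eq_0_iff[OF cexp_in_L2[OF w uL]] by (simp add: antisym)
  qed
  have eq: "L2_norm M (\<lambda>\<omega>. cexp M (c k) f \<omega> - cexp M w f \<omega>) = L2_norm M (cexp M (c k) u)" for k
  proof (intro L2_norm_cong L2_measurable L2_diff cexp_in_L2 w c uL f)
    have "cexp M (c k) ?v \<doteq> ?v" by (rule cexp_F_meas[OF c vk])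
    moreover have "cexp M w ?v \<doteq> ?v" by (rule cexp_F_meas[OF w vw])
    ultimately show "AE \<omega> in M. cexp M (c k) f \<omega> - cexp M w f \<omega> = cexp M (c k) u \<omega>"
      using cexp_diff[OF c f uL, of k] cexp_diff[OF w f uL] u0
      by eventually_elim simp
  qed
  show ?thesis
    unfolding w_def[symmetric] eq
  proof (rule LIMSEQ_I)
    fix e :: real assume "0 < e"
    then obtain N where "\<forall>k\<ge>N. L2_norm M (cexp M (c k) u) < e" using lim0 by blast
    then show "\<exists>N. \<forall>k\<ge>N. norm (L2_norm M (cexp M (c k) u) - 0) < e" by auto
  qed
qed

section \<open>Independence and random signs\<close>

lemma L2_inner_indicator:
  assumes "E \<in> sets M"
  shows "L2_inner M f (indicator E) = (LINT \<omega>:E|M. f \<omega>)"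
  by (simp add: L2_inner_def set_lebesgue_integral_def mult.commute)

text \<open>Dynkin's argument: agreement of the two indefinite integrals passes to complements and
  to disjoint unions. Complements are taken in the whole space, which is why \<open>space M\<close>
  is asked to be in \<open>G\<close>.\<close>

lemma L2_inner_indicator_sigma_eq:
  assumes G: "Int_stable G" "G \<subseteq> sets M" "space M \<in> G"
    and fg: "f \<in> L2 M" "g \<in> L2 M"
    and eq: "\<And>E. E \<in> G \<Longrightarrow> L2_inner M f (indicator E) = L2_inner M g (indicator E)"
    and E: "E \<in> sigma_sets (space M) G"
  shows "L2_inner M f (indicator E) = L2_inner M g (indicator E)"
proof -
  have sub: "sigma_sets (space M) G \<subseteq> sets M" using G(2) by (rule sets.sigma_sets_subset)
  have complement: "L2_inner M u (indicator (space M - A)) = L2_inner M u (indicator (space M)) - L2_inner M u (indicator A)"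
    if "u \<in> L2 M" "A \<in> sets M" for u A
  proof -
    have "L2_inner M (\<lambda>\<omega>. indicator (space M) \<omega> - indicator A \<omega>) u
        = L2_inner M (indicator (space M)) u - L2_inner M (indicator A) u"
      using that by (intro L2_inner_diff_left L2_indicator) auto
    moreover have "L2_inner M (\<lambda>\<omega>. indicator (space M) \<omega> - indicator A \<omega>) u = L2_inner M (indicator (space M - A)) u"
      unfolding L2_inner_def using sets.sets_into_space[OF that(2)]
      by (intro Bochner_Integration.integral_cong) (auto split: split_indicator)
    ultimately show ?thesis by (simp add: L2_inner_commute[of M u])
  qed
  have disjoint_union: "L2_inner M u (indicator (\<Union>i. A i)) = (\<Sum>i. L2_inner M u (indicator (A i)))"
    if "u \<in> L2 M" "range A \<subseteq> sets M" "disjoint_family A" for u and A :: "nat \<Rightarrow> 'a set"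
  proof -
    have "(LINT \<omega>:(\<Union>i. A i)|M. u \<omega>) = (\<Sum>i. LINT \<omega>:A i|M. u \<omega>)"
    proof (rule lebesgue_integral_countable_add)
      show "set_integrable M (\<Union>i. A i) u"
        unfolding set_integrable_def using that L2_integrable[OF that(1)]
        by (intro integrable_mult_indicator) auto
    qed (use that in \<open>auto simp: disjoint_family_on_def\<close>)
    then show ?thesis using that by (subst L2_inner_indicator) (auto simp: L2_inner_indicator)
  qed
  have GP: "G \<subseteq> Pow (space M)" using G(2) sets.space_closed by blast
  from G(1) GP E show ?thesis
  proof (induction rule: sigma_sets_induct_disjoint)
    case (compl A)
    then have "A \<in> sets M" using sub by blast
    then show ?case using compl.IH eq[OF G(3)] fg complement by simp
  next
    case (union A)
    then have "range A \<subseteq> sets M" using sub by blast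
    then show ?case using union.hyps union.IH fg disjoint_union by simp
  next
    case empty
    show ?case by (simp add: L2_inner_def)
  next
    case (basic A)
    then show ?case by (rule eq)
  qed
qed

text \<open>The generator for Dynkin's argument on a join: these intersections form a stable family,
  and taking the whole space as one factor recovers \<open>a\<close> and \<open>b\<close>.\<close>

lemma Join_pair_eq_sigma_Int:
  assumes a: "a \<in> CS" and b: "b \<in> CS"
  shows "Join M {a, b} = sigma_sets (space M) {A \<inter> B | A B. A \<in> a \<and> B \<in> b}" (is "_ = ?R")
    and "Int_stable {A \<inter> B | A B. A \<in> a \<and> B \<in> b}"
    and "{A \<inter> B | A B. A \<in> a \<and> B \<in> b} \<subseteq> sets M"
    and "space M \<in> {A \<inter> B | A B. A \<in> a \<and> B \<in> b}"
proof -
  interpret A: sigma_algebra "space M" a by (rule CS_sigma_algebra[OF a])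
  interpret B: sigma_algebra "space M" b by (rule CS_sigma_algebra[OF b])
  have sa: "E = E \<inter> space M" if "E \<in> a" for E using A.sets_into_space[OF that] by blast
  have sb: "E = space M \<inter> E" if "E \<in> b" for E using B.sets_into_space[OF that] by blast
  have ag: "a \<subseteq> {A \<inter> B | A B. A \<in> a \<and> B \<in> b}" using sa B.top by blast
  have bg: "b \<subseteq> {A \<inter> B | A B. A \<in> a \<and> B \<in> b}" using sb A.top by blast
  show gM: "{A \<inter> B | A B. A \<in> a \<and> B \<in> b} \<subseteq> sets M" using CS_sets[OF a] CS_sets[OF b] by blast
  show "space M \<in> {A \<inter> B | A B. A \<in> a \<and> B \<in> b}" using ag A.top by blast
  show "Int_stable {A \<inter> B | A B. A \<in> a \<and> B \<in> b}"
  proof (rule Int_stableI)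
    fix E F assume "E \<in> {A \<inter> B | A B. A \<in> a \<and> B \<in> b}" "F \<in> {A \<inter> B | A B. A \<in> a \<and> B \<in> b}"
    then obtain A B A' B' where "E = A \<inter> B" "F = A' \<inter> B'" "A \<in> a" "A' \<in> a" "B \<in> b" "B' \<in> b" by blast
    then have "E \<inter> F = (A \<inter> A') \<inter> (B \<inter> B')" "A \<inter> A' \<in> a" "B \<inter> B' \<in> b" by auto
    then show "E \<inter> F \<in> {A \<inter> B | A B. A \<in> a \<and> B \<in> b}" by blast
  qed
  show "Join M {a, b} = ?R"
  proof
    have "trivial_field M \<union> \<Union>{a, b} \<subseteq> {A \<inter> B | A B. A \<in> a \<and> B \<in> b}"
      using ag bg CS_trivial[OF a] by blast
    then show "Join M {a, b} \<subseteq> ?R" unfolding Join_def by (rule sigma_sets_mono')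
    interpret J: sigma_algebra "space M" "Join M {a, b}"
      using a b by (intro CS_sigma_algebra Join_in_CS) auto
    have "{A \<inter> B | A B. A \<in> a \<and> B \<in> b} \<subseteq> Join M {a, b}"
      using Join_upper[of a "{a, b}"] Join_upper[of b "{a, b}"] by blast
    then show "?R \<subseteq> Join M {a, b}" by (rule J.sigma_sets_subset)
  qed
qed

lemma indep_set_commute: "indep_set a b \<Longrightarrow> indep_set b a"
proof (rule indep_setI)
  fix B A assume "indep_set a b" "B \<in> b" "A \<in> a"
  then show "prob (B \<inter> A) = prob B * prob A"
    using indep_setD[of a b A B] by (simp add: Int_commute mult.commute)
qed (auto dest: indep_setD_ev1 indep_setD_ev2)

lemma L2_inner_indicator_indicator:
  "A \<in> sets M \<Longrightarrow> B \<in> sets M \<Longrightarrow> L2_inner M (indicator A) (indicator B) = prob (A \<inter> B)"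
  by (simp add: L2_inner_def indicator_inter_arith[symmetric])

text \<open>Independence speaks of events only. It determines the conditional expectation of
  \<open>indicator D\<close> given \<open>b\<close>; testing this against f moves the statement from
  events to square-integrable functions.\<close>

lemma cexp_indep:
  assumes b: "b \<in> CS" and k: "k \<in> CS" and ind: "indep_set b k" and f: "f \<in> L2_sub M b"
  shows "cexp M k f \<doteq> (\<lambda>_. expectation f)"
proof (rule cexp_charact[OF k L2_sub_L2[OF b f] L2_sub_const[OF k]])
  fix D assume D: "D \<in> k"
  have DM: "D \<in> sets M" using D CS_sets[OF k] by blast
  have fL: "f \<in> L2 M" by (rule L2_sub_L2[OF b f])
  have "cexp M b (indicator D) \<doteq> (\<lambda>_. prob D)"
  proof (rule cexp_charact[OF b L2_indicator[OF DM] L2_sub_const[OF b]])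
    fix E assume "E \<in> b"
    then have EM: "E \<in> sets M" and "prob (E \<inter> D) = prob E * prob D"
      using CS_sets[OF b] indep_setD[OF ind _ D] by auto
    then show "L2_inner M (indicator D) (indicator E) = L2_inner M (\<lambda>_. prob D) (indicator E)"
      using DM by (simp add: L2_inner_indicator_indicator Int_commute) (simp add: L2_inner_def)
  qed
  then have "L2_inner M (cexp M b (indicator D)) f = L2_inner M (\<lambda>_. prob D) f"
    by (intro L2_inner_cong L2_measurable cexp_in_L2 b L2_indicator DM L2_const fL) auto
  moreover have "L2_inner M (cexp M b (indicator D)) f = L2_inner M f (indicator D)"
    using cexp_inner[OF b L2_indicator[OF DM] f] by (simp add: L2_inner_commute)
  moreover have "L2_inner M (\<lambda>_. prob D) f = prob D * expectation f" by (simp add: L2_inner_def)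
  moreover have "L2_inner M (\<lambda>_. expectation f) (indicator D) = expectation f * prob D"
    using DM by (simp add: L2_inner_def)
  ultimately show "L2_inner M f (indicator D) = L2_inner M (\<lambda>_. expectation f) (indicator D)" by simp
qed

lemma indep_L2_inner:
  assumes b: "b \<in> CS" and k: "k \<in> CS" and ind: "indep_set b k"
    and f: "f \<in> L2_sub M b" and g: "g \<in> L2_sub M k"
  shows "L2_inner M f g = expectation f * expectation g"
proof -
  have fg: "f \<in> L2 M" "g \<in> L2 M" using L2_sub_L2 b k f g by auto
  have "L2_inner M f g = L2_inner M (cexp M k f) g" by (rule cexp_inner[OF k fg(1) g, symmetric])
  also have "\<dots> = L2_inner M (\<lambda>_. expectation f) g"
    by (intro L2_inner_cong L2_measurable cexp_in_L2 k fg L2_const cexp_indep[OF b k ind f]) auto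
  finally show ?thesis by (simp add: L2_inner_def)
qed

text \<open>Each event of \<open>b\<close> is independent of itself, so its probability satisfies p
  = p^2.\<close>

lemma indep_Int_trivial:
  assumes b: "b \<in> CS" and ind: "indep_set b k" and sub: "b \<subseteq> k"
  shows "b = trivial_field M"
proof
  show "b \<subseteq> trivial_field M"
  proof
    fix E assume E: "E \<in> b"
    then have "prob (E \<inter> E) = prob E * prob E" using indep_setD[OF ind E] sub by blast
    then have "prob E * (prob E - 1) = 0" by (simp add: algebra_simps)
    then show "E \<in> trivial_field M" using E CS_sets[OF b] by (auto simp: trivial_field_def)
  qed
qed (rule CS_trivial[OF b])

lemma indep_trivial: "k \<in> CS \<Longrightarrow> indep_set (trivial_field M) k"
proof (rule indep_setI)
  fix E D assume k: "k \<in> CS" and E: "E \<in> trivial_field M" and D: "D \<in> k"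
  have EM: "E \<in> sets M" and DM: "D \<in> sets M" using E D CS_sets[OF k] by (auto simp: trivial_field_def)
  consider "AE \<omega> in M. \<omega> \<notin> E" | "AE \<omega> in M. \<omega> \<in> E" using E by (auto simp: trivial_field_iff)
  then show "prob (E \<inter> D) = prob E * prob D"
  proof cases
    case 1
    then have "prob E = 0" "prob (E \<inter> D) = 0"
      using EM DM by (auto simp: prob_eq_0 elim: eventually_mono)
    then show ?thesis by simp
  next
    case 2
    then have "prob E = 1" using EM by (simp add: prob_eq_1)
    moreover have "prob (E \<inter> D) = prob D"
      using 2 EM DM by (intro finite_measure_eq_AE) (auto elim: eventually_mono)
    ultimately show ?thesis by simp
  qed
qed (auto simp: trivial_field_def dest: CS_sets)

text \<open>The source of the commutation relations. Self-adjointness reduces the claim to events D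
  of \<open>k\<close>: conditioning \<open>indicator D\<close> on the join of \<open>a\<close> and
  \<open>b\<close> gives the same as conditioning it on \<open>a\<close>, because \<open>b\<close>
  carries no information about \<open>k\<close>.\<close>

lemma cexp_Join_indep:
  assumes a: "a \<in> CS" and b: "b \<in> CS" and k: "k \<in> CS" and ak: "a \<subseteq> k" and ind: "indep_set b k"
    and f: "f \<in> L2_sub M (Join M {a, b})"
  shows "cexp M k f \<doteq> cexp M a f"
proof -
  define j where "j = Join M {a, b}"
  have j: "j \<in> CS" unfolding j_def using a b by (intro Join_in_CS) auto
  have aj: "a \<subseteq> j" unfolding j_def by (intro Join_upper) auto
  have fL: "f \<in> L2 M" by (rule L2_sub_L2[OF j f[folded j_def]])
  have D: "cexp M j (indicator D) \<doteq> cexp M a (indicator D)" if D: "D \<in> k" for D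
  proof -
    have DM: "D \<in> sets M" using D CS_sets[OF k] by blast
    have DL: "(indicator D :: 'a \<Rightarrow> real) \<in> L2 M" by (rule L2_indicator[OF DM])
    let ?h = "cexp M a (indicator D)"
    have hL: "?h \<in> L2 M" by (rule cexp_in_L2[OF a DL])
    show ?thesis
    proof (rule cexp_charact[OF j DL L2_sub_mono[OF a j aj cexp_L2_sub[OF a DL]]])
      fix E assume "E \<in> j"
      then have E: "E \<in> sigma_sets (space M) {A \<inter> B | A B. A \<in> a \<and> B \<in> b}"
        unfolding j_def Join_pair_eq_sigma_Int(1)[OF a b] .
      show "L2_inner M (indicator D) (indicator E) = L2_inner M ?h (indicator E)"
      proof (rule L2_inner_indicator_sigma_eq[OF Join_pair_eq_sigma_Int(2-4)[OF a b] DL hL _ E])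
        fix E assume "E \<in> {A \<inter> B | A B. A \<in> a \<and> B \<in> b}"
        then obtain A B where E: "E = A \<inter> B" and A: "A \<in> a" and B: "B \<in> b" by blast
        interpret K: sigma_algebra "space M" k by (rule CS_sigma_algebra[OF k])
        have AM: "A \<in> sets M" and BM: "B \<in> sets M" using A B CS_sets[OF a] CS_sets[OF b] by auto
        have Eeq: "(indicator E :: 'a \<Rightarrow> real) = (\<lambda>\<omega>. indicator A \<omega> * indicator B \<omega>)"
          by (auto simp: E indicator_inter_arith)
        have AD: "D \<inter> A \<in> k" using D A ak by blast
        have hA: "(\<lambda>\<omega>. indicator A \<omega> * ?h \<omega>) \<in> L2_sub M k"
          using L2_sub_mono[OF a k ak cexp_L2_sub[OF a DL]] A ak
          by (intro L2_sub_bounded_mult[where K = 1] k L2_sub_indicator) (auto split: split_indicator)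
        \<comment> \<open>Because \<open>a \<subseteq> k\<close>, both the function
          \<open>indicator A\<close> times \<open>?h\<close> and the event D \<inter> A belong to
          \<open>k\<close>. Hence the factor of B splits off by independence, and is put back in the
          same way after \<open>?h\<close> has been replaced by D.\<close>
        have "L2_inner M ?h (indicator E) = L2_inner M (indicator B) (\<lambda>\<omega>. indicator A \<omega> * ?h \<omega>)"
          unfolding Eeq L2_inner_def by (simp add: ac_simps)
        also have "\<dots> = prob B * expectation (\<lambda>\<omega>. indicator A \<omega> * ?h \<omega>)"
          using indep_L2_inner[OF b k ind L2_sub_indicator[OF b B] hA] BM by simp
        also have "expectation (\<lambda>\<omega>. indicator A \<omega> * ?h \<omega>) = L2_inner M ?h (indicator A)"
          by (simp add: L2_inner_def mult.commute)
        also have "\<dots> = prob (D \<inter> A)"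
          using cexp_inner[OF a DL L2_sub_indicator[OF a A]] DM AM by (simp add: L2_inner_indicator_indicator)
        also have "prob B * prob (D \<inter> A) = prob (B \<inter> (D \<inter> A))" by (rule indep_setD[OF ind B AD, symmetric])
        also have "\<dots> = L2_inner M (indicator D) (indicator E)"
          using AM BM DM by (simp add: L2_inner_indicator_indicator E Int_ac)
        finally show "L2_inner M (indicator D) (indicator E) = L2_inner M ?h (indicator E)" by simp
      qed
    qed
  qed
  show ?thesis
  proof (rule cexp_charact[OF k fL L2_sub_mono[OF a k ak cexp_L2_sub[OF a fL]]])
    fix E assume E: "E \<in> k"
    then have EL: "(indicator E :: 'a \<Rightarrow> real) \<in> L2 M" using CS_sets[OF k] by (intro L2_indicator) blast
    have "L2_inner M f (indicator E) = L2_inner M (cexp M j (indicator E)) f"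
      using cexp_inner[OF j EL f[folded j_def]] by (simp add: L2_inner_commute)
    also have "\<dots> = L2_inner M (cexp M a (indicator E)) f"
      by (intro L2_inner_cong L2_measurable cexp_in_L2 j a EL fL D[OF E]) auto
    also have "\<dots> = L2_inner M (cexp M a f) (indicator E)"
      using cexp_self_adjoint[OF a EL fL] by (simp add: L2_inner_commute)
    finally show "L2_inner M f (indicator E) = L2_inner M (cexp M a f) (indicator E)" .
  qed
qed

section \<open>Random signs\<close>

lemma random_sign_iff:
  "random_sign M \<xi> \<longleftrightarrow> \<xi> \<in> borel_measurable M \<and> (AE \<omega> in M. \<xi> \<omega> = 1 \<or> \<xi> \<omega> = - 1) \<and> expectation \<xi> = 0"
proof -
  have "(prob {\<omega> \<in> space M. \<xi> \<omega> = 1} = 1/2 \<and> prob {\<omega> \<in> space M. \<xi> \<omega> = - 1} = 1/2) \<longleftrightarrow>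
      (AE \<omega> in M. \<xi> \<omega> = 1 \<or> \<xi> \<omega> = - 1) \<and> expectation \<xi> = 0" if [measurable]: "\<xi> \<in> borel_measurable M"
  proof -
    let ?P = "{\<omega> \<in> space M. \<xi> \<omega> = 1}" and ?N = "{\<omega> \<in> space M. \<xi> \<omega> = - 1}"
    have PN: "?P \<in> sets M" "?N \<in> sets M" by measurable
    have "prob (?P \<union> ?N) = prob ?P + prob ?N" using PN by (intro finite_measure_Union) auto
    moreover have "?P \<union> ?N = {\<omega> \<in> space M. \<xi> \<omega> = 1 \<or> \<xi> \<omega> = - 1}" by blast
    ultimately have sum: "(AE \<omega> in M. \<xi> \<omega> = 1 \<or> \<xi> \<omega> = - 1) \<longleftrightarrow> prob ?P + prob ?N = 1"
      using prob_Collect_eq_1[of "\<lambda>\<omega>. \<xi> \<omega> = 1 \<or> \<xi> \<omega> = - 1"] by simp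
    have "expectation \<xi> = prob ?P - prob ?N" if ae: "AE \<omega> in M. \<xi> \<omega> = 1 \<or> \<xi> \<omega> = - 1"
    proof -
      have "expectation \<xi> = expectation (\<lambda>\<omega>. indicator ?P \<omega> - indicator ?N \<omega>)"
      proof (rule integral_cong_AE)
        show "AE \<omega> in M. \<xi> \<omega> = indicator ?P \<omega> - indicator ?N \<omega>"
          using ae AE_space by eventually_elim (auto split: split_indicator)
      qed measurable
      also have "\<dots> = expectation (indicator ?P) - expectation (indicator ?N)"
        using PN by (intro Bochner_Integration.integral_diff integrable_real_indicator) (auto simp: less_top[symmetric])
      also have "\<dots> = prob ?P - prob ?N" using PN by simp
      finally show ?thesis .
    qed
    \<comment> \<open>The two equations p + q = 1 and p - q = 0 have the only solution p = q =
      1/2.\<close>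
    then show ?thesis using sum by (smt (verit, best) field_sum_of_halves)
  qed
  then show ?thesis by (auto simp: random_sign_def)
qed

lemma random_sign_measurable: "random_sign M \<xi> \<Longrightarrow> \<xi> \<in> borel_measurable M"
  and random_sign_AE: "random_sign M \<xi> \<Longrightarrow> AE \<omega> in M. \<xi> \<omega> = 1 \<or> \<xi> \<omega> = - 1"
  and random_sign_expectation: "random_sign M \<xi> \<Longrightarrow> expectation \<xi> = 0"
  by (simp_all add: random_sign_iff)

lemma random_sign_AE_abs: "random_sign M \<xi> \<Longrightarrow> AE \<omega> in M. \<bar>\<xi> \<omega>\<bar> \<le> 1"
  using random_sign_AE[of \<xi>] by (auto elim: eventually_mono)

lemma random_sign_L2: "random_sign M \<xi> \<Longrightarrow> \<xi> \<in> L2 M"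
  by (rule L2_bounded[OF random_sign_measurable random_sign_AE_abs])

lemma random_sign_square: "random_sign M \<xi> \<Longrightarrow> AE \<omega> in M. \<xi> \<omega> * \<xi> \<omega> = 1"
  using random_sign_AE[of \<xi>] by (auto elim: eventually_mono)

section \<open>Fields generated by signs\<close>

lemma sigma_rv_in_CS:
  assumes "\<And>n. n \<in> I \<Longrightarrow> \<zeta> n \<in> borel_measurable M"
  shows "sigma_rv M \<zeta> I \<in> CS"
  unfolding sigma_rv_def using assms by (intro sigma_in_CS) (auto intro: measurable_sets)

lemma sigma_rv_least:
  assumes x: "x \<in> CS" and \<zeta>: "\<And>n. n \<in> I \<Longrightarrow> \<zeta> n \<in> L2_sub M x"
  shows "sigma_rv M \<zeta> I \<subseteq> x"
  unfolding sigma_rv_def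
proof (rule sigma_least_CS[OF x])
  have "\<zeta> n -` A \<inter> space M \<in> x" if "n \<in> I" "A \<in> sets borel" for n A
    using measurable_sets[of "\<zeta> n" "sigma (space M) x" borel A] \<zeta>[OF that(1)] that(2)
    by (simp add: L2_sub_iff[OF x] sets_sigma_CS[OF x] space_measure_of_conv)
  then show "null_sets M \<union> (\<Union>n\<in>I. {\<zeta> n -` A \<inter> space M | A. A \<in> sets borel}) \<subseteq> x"
    using CS_null[OF x] by blast
qed

lemma sigma_rv_L2_sub:
  assumes I: "\<And>n. n \<in> I \<Longrightarrow> \<zeta> n \<in> borel_measurable M" and n: "n \<in> I" and L: "\<zeta> n \<in> L2 M"
  shows "\<zeta> n \<in> L2_sub M (sigma_rv M \<zeta> I)"
proof -
  have s: "sigma_rv M \<zeta> I \<in> CS" using I by (rule sigma_rv_in_CS)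
  have "\<zeta> n \<in> borel_measurable (sigma (space M) (sigma_rv M \<zeta> I))"
  proof (rule measurableI)
    fix A :: "real set" assume "A \<in> sets borel"
    then have "\<zeta> n -` A \<inter> space M \<in> sigma_rv M \<zeta> I"
      unfolding sigma_rv_def using n by (intro sigma_sets.Basic) blast
    then show "\<zeta> n -` A \<inter> space (sigma (space M) (sigma_rv M \<zeta> I)) \<in> sets (sigma (space M) (sigma_rv M \<zeta> I))"
      by (simp add: sets_sigma_CS[OF s] space_measure_of_conv)
  qed simp
  then show ?thesis using L by (simp add: L2_sub_iff[OF s])
qed

lemma sigma_rv_mono:
  assumes "I \<subseteq> J"
  shows "sigma_rv M \<zeta> I \<subseteq> sigma_rv M \<zeta> J"
  unfolding sigma_rv_def using assms by (intro sigma_sets_mono') blast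

text \<open>An event of the field of one sign is determined almost surely by the value of the sign,
  and every function on the two points 1 and -1 is affine.\<close>

lemma indicator_sigma_rv_sign:
  assumes \<eta>: "random_sign M (\<eta> n)" and B: "B \<in> sigma_rv M \<eta> {n}"
  obtains \<alpha> \<beta> where "(indicator B :: 'a \<Rightarrow> real) \<doteq> (\<lambda>\<omega>. \<alpha> + \<beta> * \<eta> n \<omega>)"
proof -
  \<comment> \<open>\<open>S\<close> may be any set of reals, since only its intersection with {1,
    -1} matters; this makes the induction over the sigma-field immediate.\<close>
  have "\<exists>S. AE \<omega> in M. \<omega> \<in> B \<longleftrightarrow> \<eta> n \<omega> \<in> S"
    using B unfolding sigma_rv_def
  proof (induction rule: sigma_sets.induct)
    case (Basic a)
    then show ?case
    proof
      assume "a \<in> null_sets M"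
      then have "AE \<omega> in M. \<omega> \<in> a \<longleftrightarrow> \<eta> n \<omega> \<in> {}" using AE_not_in[of a M] by simp
      then show ?case by blast
    next
      assume "a \<in> (\<Union>n\<in>{n}. {\<eta> n -` A \<inter> space M | A. A \<in> sets borel})"
      then obtain A where a: "a = \<eta> n -` A \<inter> space M" by blast
      have "AE \<omega> in M. \<omega> \<in> a \<longleftrightarrow> \<eta> n \<omega> \<in> A" using AE_space by eventually_elim (simp add: a)
      then show ?case by blast
    qed
  next
    case (Compl a)
    then obtain S where "AE \<omega> in M. \<omega> \<in> a \<longleftrightarrow> \<eta> n \<omega> \<in> S" by blast
    with AE_space have "AE \<omega> in M. \<omega> \<in> space M - a \<longleftrightarrow> \<eta> n \<omega> \<in> - S" by eventually_elim auto
    then show ?case by blast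
  next
    case (Union a)
    then obtain S where "AE \<omega> in M. \<omega> \<in> a i \<longleftrightarrow> \<eta> n \<omega> \<in> S i" for i :: nat by metis
    then have "AE \<omega> in M. \<forall>i. \<omega> \<in> a i \<longleftrightarrow> \<eta> n \<omega> \<in> S i" by (simp add: AE_all_countable)
    then have "AE \<omega> in M. \<omega> \<in> (\<Union>i. a i) \<longleftrightarrow> \<eta> n \<omega> \<in> (\<Union>i. S i)" by eventually_elim auto
    then show ?case by blast
  next
    case Empty
    show ?case by (intro exI[of _ "{}"]) simp
  qed
  then obtain S where S: "AE \<omega> in M. \<omega> \<in> B \<longleftrightarrow> \<eta> n \<omega> \<in> S" by blast
  let ?s = "indicator S :: real \<Rightarrow> real"
  have "(indicator B :: 'a \<Rightarrow> real) \<doteq> (\<lambda>\<omega>. (?s 1 + ?s (- 1)) / 2 + (?s 1 - ?s (- 1)) / 2 * \<eta> n \<omega>)"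
    using S random_sign_AE[OF \<eta>]
  proof eventually_elim
    case (elim \<omega>)
    have "indicator B \<omega> = ?s (\<eta> n \<omega>)" using elim(1) by (simp add: indicator_def)
    then show ?case using elim(2) by (elim disjE) (simp_all add: field_simps)
  qed
  then show thesis by (rule that)
qed

text \<open>Expansion of f in the basis 1, \<eta> n over \<open>w\<close>; the two coefficients are
  obtained by conditioning f and the product of \<eta> n with f on \<open>w\<close>.\<close>

lemma sign_decomposition:
  assumes w: "w \<in> CS" and \<eta>: "random_sign M (\<eta> n)" and y: "y = sigma_rv M \<eta> {n}"
    and ind: "indep_set y w" and f: "f \<in> L2_sub M (Join M {w, y})"
  shows "f \<doteq> (\<lambda>\<omega>. cexp M w f \<omega> + \<eta> n \<omega> * cexp M w (\<lambda>\<omega>. \<eta> n \<omega> * f \<omega>) \<omega>)"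
proof -
  let ?e = "\<eta> n"
  note em [measurable] = random_sign_measurable[OF \<eta>]
  have yCS: "y \<in> CS" unfolding y using em by (intro sigma_rv_in_CS) auto
  define j where "j = Join M {w, y}"
  have j: "j \<in> CS" unfolding j_def using w yCS by (intro Join_in_CS) auto
  have wj: "w \<subseteq> j" and yj: "y \<subseteq> j" unfolding j_def by (intro Join_upper; simp)+
  have fL: "f \<in> L2 M" by (rule L2_sub_L2[OF j f[folded j_def]])
  have eL: "?e \<in> L2 M" by (rule random_sign_L2[OF \<eta>])
  have ey: "?e \<in> L2_sub M y" unfolding y using em eL by (intro sigma_rv_L2_sub) auto
  note eb = random_sign_AE_abs[OF \<eta>]
  have efL: "(\<lambda>\<omega>. ?e \<omega> * f \<omega>) \<in> L2 M" by (rule L2_bounded_mult[OF fL em eb])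
  let ?p = "cexp M w f" and ?q = "cexp M w (\<lambda>\<omega>. ?e \<omega> * f \<omega>)"
  have p: "?p \<in> L2_sub M w" and q: "?q \<in> L2_sub M w" by (rule cexp_L2_sub[OF w fL] cexp_L2_sub[OF w efL])+
  have pL: "?p \<in> L2 M" and qL: "?q \<in> L2 M" using p q L2_sub_L2[OF w] by auto
  have eqL: "(\<lambda>\<omega>. ?e \<omega> * ?q \<omega>) \<in> L2 M" by (rule L2_bounded_mult[OF qL em eb])
  let ?h = "\<lambda>\<omega>. ?p \<omega> + ?e \<omega> * ?q \<omega>"
  have hL: "?h \<in> L2 M" by (rule L2_add[OF pL eqL])
  have "(\<lambda>\<omega>. ?e \<omega> * ?q \<omega>) \<in> L2_sub M j"
    by (rule L2_sub_bounded_mult[OF j L2_sub_mono[OF w j wj q] L2_sub_mono[OF yCS j yj ey] eb])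
  then have h: "?h \<in> L2_sub M j" using L2_sub_mono[OF w j wj p] hL by (auto simp: L2_sub_iff[OF j])
  have sq: "AE \<omega> in M. ?e \<omega> * ?e \<omega> = 1" by (rule random_sign_square[OF \<eta>])
  have e0: "L2_inner M ?e v = 0" if "v \<in> L2_sub M w" for v
    using indep_L2_inner[OF yCS w ind ey that] random_sign_expectation[OF \<eta>] by simp
  have "cexp M j f \<doteq> ?h"
  proof (rule cexp_charact[OF j fL h])
    fix E assume "E \<in> j"
    then have E: "E \<in> sigma_sets (space M) {A \<inter> B | A B. A \<in> w \<and> B \<in> y}"
      unfolding j_def Join_pair_eq_sigma_Int(1)[OF w yCS] .
    show "L2_inner M f (indicator E) = L2_inner M ?h (indicator E)"
    proof (rule L2_inner_indicator_sigma_eq[OF Join_pair_eq_sigma_Int(2-4)[OF w yCS] fL hL _ E])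
      fix E assume "E \<in> {A \<inter> B | A B. A \<in> w \<and> B \<in> y}"
      then obtain A B where E: "E = A \<inter> B" and A: "A \<in> w" and B: "B \<in> y" by blast
      have AM: "A \<in> sets M" and BM: "B \<in> sets M" using A B CS_sets[OF w] CS_sets[OF yCS] by auto
      let ?A = "indicator A :: 'a \<Rightarrow> real"
      have AL: "?A \<in> L2 M" and Aw: "?A \<in> L2_sub M w" by (rule L2_indicator[OF AM] L2_sub_indicator[OF w A])+
      have eA: "(\<lambda>\<omega>. ?e \<omega> * ?A \<omega>) \<in> L2 M" by (rule L2_bounded_mult[OF AL em eb])
      obtain \<alpha> \<beta> where ab: "(indicator B :: 'a \<Rightarrow> real) \<doteq> (\<lambda>\<omega>. \<alpha> + \<beta> * ?e \<omega>)"
        using indicator_sigma_rv_sign[OF \<eta> B[unfolded y]] .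
      let ?t = "\<lambda>\<omega>. \<alpha> * ?A \<omega> + \<beta> * (?e \<omega> * ?A \<omega>)"
      have tL: "?t \<in> L2 M" by (intro L2_add L2_cmult AL eA)
      have "(indicator E :: 'a \<Rightarrow> real) \<doteq> ?t"
        using ab by eventually_elim (simp add: E indicator_inter_arith algebra_simps)
      then have ind_eq: "L2_inner M u (indicator E) = L2_inner M ?t u" if "u \<in> L2 M" for u
        using L2_inner_cong[of u M u "indicator E" ?t] that AM BM tL
        by (simp add: E L2_measurable L2_inner_commute[of M ?t])
      \<comment> \<open>Every test event reduces to the two test functions \<open>?A\<close> and
        \<eta> n times \<open>?A\<close>. The mixed terms vanish by independence (\<open>z\<close>),
        and the square of the sign is one (\<open>z2\<close>).\<close>
      have red: "L2_inner M u (indicator E) = \<alpha> * L2_inner M u ?A + \<beta> * L2_inner M u (\<lambda>\<omega>. ?e \<omega> * ?A \<omega>)"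
        if "u \<in> L2 M" for u
        using ind_eq[OF that] L2_inner_add_left[OF L2_cmult[OF AL] L2_cmult[OF eA] that, of \<alpha> \<beta>]
        by (simp add: L2_inner_cmult_left L2_inner_commute[of M ?A u]
            L2_inner_commute[of M "\<lambda>\<omega>. ?e \<omega> * ?A \<omega>" u])
      have swap: "L2_inner M (\<lambda>\<omega>. ?e \<omega> * u \<omega>) v = L2_inner M u (\<lambda>\<omega>. ?e \<omega> * v \<omega>)" for u v
        by (simp add: L2_inner_def ac_simps)
      have bA: "(\<lambda>\<omega>. ?A \<omega> * v \<omega>) \<in> L2_sub M w" if "v \<in> L2_sub M w" for v
        by (rule L2_sub_bounded_mult[OF w that Aw, of 1]) (auto split: split_indicator)
      have z: "L2_inner M v (\<lambda>\<omega>. ?e \<omega> * ?A \<omega>) = 0" if "v \<in> L2_sub M w" for v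
        using e0[OF bA[OF that]] by (simp add: L2_inner_def ac_simps)
      have z2: "L2_inner M (\<lambda>\<omega>. ?e \<omega> * v \<omega>) (\<lambda>\<omega>. ?e \<omega> * ?A \<omega>) = L2_inner M v ?A" if "v \<in> L2 M" for v
        unfolding L2_inner_def
      proof (rule integral_cong_AE)
        note [measurable] = L2_measurable[OF that] AM
        show "(\<lambda>\<omega>. ?e \<omega> * v \<omega> * (?e \<omega> * ?A \<omega>)) \<in> borel_measurable M" by measurable
        show "(\<lambda>\<omega>. v \<omega> * ?A \<omega>) \<in> borel_measurable M" by measurable
        show "AE \<omega> in M. ?e \<omega> * v \<omega> * (?e \<omega> * ?A \<omega>) = v \<omega> * ?A \<omega>"
          using sq
        proof eventually_elim
          case (elim \<omega>)
          have "?e \<omega> * v \<omega> * (?e \<omega> * ?A \<omega>) = (?e \<omega> * ?e \<omega>) * (v \<omega> * ?A \<omega>)" by simp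
          then show ?case using elim by simp
        qed
      qed
      have "L2_inner M ?h ?A = L2_inner M ?p ?A"
        using L2_inner_add_left[OF pL eqL AL] z[OF q] swap[of ?q ?A] by simp
      also have "\<dots> = L2_inner M f ?A" by (rule cexp_inner[OF w fL Aw])
      finally have 1: "L2_inner M ?h ?A = L2_inner M f ?A" .
      have "L2_inner M ?h (\<lambda>\<omega>. ?e \<omega> * ?A \<omega>) = L2_inner M ?q ?A"
        using L2_inner_add_left[OF pL eqL eA] z[OF p] z2[OF qL] by simp
      also have "\<dots> = L2_inner M f (\<lambda>\<omega>. ?e \<omega> * ?A \<omega>)"
        using cexp_inner[OF w efL Aw] swap[of f ?A] by simp
      finally show "L2_inner M f (indicator E) = L2_inner M ?h (indicator E)"
        using red[OF fL] red[OF hL] 1 by simp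
    qed
  qed
  then show ?thesis using cexp_F_meas[OF j f[folded j_def]] by eventually_elim simp
qed

lemma AE_sign_prod:
  assumes "\<And>k. k \<in> K \<Longrightarrow> AE \<omega> in M. \<zeta> k \<omega> = (1::real) \<or> \<zeta> k \<omega> = - 1"
  shows "AE \<omega> in M. (\<Prod>k\<in>K. \<zeta> k \<omega>) = 1 \<or> (\<Prod>k\<in>K. \<zeta> k \<omega>) = - 1"
  using assms
proof (induction K rule: infinite_finite_induct)
  case (insert k K)
  then have "AE \<omega> in M. \<zeta> k \<omega> = 1 \<or> \<zeta> k \<omega> = - 1"
    "AE \<omega> in M. (\<Prod>k\<in>K. \<zeta> k \<omega>) = 1 \<or> (\<Prod>k\<in>K. \<zeta> k \<omega>) = - 1" by auto
  then show ?case by eventually_elim (use insert in auto)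
qed auto

lemma L2_sign_prod:
  assumes "\<And>k. k \<in> K \<Longrightarrow> random_sign M (\<zeta> k)"
  shows "(\<lambda>\<omega>. \<Prod>k\<in>K. \<zeta> k \<omega>) \<in> L2 M"
proof (rule L2_bounded)
  show "(\<lambda>\<omega>. \<Prod>k\<in>K. \<zeta> k \<omega>) \<in> borel_measurable M"
    by (intro borel_measurable_prod random_sign_measurable assms)
  show "AE \<omega> in M. \<bar>\<Prod>k\<in>K. \<zeta> k \<omega>\<bar> \<le> 1"
    using AE_sign_prod[of K \<zeta>] random_sign_AE[OF assms] by (auto elim: eventually_mono)
qed

text \<open>Squares of signs are one, so products of signs multiply like their index sets under
  symmetric difference; the index set on the right is the symmetric difference of K and {i}.\<close>

lemma sign_prod_toggle:
  assumes \<zeta>: "random_sign M (\<zeta> i)" and K: "finite K"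
  shows "AE \<omega> in M. \<zeta> i \<omega> * (\<Prod>k\<in>K. \<zeta> k \<omega>) = (\<Prod>k\<in>(if i \<in> K then K - {i} else insert i K). \<zeta> k \<omega>)"
  using random_sign_square[OF \<zeta>]
proof eventually_elim
  case (elim \<omega>)
  show ?case
  proof (cases "i \<in> K")
    case True
    then have "(\<Prod>k\<in>K. \<zeta> k \<omega>) = \<zeta> i \<omega> * (\<Prod>k\<in>K - {i}. \<zeta> k \<omega>)" using K by (simp add: prod.remove)
    then have "\<zeta> i \<omega> * (\<Prod>k\<in>K. \<zeta> k \<omega>) = (\<zeta> i \<omega> * \<zeta> i \<omega>) * (\<Prod>k\<in>K - {i}. \<zeta> k \<omega>)" by simp
    then show ?thesis using elim True by simp
  qed (use K in simp)
qed

text \<open>The events whose indicators preserve the orthogonal complement of the products of signs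
  form a sigma-field, and it contains the events generated by a single sign.\<close>

theorem orthogonal_sign_prods_imp_zero:
  assumes \<zeta>: "\<And>k. k \<in> I \<Longrightarrow> random_sign M (\<zeta> k)"
    and u: "u \<in> L2_sub M (sigma_rv M \<zeta> I)"
    and orth: "\<And>K. finite K \<Longrightarrow> K \<subseteq> I \<Longrightarrow> L2_inner M u (\<lambda>\<omega>. \<Prod>k\<in>K. \<zeta> k \<omega>) = 0"
  shows "u \<doteq> (\<lambda>_. 0)"
proof -
  let ?\<sigma> = "sigma_rv M \<zeta> I" and ?P = "\<lambda>K \<omega>. \<Prod>k\<in>K. \<zeta> k \<omega>"
  have \<sigma>: "?\<sigma> \<in> CS" using random_sign_measurable[OF \<zeta>] by (rule sigma_rv_in_CS)
  have P: "?P K \<in> L2 M" if "K \<subseteq> I" for K using \<zeta> that by (intro L2_sign_prod) auto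
  \<comment> \<open>The orthogonal complement of the sign products. By
    \<open>sign_prod_toggle\<close> it is invariant under multiplication by each sign.\<close>
  define U where "U = {u \<in> L2 M. \<forall>K. finite K \<longrightarrow> K \<subseteq> I \<longrightarrow> L2_inner M u (?P K) = 0}"
  have UL: "u \<in> L2 M" if "u \<in> U" for u using that by (simp add: U_def)
  have U_cong: "v \<in> U" if "u \<in> U" "v \<in> L2 M" "u \<doteq> v" for u v
  proof -
    have "L2_inner M u (?P K) = L2_inner M v (?P K)" if "K \<subseteq> I" for K
      using \<open>u \<doteq> v\<close> UL[OF \<open>u \<in> U\<close>] \<open>v \<in> L2 M\<close> P[OF that] by (intro L2_inner_cong L2_measurable) auto
    then show ?thesis using that by (simp add: U_def)
  qed
  have U_diff: "(\<lambda>\<omega>. u \<omega> - v \<omega>) \<in> U" if "u \<in> U" "v \<in> U" for u v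
    using that P by (auto simp: U_def L2_diff L2_inner_diff_left)
  have U_lin: "(\<lambda>\<omega>. a * u \<omega> + b * v \<omega>) \<in> U" if "u \<in> U" "v \<in> U" for u v a b
    using that P by (auto simp: U_def L2_add L2_cmult L2_inner_add_left L2_inner_cmult_left)
  have U_sign: "(\<lambda>\<omega>. \<zeta> i \<omega> * u \<omega>) \<in> U" if u: "u \<in> U" and i: "i \<in> I" for u i
  proof -
    have zL: "(\<lambda>\<omega>. \<zeta> i \<omega> * u \<omega>) \<in> L2 M"
      by (rule L2_bounded_mult[OF UL[OF u] random_sign_measurable[OF \<zeta>[OF i]] random_sign_AE_abs[OF \<zeta>[OF i]]])
    have "L2_inner M (\<lambda>\<omega>. \<zeta> i \<omega> * u \<omega>) (?P K) = 0" if K: "finite K" "K \<subseteq> I" for K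
    proof -
      define K' where "K' = (if i \<in> K then K - {i} else insert i K)"
      have K': "finite K'" "K' \<subseteq> I" using K i by (auto simp: K'_def)
      have "(\<lambda>\<omega>. \<zeta> i \<omega> * ?P K \<omega>) \<doteq> ?P K'"
        unfolding K'_def by (rule sign_prod_toggle[of \<zeta>, OF \<zeta>[OF i] K(1)])
      then have "(\<lambda>\<omega>. (\<zeta> i \<omega> * u \<omega>) * ?P K \<omega>) \<doteq> (\<lambda>\<omega>. u \<omega> * ?P K' \<omega>)"
      proof eventually_elim
        case (elim \<omega>)
        have "(\<zeta> i \<omega> * u \<omega>) * ?P K \<omega> = u \<omega> * (\<zeta> i \<omega> * ?P K \<omega>)" by simp
        then show ?case using elim by simp
      qed
      then have "L2_inner M (\<lambda>\<omega>. \<zeta> i \<omega> * u \<omega>) (?P K) = L2_inner M u (?P K')"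
        unfolding L2_inner_def using L2_measurable[OF zL] L2_measurable[OF P] K(2) K'(2) L2_measurable[OF UL[OF u]]
        by (intro integral_cong_AE borel_measurable_times[of "\<lambda>\<omega>. \<zeta> i \<omega> * u \<omega>"]
            borel_measurable_times[of u]) auto
      then show ?thesis using u K' by (simp add: U_def)
    qed
    then show ?thesis using zL by (simp add: U_def)
  qed
  define D where "D = {E \<in> sets M. \<forall>u\<in>U. (\<lambda>\<omega>. indicator E \<omega> * u \<omega>) \<in> U}"
  have D_Int: "E \<inter> F \<in> D" if "E \<in> D" "F \<in> D" for E F
    using that by (auto simp: D_def indicator_inter_arith mult.assoc)
  have D_Compl: "space M - E \<in> D" if "E \<in> D" for E
  proof -
    have "(\<lambda>\<omega>. indicator (space M - E) \<omega> * u \<omega>) \<in> U" if u: "u \<in> U" for u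
    proof (rule U_cong[OF U_diff[OF u]])
      show "(\<lambda>\<omega>. indicator E \<omega> * u \<omega>) \<in> U" using u \<open>E \<in> D\<close> by (auto simp: D_def)
      show "(\<lambda>\<omega>. indicator (space M - E) \<omega> * u \<omega>) \<in> L2 M"
        using \<open>E \<in> D\<close> by (intro L2_indicator_mult UL[OF u]) (auto simp: D_def)
      show "(\<lambda>\<omega>. u \<omega> - indicator E \<omega> * u \<omega>) \<doteq> (\<lambda>\<omega>. indicator (space M - E) \<omega> * u \<omega>)"
        using AE_space by eventually_elim (auto split: split_indicator)
    qed
    then show ?thesis using that by (auto simp: D_def)
  qed
  have "?\<sigma> \<subseteq> D"
  proof
    fix E assume "E \<in> ?\<sigma>"
    then show "E \<in> D" unfolding sigma_rv_def
    proof (induction rule: sigma_sets.induct)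
      case (Basic E)
      then show ?case
      proof
        assume E: "E \<in> null_sets M"
        have "(\<lambda>\<omega>. indicator E \<omega> * u \<omega>) \<in> U" if u: "u \<in> U" for u
        proof (rule U_cong[OF U_diff[OF u u]])
          show "(\<lambda>\<omega>. indicator E \<omega> * u \<omega>) \<in> L2 M"
            using E by (intro L2_indicator_mult UL[OF u]) auto
          show "(\<lambda>\<omega>. u \<omega> - u \<omega>) \<doteq> (\<lambda>\<omega>. indicator E \<omega> * u \<omega>)"
            using AE_not_in[OF E] by eventually_elim simp
        qed
        then show ?case using E by (auto simp: D_def)
      next
        assume "E \<in> (\<Union>n\<in>I. {\<zeta> n -` A \<inter> space M | A. A \<in> sets borel})"
        then obtain i A where i: "i \<in> I" and A: "A \<in> sets borel" and E: "E = \<zeta> i -` A \<inter> space M" by blast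
        have EM: "E \<in> sets M" unfolding E using random_sign_measurable[OF \<zeta>[OF i]] A by (rule measurable_sets)
        have "E \<in> sigma_rv M \<zeta> {i}" unfolding sigma_rv_def using A by (intro sigma_sets.Basic) (auto simp: E)
        then obtain \<alpha> \<beta> where ab: "(indicator E :: 'a \<Rightarrow> real) \<doteq> (\<lambda>\<omega>. \<alpha> + \<beta> * \<zeta> i \<omega>)"
          using indicator_sigma_rv_sign[of \<zeta> i, OF \<zeta>[OF i]] by blast
        have "(\<lambda>\<omega>. indicator E \<omega> * u \<omega>) \<in> U" if u: "u \<in> U" for u
        proof (rule U_cong[OF U_lin[OF u U_sign[OF u i]]])
          show "(\<lambda>\<omega>. indicator E \<omega> * u \<omega>) \<in> L2 M"
            using EM by (intro L2_indicator_mult UL[OF u]) auto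
          show "(\<lambda>\<omega>. \<alpha> * u \<omega> + \<beta> * (\<zeta> i \<omega> * u \<omega>)) \<doteq> (\<lambda>\<omega>. indicator E \<omega> * u \<omega>)"
            using ab by eventually_elim (simp add: algebra_simps)
        qed
        then show ?case using EM by (auto simp: D_def)
      qed
    next
      case Empty
      have "(\<lambda>_. 0) \<in> U" by (auto simp: U_def L2_zero_fun L2_inner_def)
      then show ?case by (simp add: D_def)
    next
      case (Compl E)
      then show ?case by (intro D_Compl)
    next
      case (Union A)
      have AM: "A i \<in> sets M" for i using Union.IH[of i] by (simp add: D_def)
      \<comment> \<open>Finite unions come from complements and intersections; dominated convergence
        then reaches the countable union.\<close>
      have part: "(\<Union>i<n. A i) \<in> D" for n
      proof (induction n)
        case 0
        have "(\<lambda>_. 0) \<in> U" by (auto simp: U_def L2_zero_fun L2_inner_def)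
        then show ?case by (simp add: D_def)
      next
        case (Suc n)
        have "(\<Union>i<Suc n. A i) = space M - ((space M - (\<Union>i<n. A i)) \<inter> (space M - A n))"
          using sets.sets_into_space[OF AM] by (auto simp: lessThan_Suc)
        then show ?case using Suc Union.IH by (auto intro!: D_Compl D_Int)
      qed
      let ?E = "\<Union>i. A i"
      have EM: "?E \<in> sets M" using AM by auto
      have "(\<lambda>\<omega>. indicator ?E \<omega> * u \<omega>) \<in> U" if u: "u \<in> U" for u
      proof -
        have "L2_inner M (\<lambda>\<omega>. indicator ?E \<omega> * u \<omega>) (?P K) = 0" if K: "finite K" "K \<subseteq> I" for K
        proof -
          let ?g = "\<lambda>\<omega>. u \<omega> * ?P K \<omega>"
          have gi: "integrable M ?g" by (rule L2_mult_integrable[OF UL[OF u] P[OF K(2)]])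
          have [measurable]: "?g \<in> borel_measurable M" using gi by auto
          note [measurable] = AM
          have "(\<lambda>n. \<integral>\<omega>. indicator (\<Union>i<n. A i) \<omega> * ?g \<omega> \<partial>M) \<longlonglongrightarrow> (\<integral>\<omega>. indicator ?E \<omega> * ?g \<omega> \<partial>M)"
          proof (rule integral_dominated_convergence[where w = "\<lambda>\<omega>. \<bar>?g \<omega>\<bar>"])
            show "AE \<omega> in M. (\<lambda>n. indicator (\<Union>i<n. A i) \<omega> * ?g \<omega>) \<longlonglongrightarrow> indicator ?E \<omega> * ?g \<omega>"
              by (intro AE_I2 tendsto_mult_right LIMSEQ_indicator_UN)
          qed (use gi in \<open>auto split: split_indicator\<close>)
          moreover have "(\<integral>\<omega>. indicator (\<Union>i<n. A i) \<omega> * ?g \<omega> \<partial>M) = 0" for n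
          proof -
            have "(\<lambda>\<omega>. indicator (\<Union>i<n. A i) \<omega> * u \<omega>) \<in> U" using part[of n] u by (simp add: D_def)
            then show ?thesis using K by (simp add: U_def L2_inner_def mult.assoc)
          qed
          ultimately have "(\<integral>\<omega>. indicator ?E \<omega> * ?g \<omega> \<partial>M) = 0" by (simp add: LIMSEQ_const_iff)
          then show ?thesis by (simp add: L2_inner_def mult.assoc)
        qed
        then show ?thesis using L2_indicator_mult[OF UL[OF u] EM] by (simp add: U_def)
      qed
      then show ?case using EM by (simp add: D_def)
    qed
  qed
  moreover have uL: "u \<in> L2 M" by (rule L2_sub_L2[OF \<sigma> u])
  then have uU: "u \<in> U" using orth by (simp add: U_def)
  ultimately have "L2_inner M u (indicator E) = 0" if "E \<in> ?\<sigma>" for E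
  proof -
    have "(\<lambda>\<omega>. indicator E \<omega> * u \<omega>) \<in> U" using \<open>?\<sigma> \<subseteq> D\<close> that uU by (auto simp: D_def)
    \<comment> \<open>The empty product is the constant one, so orthogonality to it says that the
      integral of u over E vanishes.\<close>
    then have "L2_inner M (\<lambda>\<omega>. indicator E \<omega> * u \<omega>) (?P {}) = 0"
      unfolding U_def by blast
    then show ?thesis by (simp add: L2_inner_def mult.commute)
  qed
  then have "cexp M ?\<sigma> u \<doteq> (\<lambda>_. 0)"
    by (intro cexp_charact \<sigma> uL L2_sub_const) (simp add: L2_inner_def[of M "\<lambda>_. 0"])
  then show ?thesis using cexp_F_meas[OF \<sigma> u] by eventually_elim simp
qed

section \<open>The closure of a commuting lattice of sub-sigma-fields\<close>

lemma Cl_subset_CS: "Cl M B \<subseteq> CS"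
  unfolding Cl_def using closure_of_subset_topspace[of "strong_topology M" B]
  by (simp add: topspace_strong_topology)

lemma subset_Cl: "B \<subseteq> CS \<Longrightarrow> B \<subseteq> Cl M B"
  unfolding Cl_def by (intro closure_of_subset) (simp add: topspace_strong_topology)

text \<open>Two functions are approximated by one and the same b, as is needed for an alternative
  that speaks of both.\<close>

lemma Cl_approx:
  assumes w: "w \<in> Cl M B" and f: "f \<in> L2 M" and g: "g \<in> L2 M" and e: "0 < e"
  obtains b where "b \<in> B" "b \<in> CS" "L2_norm M (\<lambda>\<omega>. cexp M b f \<omega> - cexp M w f \<omega>) < e"
    "L2_norm M (\<lambda>\<omega>. cexp M b g \<omega> - cexp M w g \<omega>) < e"
proof -
  have wC: "w \<in> CS" using w Cl_subset_CS by blast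
  let ?U = "\<lambda>f. {y \<in> CS. L2_norm M (\<lambda>\<omega>. cexp M y f \<omega> - cexp M w f \<omega>) < e}"
  have "openin (strong_topology M) (?U f)" if "f \<in> L2 M" for f
    unfolding strong_topology_def by (rule topology_generated_by_Basis) (use that e wC in blast)
  then have op: "openin (strong_topology M) (?U f \<inter> ?U g)" using f g by (intro openin_Int)
  have "\<forall>T. w \<in> T \<and> openin (strong_topology M) T \<longrightarrow> (\<exists>b. b \<in> B \<and> b \<in> T)"
    using w unfolding Cl_def in_closure_of by (rule conjunct2)
  moreover have "w \<in> ?U f \<inter> ?U g" using wC e by (simp add: L2_norm_def)
  ultimately have "\<exists>b. b \<in> B \<and> b \<in> ?U f \<inter> ?U g" using op by (elim allE[of _ "?U f \<inter> ?U g"] mp) simp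
  then obtain b where b: "b \<in> B" and b': "b \<in> ?U f \<inter> ?U g" by (elim exE conjE)
  show thesis by (rule that[of b]) (use b b' in simp_all)
qed

text \<open>A zero-one alternative passes from \<open>B\<close> to its closure, because each alternative excludes
  a strong neighbourhood.\<close>

lemma Cl_dichotomy:
  assumes w: "w \<in> Cl M B" and f: "f \<in> L2 M" and g: "g \<in> L2 M"
    and alt: "\<And>b. b \<in> B \<Longrightarrow> b \<in> CS \<Longrightarrow> cexp M b f \<doteq> (\<lambda>_. 0) \<or> cexp M b g \<doteq> g"
  shows "cexp M w f \<doteq> (\<lambda>_. 0) \<or> cexp M w g \<doteq> g"
proof (rule ccontr)
  assume no: "\<not> (cexp M w f \<doteq> (\<lambda>_. 0) \<or> cexp M w g \<doteq> g)"
  have wC: "w \<in> CS" using w Cl_subset_CS by blast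
  let ?d = "L2_norm M (cexp M w f)" and ?d' = "L2_norm M (\<lambda>\<omega>. g \<omega> - cexp M w g \<omega>)"
  have "?d \<noteq> 0" using no L2_norm_eq_0_iff[OF cexp_in_L2[OF wC f]] by blast
  then have d: "0 < ?d" using L2_norm_nonneg[of M "cexp M w f"] by linarith
  have "cexp M w g \<doteq> g" if "AE \<omega> in M. g \<omega> - cexp M w g \<omega> = 0"
    using that by eventually_elim simp
  then have "?d' \<noteq> 0"
    using no L2_norm_eq_0_iff[OF L2_diff[OF g cexp_in_L2[OF wC g]]] by blast
  then have d': "0 < ?d'" using L2_norm_nonneg[of M "\<lambda>\<omega>. g \<omega> - cexp M w g \<omega>"] by linarith
  \<comment> \<open>If both alternatives failed at \<open>w\<close>, both distances would be
    positive, and a b within the smaller of them would satisfy neither alternative.\<close>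
  have "0 < min ?d ?d'" using d d' by (rule min_less_iff_conj[THEN iffD2, OF conjI])
  then obtain b where b: "b \<in> B" "b \<in> CS"
    and fb: "L2_norm M (\<lambda>\<omega>. cexp M b f \<omega> - cexp M w f \<omega>) < ?d"
    and gb: "L2_norm M (\<lambda>\<omega>. cexp M b g \<omega> - cexp M w g \<omega>) < ?d'"
    by (rule Cl_approx[OF w f g]) (simp only: min_less_iff_conj)
  show False
    using alt[OF b]
  proof
    assume "cexp M b f \<doteq> (\<lambda>_. 0)"
    then have "L2_norm M (\<lambda>\<omega>. cexp M b f \<omega> - cexp M w f \<omega>) = L2_norm M (\<lambda>\<omega>. - 1 * cexp M w f \<omega>)"
      by (intro L2_norm_cong L2_measurable L2_diff L2_cmult cexp_in_L2 b wC f) (auto elim: eventually_mono)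
    then show False using fb L2_norm_cmult[of M "- 1" "cexp M w f"] by simp
  next
    assume "cexp M b g \<doteq> g"
    then have "L2_norm M (\<lambda>\<omega>. cexp M b g \<omega> - cexp M w g \<omega>) = L2_norm M (\<lambda>\<omega>. g \<omega> - cexp M w g \<omega>)"
      by (intro L2_norm_cong L2_measurable L2_diff cexp_in_L2 b wC g) (auto elim: eventually_mono)
    then show False using gb by simp
  qed
qed

lemma Cl_limit:
  assumes c: "\<And>k. c k \<in> B" "\<And>k. c k \<in> CS" and w: "w \<in> CS"
    and lim: "\<And>f. f \<in> L2 M \<Longrightarrow> (\<lambda>k. L2_norm M (\<lambda>\<omega>. cexp M (c k) f \<omega> - cexp M w f \<omega>)) \<longlonglongrightarrow> 0"
  shows "w \<in> Cl M B"
proof -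
  have "limitin (strong_topology M) c w sequentially"
    using limitin_strong_topology[of M c w, OF prob_space_axioms c(2) w] lim by blast
  then have "\<forall>T. w \<in> T \<and> openin (strong_topology M) T \<longrightarrow> (\<exists>y. y \<in> B \<and> y \<in> T)"
    using c(1) unfolding limitin_def eventually_sequentially by (meson order_refl)
  then show ?thesis using w by (simp add: Cl_def in_closure_of topspace_strong_topology)
qed

text \<open>Orthogonality to a union of subspaces extends to its span and, by continuity of the
  inner product, to the closure. So it may be tested on one smaller element at a time.\<close>

lemma L2_circ_iff:
  assumes z: "z \<in> CS"
  shows "f \<in> L2_circ M B z \<longleftrightarrow> f \<in> L2_sub M z \<and> (\<forall>w\<in>Cl M B. w \<subset> z \<longrightarrow> cexp M w f \<doteq> (\<lambda>_. 0))"
proof (cases "f \<in> L2_sub M z")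
  case True
  then have f: "f \<in> L2 M" by (rule L2_sub_L2[OF z])
  let ?S = "\<Union>y\<in>{y \<in> Cl M B. y \<subset> z}. L2_sub M y"
  have S: "?S \<subseteq> L2 M" using L2_sub_L2 Cl_subset_CS by blast
  have span: "lin_span ?S \<subseteq> L2 M"
    unfolding lin_span_def using S by (auto intro!: L2_sum L2_cmult)
  have "(\<forall>g\<in>L2_closure M (lin_span ?S). L2_inner M f g = 0) \<longleftrightarrow> (\<forall>g\<in>?S. L2_inner M f g = 0)"
  proof
    assume *: "\<forall>g\<in>L2_closure M (lin_span ?S). L2_inner M f g = 0"
    show "\<forall>g\<in>?S. L2_inner M f g = 0"
    proof
      fix g assume g: "g \<in> ?S"
      have "g \<in> lin_span ?S" using g by (rule lin_span_base)
      moreover have "L2_norm M (\<lambda>\<omega>. g \<omega> - g \<omega>) = 0" by (simp add: L2_norm_def)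
      moreover have "g \<in> L2 M" using S g by blast
      ultimately have "g \<in> L2_closure M (lin_span ?S)"
        unfolding L2_closure_def by (intro CollectI conjI allI impI bexI[of _ g]) simp_all
      then show "L2_inner M f g = 0" using * by blast
    qed
  next
    assume *: "\<forall>g\<in>?S. L2_inner M f g = 0"
    have 0: "L2_inner M h f = 0" if hS: "h \<in> lin_span ?S" for h
    proof -
      obtain F c where F: "finite F" "F \<subseteq> ?S" and h: "h = (\<lambda>\<omega>. \<Sum>g\<in>F. c g * g \<omega>)"
        using hS unfolding lin_span_def mem_Collect_eq by (elim exE conjE)
      have "L2_inner M h f = (\<Sum>g\<in>F. L2_inner M (\<lambda>\<omega>. c g * g \<omega>) f)"
        unfolding h using F(2) S f by (intro L2_inner_sum_left L2_cmult) auto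
      also have "\<dots> = 0"
        using F(2) * by (intro sum.neutral ballI) (auto simp: L2_inner_cmult_left L2_inner_commute[of M _ f])
      finally show ?thesis .
    qed
    show "\<forall>g\<in>L2_closure M (lin_span ?S). L2_inner M f g = 0"
    proof
      fix g assume g: "g \<in> L2_closure M (lin_span ?S)"
      then have gL: "g \<in> L2 M" by (simp add: L2_closure_def)
      have le: "\<bar>L2_inner M f g\<bar> \<le> L2_norm M f * e" if "0 < e" for e
      proof -
        obtain h where h: "h \<in> lin_span ?S" "L2_norm M (\<lambda>\<omega>. g \<omega> - h \<omega>) < e"
          using g \<open>0 < e\<close> by (auto simp: L2_closure_def)
        have hL: "h \<in> L2 M" using h span by blast
        have "L2_inner M f g = L2_inner M (\<lambda>\<omega>. g \<omega> - h \<omega>) f"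
          using 0[OF h(1)] by (simp add: L2_inner_diff_left[OF gL hL f] L2_inner_commute[of M f g])
        then have "\<bar>L2_inner M f g\<bar> \<le> L2_norm M (\<lambda>\<omega>. g \<omega> - h \<omega>) * L2_norm M f"
          using L2_inner_le_norm[OF L2_diff[OF gL hL] f] by simp
        also have "\<dots> \<le> e * L2_norm M f" using h(2) by (intro mult_right_mono) auto
        finally show ?thesis by (simp add: mult.commute)
      qed
      have "(\<lambda>n. L2_norm M f * (1 / real (Suc n))) \<longlonglongrightarrow> L2_norm M f * 0"
        by (intro tendsto_mult tendsto_const LIMSEQ_Suc[OF lim_1_over_n])
      then have "\<bar>L2_inner M f g\<bar> \<le> L2_norm M f * 0"
        by (rule LIMSEQ_le_const) (intro exI allI impI le, simp)
      then show "L2_inner M f g = 0" by simp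
    qed
  qed
  then have "f \<in> L2_circ M B z \<longleftrightarrow> (\<forall>w\<in>Cl M B. w \<subset> z \<longrightarrow> (\<forall>g\<in>L2_sub M w. L2_inner M f g = 0))"
    using True by (auto simp: L2_circ_def)
  also have "\<dots> \<longleftrightarrow> (\<forall>w\<in>Cl M B. w \<subset> z \<longrightarrow> cexp M w f \<doteq> (\<lambda>_. 0))"
  proof (rule ball_cong[OF refl])
    fix w assume "w \<in> Cl M B"
    then have "w \<in> CS" using Cl_subset_CS by (rule subsetD[rotated])
    then show "(w \<subset> z \<longrightarrow> (\<forall>g\<in>L2_sub M w. L2_inner M f g = 0)) \<longleftrightarrow> (w \<subset> z \<longrightarrow> cexp M w f \<doteq> (\<lambda>_. 0))"
      by (simp only: cexp_eq_0_iff[OF _ f])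
  qed
  finally show ?thesis using True by simp
qed (simp add: L2_circ_def)

lemma L2_circ_L2: "z \<in> CS \<Longrightarrow> f \<in> L2_circ M B z \<Longrightarrow> f \<in> L2 M"
  using L2_sub_L2 by (simp add: L2_circ_def)

lemma L2_circ_cong:
  assumes z: "z \<in> CS" and f: "f \<in> L2_circ M B z" and g: "g \<in> borel_measurable M" and fg: "f \<doteq> g"
  shows "g \<in> L2_circ M B z"
proof -
  note f' = f[unfolded L2_circ_iff[OF z]]
  have "cexp M w g \<doteq> (\<lambda>_. 0)" if w: "w \<in> Cl M B" "w \<subset> z" for w
  proof -
    have wC: "w \<in> CS" using w(1) Cl_subset_CS by blast
    have "cexp M w f \<doteq> cexp M w g" by (rule cexp_cong[OF wC L2_measurable[OF L2_circ_L2[OF z f]] g fg])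
    moreover have "cexp M w f \<doteq> (\<lambda>_. 0)" using f' w by blast
    ultimately show ?thesis by eventually_elim simp
  qed
  moreover have "g \<in> L2_sub M z" using L2_sub_cong_AE[OF z _ g fg] f' by blast
  ultimately show ?thesis by (simp add: L2_circ_iff[OF z])
qed

lemma L2_circ_cmult:
  assumes z: "z \<in> CS" and f: "f \<in> L2_circ M B z"
  shows "(\<lambda>\<omega>. c * f \<omega>) \<in> L2_circ M B z"
proof -
  note f' = f[unfolded L2_circ_iff[OF z]]
  have "cexp M w (\<lambda>\<omega>. c * f \<omega>) \<doteq> (\<lambda>_. 0)" if w: "w \<in> Cl M B" "w \<subset> z" for w
  proof -
    have "w \<in> CS" using w(1) Cl_subset_CS by blast
    note cexp_cmult[OF this L2_circ_L2[OF z f], of c]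
    moreover have "cexp M w f \<doteq> (\<lambda>_. 0)" using f' w by blast
    ultimately show ?thesis by eventually_elim simp
  qed
  then show ?thesis using L2_sub_cmult[OF z] f' by (simp add: L2_circ_iff[OF z])
qed

lemma L2_zero_subset_circ: "z \<in> CS \<Longrightarrow> L2_zero M \<subseteq> L2_circ M B z"
proof
  fix f assume z: "z \<in> CS" and f: "f \<in> L2_zero M"
  have "(\<lambda>_. 0) \<in> L2_circ M B z"
    unfolding L2_circ_iff[OF z] using L2_sub_const[OF z] cexp_F_meas[OF _ L2_sub_const] Cl_subset_CS by blast
  moreover have "(\<lambda>_. 0) \<doteq> f" using f by (auto simp: L2_zero_def elim: eventually_mono)
  ultimately show "f \<in> L2_circ M B z" using L2_circ_cong[OF z] f by (simp add: L2_zero_def)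
qed

end


text \<open>What the spectral theory draws from \<open>B\<close>. \<open>B_commute\<close> makes the
  conditional expectations commuting projections whose products are given by intersections;
  \<open>B_countable\<close> lets an intersection of many elements be reached along a decreasing
  sequence, hence inside the closure.\<close>

locale commuting_lattice = prob_space +
  fixes B :: "'a set set set"
  assumes B_CS: "B \<subseteq> complete_subfields M"
    and B_Int: "b \<in> B \<Longrightarrow> c \<in> B \<Longrightarrow> b \<inter> c \<in> B"
    and B_commute: "b \<in> B \<Longrightarrow> c \<in> B \<Longrightarrow> f \<in> L2 M \<Longrightarrow>
      AE \<omega> in M. cexp M b (cexp M c f) \<omega> = cexp M (b \<inter> c) f \<omega>"
    and B_countable: "countable B"
    and B_top: "sets M \<in> B"
begin

lemma B_in_CS: "b \<in> B \<Longrightarrow> b \<in> CS"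
  using B_CS by blast

lemma B_in_Cl: "b \<in> B \<Longrightarrow> b \<in> Cl M B"
  using subset_Cl[OF B_CS] by blast

lemma cexp_Int:
  assumes "b \<in> B" "c \<in> B" "f \<in> L2_sub M c"
  shows "cexp M b f \<doteq> cexp M (b \<inter> c) f"
proof -
  have c: "c \<in> CS" and b: "b \<in> CS" using assms B_in_CS by auto
  have fL: "f \<in> L2 M" by (rule L2_sub_L2[OF c assms(3)])
  have "cexp M b (cexp M c f) \<doteq> cexp M b f"
    using cexp_F_meas[OF c assms(3)] fL
    by (intro cexp_cong b L2_measurable cexp_in_L2 c) auto
  then show ?thesis using B_commute[OF assms(1,2) fL] by eventually_elim simp
qed

text \<open>Removes the closure from the description when z is in \<open>B\<close>. If
  \<open>w\<close> in the closure lies strictly below z, some g over z is not measurable over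
  \<open>w\<close>. Every b in \<open>B\<close> either contains z and fixes g, or meets z in a
  smaller element and kills f. This alternative passes to \<open>w\<close>, which does not fix g and
  therefore kills f.\<close>

lemma L2_circ_iff_B:
  assumes z: "z \<in> B"
  shows "f \<in> L2_circ M B z \<longleftrightarrow> f \<in> L2_sub M z \<and> (\<forall>w\<in>B. w \<subset> z \<longrightarrow> cexp M w f \<doteq> (\<lambda>_. 0))"
    (is "_ \<longleftrightarrow> ?R")
proof -
  have zC: "z \<in> CS" by (rule B_in_CS[OF z])
  have "cexp M w f \<doteq> (\<lambda>_. 0)" if R: ?R and w: "w \<in> Cl M B" "w \<subset> z" for w
  proof -
    have wC: "w \<in> CS" using w(1) Cl_subset_CS by blast
    have fz: "f \<in> L2_sub M z" using R by blast
    have fL: "f \<in> L2 M" by (rule L2_sub_L2[OF zC fz])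
    have "\<not> L2_sub M z \<subseteq> L2_sub M w" using w(2) L2_sub_subset_iff[OF zC wC] by blast
    then obtain g where gz: "g \<in> L2_sub M z" and gw: "g \<notin> L2_sub M w" by blast
    have gL: "g \<in> L2 M" by (rule L2_sub_L2[OF zC gz])
    have "cexp M w f \<doteq> (\<lambda>_. 0) \<or> cexp M w g \<doteq> g"
    proof (rule Cl_dichotomy[OF w(1) fL gL])
      fix b assume b: "b \<in> B" and bC: "b \<in> CS"
      show "cexp M b f \<doteq> (\<lambda>_. 0) \<or> cexp M b g \<doteq> g"
      proof (cases "z \<subseteq> b")
        case True
        then show ?thesis by (intro disjI2 cexp_F_meas bC L2_sub_mono[OF zC bC _ gz])
      next
        case False
        then have "b \<inter> z \<subset> z" by blast
        with R B_Int[OF b z] have "cexp M (b \<inter> z) f \<doteq> (\<lambda>_. 0)" by simp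
        with cexp_Int[OF b z fz] have "cexp M b f \<doteq> (\<lambda>_. 0)" by eventually_elim simp
        then show ?thesis by (rule disjI1)
      qed
    qed
    then show ?thesis using gw L2_sub_iff_cexp[OF wC gL] by simp
  qed
  then show ?thesis unfolding L2_circ_iff[OF zC] using B_in_Cl by metis
qed

lemma cexp_circ:
  assumes z: "z \<in> B" and f: "f \<in> L2_circ M B z" and b: "b \<in> B"
  shows "cexp M b f \<doteq> (if z \<subseteq> b then f else (\<lambda>_. 0))"
proof -
  have fz: "f \<in> L2_sub M z" using f by (simp add: L2_circ_def)
  show ?thesis
  proof (cases "z \<subseteq> b")
    case True
    then show ?thesis
      using cexp_F_meas[OF B_in_CS[OF b] L2_sub_mono[OF B_in_CS[OF z] B_in_CS[OF b] True fz]] by simp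
  next
    case False
    then have "b \<inter> z \<subset> z" by blast
    then have "cexp M (b \<inter> z) f \<doteq> (\<lambda>_. 0)" using f B_Int[OF b z] by (simp add: L2_circ_iff_B[OF z])
    with cexp_Int[OF b z fz] have "cexp M b f \<doteq> (\<lambda>_. 0)" by eventually_elim simp
    then show ?thesis using False by simp
  qed
qed

text \<open>The alternative again, now with every g over z: if \<open>w\<close> does not kill f, it
  fixes all of \<open>L2_sub M z\<close> and therefore contains z.\<close>

lemma cexp_circ_Cl:
  assumes z: "z \<in> B" and f: "f \<in> L2_circ M B z" and w: "w \<in> Cl M B" and zw: "\<not> z \<subseteq> w"
  shows "cexp M w f \<doteq> (\<lambda>_. 0)"
proof (rule ccontr)
  have zC: "z \<in> CS" by (rule B_in_CS[OF z])
  have wC: "w \<in> CS" using w(1) Cl_subset_CS by blast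
  have fL: "f \<in> L2 M" by (rule L2_circ_L2[OF zC f])
  assume no: "\<not> cexp M w f \<doteq> (\<lambda>_. 0)"
  have "g \<in> L2_sub M w" if g: "g \<in> L2_sub M z" for g
  proof -
    have gL: "g \<in> L2 M" by (rule L2_sub_L2[OF zC g])
    have "cexp M w f \<doteq> (\<lambda>_. 0) \<or> cexp M w g \<doteq> g"
    proof (rule Cl_dichotomy[OF w fL gL])
      fix b assume b: "b \<in> B" and bC: "b \<in> CS"
      show "cexp M b f \<doteq> (\<lambda>_. 0) \<or> cexp M b g \<doteq> g"
        using cexp_circ[OF z f b] cexp_F_meas[OF bC L2_sub_mono[OF zC bC _ g]] by (cases "z \<subseteq> b") auto
    qed
    then show ?thesis using no L2_sub_iff_cexp[OF wC gL] by simp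
  qed
  then show False using zw L2_sub_subset_iff[OF zC wC] by blast
qed

text \<open>Only one of the two elements has to be in \<open>B\<close>, so that an element of the
  closure outside \<open>B\<close> can be compared with those inside. If z \<subseteq> w, then z
  kills g; otherwise w kills f.\<close>

lemma L2_circ_orthogonal:
  assumes z: "z \<in> B" "f \<in> L2_circ M B z" and w: "w \<in> Cl M B" "g \<in> L2_circ M B w" and ne: "z \<noteq> w"
  shows "L2_inner M f g = 0"
proof -
  have zC: "z \<in> CS" and wC: "w \<in> CS" using z(1) B_in_CS w(1) Cl_subset_CS by auto
  have fL: "f \<in> L2 M" and gL: "g \<in> L2 M" by (rule L2_circ_L2[OF zC z(2)] L2_circ_L2[OF wC w(2)])+
  show ?thesis
  proof (cases "z \<subseteq> w")
    case True
    then have "cexp M z g \<doteq> (\<lambda>_. 0)" using w(2) ne B_in_Cl[OF z(1)] by (simp add: L2_circ_iff[OF wC] psubset_eq)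
    then have "L2_inner M g f = 0" using cexp_eq_0_iff[OF zC gL] z(2) by (simp add: L2_circ_def)
    then show ?thesis by (simp add: L2_inner_commute)
  next
    case False
    then have "cexp M w f \<doteq> (\<lambda>_. 0)" by (rule cexp_circ_Cl[OF z w(1)])
    then show ?thesis using cexp_eq_0_iff[OF wC fL] w(2) by (simp add: L2_circ_def)
  qed
qed

text \<open>The elements fixing f are closed under intersection, so the finite intersections
  \<open>c k\<close> of an enumeration stay in \<open>B\<close> and decrease to w. Each b either
  fixes f, hence contains w and fixes every g over w, or kills f; by the alternative, an element of
  the closure strictly below w must kill f.\<close>

lemma eigenvector_in_L2_circ:
  assumes f: "f \<in> L2 M" and f0: "\<not> f \<doteq> (\<lambda>_. 0)"
    and eig: "\<And>b. b \<in> B \<Longrightarrow> cexp M b f \<doteq> f \<or> cexp M b f \<doteq> (\<lambda>_. 0)"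
  obtains w where "w \<in> Cl M B" "f \<in> L2_circ M B w"
proof -
  define U where "U = {b \<in> B. cexp M b f \<doteq> f}"
  have U_iff: "b \<in> U \<longleftrightarrow> b \<in> B \<and> f \<in> L2_sub M b" for b
    using L2_sub_iff_cexp[OF B_in_CS f] by (auto simp: U_def)
  have top: "sets M \<in> U" using B_top f by (simp add: U_iff L2_sub_sets)
  have U_Int: "b \<inter> c \<in> U" if "b \<in> U" "c \<in> U" for b c
  proof -
    have bc: "b \<in> B" "c \<in> B" "cexp M b f \<doteq> f" "f \<in> L2_sub M c" using that U_iff by (auto simp: U_def)
    from bc(3) cexp_Int[OF bc(1,2,4)] have "cexp M (b \<inter> c) f \<doteq> f" by eventually_elim simp
    then show ?thesis using B_Int[OF bc(1,2)] by (simp add: U_def)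
  qed
  define \<beta> where "\<beta> = from_nat_into U"
  have "countable U" using B_countable by (rule countable_subset[rotated]) (auto simp: U_def)
  then have range: "range \<beta> = U" using top unfolding \<beta>_def by (intro range_from_nat_into) auto
  define c where "c = (\<lambda>k. \<Inter>j\<le>k. \<beta> j)"
  have cU: "c k \<in> U" for k
  proof (induction k)
    case 0
    then show ?case using range by (auto simp: c_def)
  next
    case (Suc k)
    have "c (Suc k) = c k \<inter> \<beta> (Suc k)" by (auto simp: c_def atMost_Suc)
    then show ?case using U_Int[OF Suc] range by auto
  qed
  have cB: "c k \<in> B" and cC: "c k \<in> CS" for k using cU[of k] B_in_CS by (auto simp: U_def)
  define w where "w = (\<Inter>k. c k)"
  have wb: "w \<subseteq> b" if bU: "b \<in> U" for b
  proof -
    obtain k where "b = \<beta> k" using range bU by blast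
    then have "c k \<subseteq> b" by (auto simp: c_def)
    then show ?thesis by (auto simp: w_def)
  qed
  have wC: "w \<in> CS" unfolding w_def by (intro Int_in_CS cC) auto
  have "w \<in> Cl M B"
  proof (rule Cl_limit[OF cB cC wC])
    fix g assume "g \<in> L2 M"
    then show "(\<lambda>k. L2_norm M (\<lambda>\<omega>. cexp M (c k) g \<omega> - cexp M w g \<omega>)) \<longlonglongrightarrow> 0"
      unfolding w_def by (intro cexp_decreasing_limit cC) (auto simp: c_def)
  qed
  moreover have "f \<in> L2_circ M B w"
    unfolding L2_circ_iff[OF wC]
  proof (intro conjI ballI impI)
    show "f \<in> L2_sub M w" unfolding w_def using cU by (intro L2_sub_INT cC) (simp_all add: U_iff)
  next
    fix v assume v: "v \<in> Cl M B" and vw: "v \<subset> w"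
    have vC: "v \<in> CS" using v Cl_subset_CS by blast
    show "cexp M v f \<doteq> (\<lambda>_. 0)"
    proof (rule ccontr)
      assume no: "\<not> cexp M v f \<doteq> (\<lambda>_. 0)"
      have "g \<in> L2_sub M v" if g: "g \<in> L2_sub M w" for g
      proof -
        have gL: "g \<in> L2 M" by (rule L2_sub_L2[OF wC g])
        have "cexp M v f \<doteq> (\<lambda>_. 0) \<or> cexp M v g \<doteq> g"
        proof (rule Cl_dichotomy[OF v f gL])
          fix b assume b: "b \<in> B" and bC: "b \<in> CS"
          show "cexp M b f \<doteq> (\<lambda>_. 0) \<or> cexp M b g \<doteq> g"
          proof (cases "b \<in> U")
            case True
            then show ?thesis by (intro disjI2 cexp_F_meas bC L2_sub_mono[OF wC bC wb g])
          next
            case False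
            then show ?thesis using eig[OF b] b by (simp add: U_def)
          qed
        qed
        then show ?thesis using no L2_sub_iff_cexp[OF vC gL] by simp
      qed
      then show False using vw L2_sub_subset_iff[OF wC vC] by blast
    qed
  qed
  ultimately show thesis by (rule that)
qed

end

section \<open>Spectral resolutions\<close>

locale spectrally_resolved = commuting_lattice M B for M :: "'a measure" and B :: "'a set set set" +
  fixes S :: "'s measure" and V :: "'s \<Rightarrow> 'h::real_vector set" and ip :: "'s \<Rightarrow> 'h \<Rightarrow> 'h \<Rightarrow> real"
    and \<Gamma> :: "('s \<Rightarrow> 'h) set" and \<Psi> :: "('a \<Rightarrow> real) \<Rightarrow> 's \<Rightarrow> 'h"
  assumes resolution: "spectral_resolution M B S V ip \<Gamma> \<Psi>"
begin

lemma field: "measurable_field S V ip \<Gamma>"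
  and unitary: "unitary_onto_direct_integral M S ip \<Gamma> \<Psi>"
  and noise_operators_eq: "noise_operators M B = {T. L2_operator M T \<and> diagonalized_by M S \<Psi> T}"
  and V_nonzero: "AE s in S. V s \<noteq> {0}"
  and standard: "standard_measure_space S"
  using resolution by (auto simp: spectral_resolution_def)

lemma field_parts:
  "\<forall>s\<in>space S. real_Hilbert_space (V s) (ip s)"
  "\<forall>v\<in>\<Gamma>. \<forall>s\<in>space S. v s \<in> V s"
  "\<forall>v\<in>\<Gamma>. \<forall>w\<in>\<Gamma>. (\<lambda>s. v s + w s) \<in> \<Gamma>"
  "\<forall>v\<in>\<Gamma>. (\<lambda>s. sqrt (ip s (v s) (v s))) \<in> borel_measurable S"
  "\<forall>v. (\<forall>s\<in>space S. v s \<in> V s) \<and> (\<forall>w\<in>\<Gamma>. (\<lambda>s. ip s (v s) (w s)) \<in> borel_measurable S) \<longrightarrow> v \<in> \<Gamma>"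
  "\<exists>e::nat \<Rightarrow> 's \<Rightarrow> 'h. range e \<subseteq> \<Gamma> \<and>
     (\<forall>s\<in>space S. \<forall>v\<in>V s. \<forall>\<epsilon>>0. \<exists>w\<in>span (range (\<lambda>n. e n s)). sqrt (ip s (v - w) (v - w)) < \<epsilon>)"
  using field unfolding measurable_field_def by - (elim conjE, assumption)+

lemma Hilbert: "s \<in> space S \<Longrightarrow> real_Hilbert_space (V s) (ip s)"
  by (rule bspec[OF field_parts(1)])

lemma Gamma_V: "v \<in> \<Gamma> \<Longrightarrow> s \<in> space S \<Longrightarrow> v s \<in> V s"
  by (rule bspec[OF bspec[OF field_parts(2)]])

lemma Gamma_add: "v \<in> \<Gamma> \<Longrightarrow> w \<in> \<Gamma> \<Longrightarrow> (\<lambda>s. v s + w s) \<in> \<Gamma>"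
  by (rule bspec[OF bspec[OF field_parts(3)]])

lemma Gamma_norm_measurable: "v \<in> \<Gamma> \<Longrightarrow> (\<lambda>s. sqrt (ip s (v s) (v s))) \<in> borel_measurable S"
  by (rule bspec[OF field_parts(4)])

lemma Gamma_maximal:
  assumes "\<And>s. s \<in> space S \<Longrightarrow> v s \<in> V s" "\<And>w. w \<in> \<Gamma> \<Longrightarrow> (\<lambda>s. ip s (v s) (w s)) \<in> borel_measurable S"
  shows "v \<in> \<Gamma>"
  by (rule mp[OF spec[OF field_parts(5)]]) (intro conjI ballI assms)

section \<open>Fibrewise algebra and measurable sections\<close>

lemma V_zero: "s \<in> space S \<Longrightarrow> 0 \<in> V s"
  and V_add: "s \<in> space S \<Longrightarrow> u \<in> V s \<Longrightarrow> v \<in> V s \<Longrightarrow> u + v \<in> V s"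
  and V_scale: "s \<in> space S \<Longrightarrow> u \<in> V s \<Longrightarrow> c *\<^sub>R u \<in> V s"
  using Hilbert by (auto simp: real_Hilbert_space_def subspace_def)

lemma ip_commute: "s \<in> space S \<Longrightarrow> u \<in> V s \<Longrightarrow> v \<in> V s \<Longrightarrow> ip s u v = ip s v u"
  and ip_add: "s \<in> space S \<Longrightarrow> u \<in> V s \<Longrightarrow> v \<in> V s \<Longrightarrow> w \<in> V s \<Longrightarrow> ip s (u + v) w = ip s u w + ip s v w"
  and ip_scale: "s \<in> space S \<Longrightarrow> u \<in> V s \<Longrightarrow> v \<in> V s \<Longrightarrow> ip s (c *\<^sub>R u) v = c * ip s u v"
  and ip_pos: "s \<in> space S \<Longrightarrow> u \<in> V s \<Longrightarrow> u \<noteq> 0 \<Longrightarrow> 0 < ip s u u"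
  using Hilbert by (simp_all add: real_Hilbert_space_def)

lemma ip_zero_left: "s \<in> space S \<Longrightarrow> v \<in> V s \<Longrightarrow> ip s 0 v = 0"
  using ip_scale[of s 0 v 0] V_zero by simp

lemma ip_scale_right: "s \<in> space S \<Longrightarrow> u \<in> V s \<Longrightarrow> v \<in> V s \<Longrightarrow> ip s u (c *\<^sub>R v) = c * ip s u v"
  using ip_commute[of s u "c *\<^sub>R v"] ip_scale[of s v u c] ip_commute[of s u v] V_scale by simp

lemma ip_nonneg: "s \<in> space S \<Longrightarrow> u \<in> V s \<Longrightarrow> 0 \<le> ip s u u"
  using ip_pos[of s u] ip_zero_left[of s 0] V_zero by (cases "u = 0") auto

lemma ip_self_eq_0_iff: "s \<in> space S \<Longrightarrow> u \<in> V s \<Longrightarrow> ip s u u = 0 \<longleftrightarrow> u = 0"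
  using ip_pos[of s u] ip_zero_left[of s 0] V_zero by (cases "u = 0") auto

lemma ip_self_measurable:
  assumes v: "v \<in> \<Gamma>"
  shows "(\<lambda>s. ip s (v s) (v s)) \<in> borel_measurable S"
proof -
  have "(\<lambda>s. (sqrt (ip s (v s) (v s)))\<^sup>2) \<in> borel_measurable S"
    using Gamma_norm_measurable[OF v] by measurable
  moreover have "(\<lambda>s. (sqrt (ip s (v s) (v s)))\<^sup>2) \<in> borel_measurable S \<longleftrightarrow>
      (\<lambda>s. ip s (v s) (v s)) \<in> borel_measurable S"
    by (intro measurable_cong) (simp add: ip_nonneg Gamma_V[OF v])
  ultimately show ?thesis by simp
qed

text \<open>A measurable field provides measurable norms; polarization gives the inner
  products.\<close>

lemma ip_measurable:
  assumes v: "v \<in> \<Gamma>" and w: "w \<in> \<Gamma>"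
  shows "(\<lambda>s. ip s (v s) (w s)) \<in> borel_measurable S"
proof -
  let ?p = "\<lambda>s. (ip s (v s + w s) (v s + w s) - ip s (v s) (v s) - ip s (w s) (w s)) / 2"
  have "?p \<in> borel_measurable S"
    using ip_self_measurable[OF Gamma_add[OF v w]] ip_self_measurable[OF v] ip_self_measurable[OF w]
    by measurable
  moreover have "?p s = ip s (v s) (w s)" if s: "s \<in> space S" for s
  proof -
    note V = Gamma_V[OF v s] Gamma_V[OF w s]
    show ?thesis
      using ip_commute[OF s V] ip_add[OF s V V_add[OF s V]] ip_commute[OF s V(1) V_add[OF s V]]
        ip_commute[OF s V(2) V_add[OF s V]] ip_add[OF s V V(1)] ip_add[OF s V V(2)] by simp
  qed
  then have "?p \<in> borel_measurable S \<longleftrightarrow> (\<lambda>s. ip s (v s) (w s)) \<in> borel_measurable S"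
    by (intro measurable_cong)
  ultimately show ?thesis by simp
qed

text \<open>\<Gamma> is closed under constant scalars by definition; for measurable scalar functions
  this follows from its maximality.\<close>

lemma Gamma_scale:
  assumes v: "v \<in> \<Gamma>" and \<phi> [measurable]: "\<phi> \<in> borel_measurable S"
  shows "(\<lambda>s. \<phi> s *\<^sub>R v s) \<in> \<Gamma>"
proof (rule Gamma_maximal)
  fix w assume w: "w \<in> \<Gamma>"
  have "(\<lambda>s. \<phi> s * ip s (v s) (w s)) \<in> borel_measurable S" using ip_measurable[OF v w] by measurable
  moreover have "(\<lambda>s. \<phi> s * ip s (v s) (w s)) \<in> borel_measurable S \<longleftrightarrow>
      (\<lambda>s. ip s (\<phi> s *\<^sub>R v s) (w s)) \<in> borel_measurable S"
    by (intro measurable_cong) (simp add: ip_scale Gamma_V v w)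
  ultimately show "(\<lambda>s. ip s (\<phi> s *\<^sub>R v s) (w s)) \<in> borel_measurable S" by simp
qed (simp add: V_scale Gamma_V v)

section \<open>The unitary onto the direct integral\<close>

lemma Psi_Gamma: "f \<in> L2 M \<Longrightarrow> \<Psi> f \<in> \<Gamma>"
  and Psi_integrable: "f \<in> L2 M \<Longrightarrow> integrable S (\<lambda>s. ip s (\<Psi> f s) (\<Psi> f s))"
  using unitary by (auto simp: unitary_onto_direct_integral_def direct_integral_def)

lemma Psi_add: "f \<in> L2 M \<Longrightarrow> g \<in> L2 M \<Longrightarrow> AE s in S. \<Psi> (\<lambda>\<omega>. f \<omega> + g \<omega>) s = \<Psi> f s + \<Psi> g s"
  and Psi_cmult: "f \<in> L2 M \<Longrightarrow> AE s in S. \<Psi> (\<lambda>\<omega>. c * f \<omega>) s = c *\<^sub>R \<Psi> f s"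
  and Psi_inner: "f \<in> L2 M \<Longrightarrow> g \<in> L2 M \<Longrightarrow> (\<integral>s. ip s (\<Psi> f s) (\<Psi> g s) \<partial>S) = L2_inner M f g"
  using unitary by (simp_all add: unitary_onto_direct_integral_def)

lemma Psi_onto:
  assumes "v \<in> \<Gamma>" "integrable S (\<lambda>s. ip s (v s) (v s))"
  obtains f where "f \<in> L2 M" "AE s in S. \<Psi> f s = v s"
  using unitary assms by (auto simp: unitary_onto_direct_integral_def direct_integral_def)

lemma Psi_V: "f \<in> L2 M \<Longrightarrow> s \<in> space S \<Longrightarrow> \<Psi> f s \<in> V s"
  using Gamma_V[OF Psi_Gamma] .

lemma Psi_eq_0_iff:
  assumes f: "f \<in> L2 M"
  shows "(AE s in S. \<Psi> f s = 0) \<longleftrightarrow> f \<doteq> (\<lambda>_. 0)"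
proof -
  have "f \<doteq> (\<lambda>_. 0) \<longleftrightarrow> L2_norm M f = 0" by (rule L2_norm_eq_0_iff[OF f, symmetric])
  also have "\<dots> \<longleftrightarrow> L2_inner M f f = 0" by (simp add: L2_norm_power2[symmetric])
  also have "\<dots> \<longleftrightarrow> (\<integral>s. ip s (\<Psi> f s) (\<Psi> f s) \<partial>S) = 0" by (simp add: Psi_inner[OF f f])
  also have "\<dots> \<longleftrightarrow> (AE s in S. ip s (\<Psi> f s) (\<Psi> f s) = 0)"
    by (intro integral_nonneg_eq_0_iff_AE Psi_integrable[OF f] AE_I2 ip_nonneg Psi_V[OF f])
  also have "\<dots> \<longleftrightarrow> (AE s in S. \<Psi> f s = 0)"
    by (intro AE_cong ip_self_eq_0_iff Psi_V[OF f])
  finally show ?thesis by simp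
qed

lemma Psi_eq_iff:
  assumes f: "f \<in> L2 M" and g: "g \<in> L2 M"
  shows "(AE s in S. \<Psi> f s = \<Psi> g s) \<longleftrightarrow> f \<doteq> g"
proof -
  \<comment> \<open>The difference is written as a sum with a factor -1, since addition and scaling
    are the operations that \<Psi> is known to respect.\<close>
  let ?h = "\<lambda>\<omega>. f \<omega> + - 1 * g \<omega>"
  have hL: "?h \<in> L2 M" by (intro L2_add L2_cmult f g)
  have h: "AE s in S. \<Psi> ?h s = \<Psi> f s - \<Psi> g s"
    using Psi_add[OF f L2_cmult[OF g, of "- 1"]] Psi_cmult[OF g, of "- 1"] by eventually_elim simp
  have "(AE s in S. \<Psi> f s = \<Psi> g s) \<longleftrightarrow> (AE s in S. \<Psi> ?h s = 0)"
  proof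
    assume "AE s in S. \<Psi> f s = \<Psi> g s"
    with h show "AE s in S. \<Psi> ?h s = 0" by eventually_elim simp
  next
    assume "AE s in S. \<Psi> ?h s = 0"
    with h show "AE s in S. \<Psi> f s = \<Psi> g s" by eventually_elim simp
  qed
  also have "\<dots> \<longleftrightarrow> ?h \<doteq> (\<lambda>_. 0)" by (rule Psi_eq_0_iff[OF hL])
  also have "\<dots> \<longleftrightarrow> f \<doteq> g" by (intro AE_cong) auto
  finally show ?thesis .
qed

lemma Psi_restrict:
  assumes f: "f \<in> L2 M" and E: "E \<in> sets S"
  obtains g where "g \<in> L2 M" "AE s in S. \<Psi> g s = indicator E s *\<^sub>R \<Psi> f s"
proof -
  have G: "(\<lambda>s. indicator E s *\<^sub>R \<Psi> f s) \<in> \<Gamma>"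
    using E by (intro Gamma_scale Psi_Gamma f) auto
  have "integrable S (\<lambda>s. indicator E s *\<^sub>R ip s (\<Psi> f s) (\<Psi> f s))"
    by (rule integrable_mult_indicator[OF E Psi_integrable[OF f]])
  also have "?this \<longleftrightarrow> integrable S (\<lambda>s. ip s (indicator E s *\<^sub>R \<Psi> f s) (indicator E s *\<^sub>R \<Psi> f s))"
    using ip_zero_left V_zero by (intro Bochner_Integration.integrable_cong refl) (auto split: split_indicator)
  finally show thesis using Psi_onto[OF G] that by blast
qed

text \<open>\<open>T\<close> selects preimages under \<Psi> of the sections cut down to E. Such a
  choice is linear only up to null sets, which is the linearity demanded by
  \<open>L2_operator\<close>.\<close>

lemma indicator_noise_operator:
  assumes E: "E \<in> sets S"
  obtains T where "T \<in> noise_operators M B"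
    "\<And>f. f \<in> L2 M \<Longrightarrow> AE s in S. \<Psi> (T f) s = indicator E s *\<^sub>R \<Psi> f s"
proof -
  have "\<exists>g. f \<in> L2 M \<longrightarrow> g \<in> L2 M \<and> (AE s in S. \<Psi> g s = indicator E s *\<^sub>R \<Psi> f s)" for f
    using Psi_restrict[OF _ E, of f] by blast
  then obtain T where TL: "\<And>f. f \<in> L2 M \<Longrightarrow> T f \<in> L2 M"
    and T: "\<And>f. f \<in> L2 M \<Longrightarrow> AE s in S. \<Psi> (T f) s = indicator E s *\<^sub>R \<Psi> f s" by metis
  have "L2_operator M T"
    unfolding L2_operator_def
  proof (intro conjI ballI allI)
    fix f g assume f: "f \<in> L2 M" and g: "g \<in> L2 M"
    have "AE s in S. \<Psi> (T (\<lambda>\<omega>. f \<omega> + g \<omega>)) s = \<Psi> (\<lambda>\<omega>. T f \<omega> + T g \<omega>) s"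
      using T[OF L2_add[OF f g]] Psi_add[OF f g] Psi_add[OF TL[OF f] TL[OF g]] T[OF f] T[OF g]
      by eventually_elim (simp add: scaleR_add_right)
    then show "T (\<lambda>\<omega>. f \<omega> + g \<omega>) \<doteq> (\<lambda>\<omega>. T f \<omega> + T g \<omega>)"
      using Psi_eq_iff[OF TL[OF L2_add[OF f g]] L2_add[OF TL[OF f] TL[OF g]]] by simp
  next
    fix c f assume f: "f \<in> L2 M"
    have "AE s in S. \<Psi> (T (\<lambda>\<omega>. c * f \<omega>)) s = \<Psi> (\<lambda>\<omega>. c * T f \<omega>) s"
      using T[OF L2_cmult[OF f], of c] Psi_cmult[OF f, of c] Psi_cmult[OF TL[OF f], of c] T[OF f]
      by eventually_elim simp
    then show "T (\<lambda>\<omega>. c * f \<omega>) \<doteq> (\<lambda>\<omega>. c * T f \<omega>)"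
      using Psi_eq_iff[OF TL[OF L2_cmult[OF f]] L2_cmult[OF TL[OF f]], of c c] by simp
  next
    have "L2_norm M (T f) \<le> 1 * L2_norm M f" if f: "f \<in> L2 M" for f
    proof -
      have "L2_inner M (T f) (T f) = (\<integral>s. ip s (\<Psi> (T f) s) (\<Psi> (T f) s) \<partial>S)"
        by (rule Psi_inner[OF TL[OF f] TL[OF f], symmetric])
      also have "\<dots> \<le> (\<integral>s. ip s (\<Psi> f s) (\<Psi> f s) \<partial>S)"
      proof (rule integral_mono_AE[OF Psi_integrable[OF TL[OF f]] Psi_integrable[OF f]])
        show "AE s in S. ip s (\<Psi> (T f) s) (\<Psi> (T f) s) \<le> ip s (\<Psi> f s) (\<Psi> f s)"
          using T[OF f] AE_space
          by eventually_elim (auto split: split_indicator simp: ip_zero_left V_zero ip_nonneg Psi_V[OF f])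
      qed
      also have "\<dots> = L2_inner M f f" by (rule Psi_inner[OF f f])
      finally have "(L2_norm M (T f))\<^sup>2 \<le> (L2_norm M f)\<^sup>2" by (simp add: L2_norm_power2)
      then have "L2_norm M (T f) \<le> L2_norm M f" by (rule power2_le_imp_le) simp
      then show ?thesis by simp
    qed
    then show "\<exists>K. \<forall>f\<in>L2 M. L2_norm M (T f) \<le> K * L2_norm M f" by blast
  qed (rule TL)
  moreover have "diagonalized_by M S \<Psi> T"
    unfolding diagonalized_by_def
    by (rule bexI[of _ "indicator E"], intro conjI exI[of _ 1] ballI T)
      (use E in \<open>auto split: split_indicator\<close>)
  ultimately show thesis using T noise_operators_eq by (intro that[of T]) auto
qed

lemma cexp_noise_operator:
  assumes b: "b \<in> B"
  shows "cexp M b \<in> noise_operators M B"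
proof -
  note bC = B_in_CS[OF b]
  have "L2_operator M (cexp M b)"
    unfolding L2_operator_def using cexp_norm_le[OF bC]
    by (intro conjI ballI allI cexp_in_L2[OF bC] cexp_add[OF bC] cexp_cmult[OF bC] exI[of _ 1]) simp_all
  moreover have "\<exists>A\<in>cexp_span M B. \<forall>f\<in>F. L2_norm M (\<lambda>\<omega>. cexp M b f \<omega> - A f \<omega>) < \<epsilon>"
    if "0 < \<epsilon>" for \<epsilon> :: real and F
  proof -
    have "(\<lambda>f \<omega>. \<Sum>x\<in>{b}. 1 * cexp M x f \<omega>) \<in> cexp_span M B"
      unfolding cexp_span_def using b
      by (intro CollectI exI[of _ "{b}"] exI[of _ "\<lambda>_. 1"]) auto
    then show ?thesis
      by (rule bexI[rotated]) (use that in \<open>simp add: L2_norm_def\<close>)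
  qed
  ultimately show ?thesis by (simp add: noise_operators_def)
qed

text \<open>Combinations of conditional expectations multiply e by a scalar, and so do their strong
  limits, because a line is closed: the part \<open>?u\<close> of \<open>T e\<close> orthogonal to e
  is no longer than the distance from \<open>T e\<close> to any multiple of e.\<close>

lemma noise_operator_circ:
  assumes T: "T \<in> noise_operators M B" and z: "z \<in> B" and e: "e \<in> L2_circ M B z"
  obtains t where "T e \<doteq> (\<lambda>\<omega>. t * e \<omega>)"
proof -
  have eL: "e \<in> L2 M" by (rule L2_circ_L2[OF B_in_CS[OF z] e])
  have TeL: "T e \<in> L2 M" using T eL by (simp add: noise_operators_def L2_operator_def)
  define N where "N = (L2_norm M e)\<^sup>2"
  \<comment> \<open>The coefficient of the projection onto e. If e vanishes, the quotient is 0 by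
    convention and orthogonality to e is trivial.\<close>
  define t where "t = L2_inner M (T e) e / N"
  let ?u = "\<lambda>\<omega>. T e \<omega> - t * e \<omega>"
  have uL: "?u \<in> L2 M" by (intro L2_diff L2_cmult TeL eL)
  have ue: "L2_inner M ?u e = 0"
  proof (cases "N = 0")
    case True
    then have "e \<doteq> (\<lambda>_. 0)" using L2_norm_eq_0_iff[OF eL] by (simp add: N_def)
    then have "L2_inner M ?u e = L2_inner M ?u (\<lambda>_. 0)"
      by (intro L2_inner_cong L2_measurable uL eL L2_zero_fun) auto
    then show ?thesis by (simp add: L2_inner_def)
  next
    case False
    have "L2_inner M ?u e = L2_inner M (T e) e - t * N"
      by (simp add: L2_inner_diff_left[OF TeL L2_cmult[OF eL] eL] L2_inner_cmult_left N_def L2_norm_power2)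
    then show ?thesis using False by (simp add: t_def)
  qed
  have "L2_norm M ?u \<le> \<epsilon>" if \<epsilon>: "0 < \<epsilon>" for \<epsilon>
  proof -
    have "finite {e} \<and> {e} \<subseteq> L2 M \<and> 0 < \<epsilon>" using eL \<epsilon> by simp
    then obtain A where A: "A \<in> cexp_span M B" and close: "L2_norm M (\<lambda>\<omega>. T e \<omega> - A e \<omega>) < \<epsilon>"
      using T unfolding noise_operators_def by blast
    obtain C c where C: "finite C" "C \<subseteq> B" and Aeq: "A = (\<lambda>f \<omega>. \<Sum>x\<in>C. c x * cexp M x f \<omega>)"
      using A unfolding cexp_span_def mem_Collect_eq by (elim exE conjE)
    \<comment> \<open>Conditioning on x keeps e if z \<subseteq> x and kills it otherwise, so the
      scalar is the sum of the coefficients of the fields containing z.\<close>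
    define a where "a = (\<Sum>x\<in>C. if z \<subseteq> x then c x else 0)"
    have "AE \<omega> in M. \<forall>x\<in>C. cexp M x e \<omega> = (if z \<subseteq> x then e \<omega> else 0)"
    proof (rule AE_finite_allI[OF C(1)])
      fix x assume "x \<in> C"
      then have "x \<in> B" using C(2) by blast
      from cexp_circ[OF z e this] show "AE \<omega> in M. cexp M x e \<omega> = (if z \<subseteq> x then e \<omega> else 0)"
        by eventually_elim simp
    qed
    then have Ae: "A e \<doteq> (\<lambda>\<omega>. a * e \<omega>)"
    proof eventually_elim
      case (elim \<omega>)
      then have "A e \<omega> = (\<Sum>x\<in>C. (if z \<subseteq> x then c x else 0) * e \<omega>)"
        unfolding Aeq by (intro sum.cong) auto
      then show ?case by (simp add: a_def sum_distrib_right)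
    qed
    have AeL: "A e \<in> L2 M"
      unfolding Aeq using C(2) B_in_CS by (intro L2_sum L2_cmult cexp_in_L2 eL) auto
    have "L2_norm M (\<lambda>\<omega>. T e \<omega> - a * e \<omega>) = L2_norm M (\<lambda>\<omega>. T e \<omega> - A e \<omega>)"
      by (intro L2_norm_cong L2_measurable L2_diff L2_cmult TeL eL AeL)
        (use Ae in \<open>eventually_elim, simp\<close>)
    with close have close': "L2_norm M (\<lambda>\<omega>. T e \<omega> - a * e \<omega>) < \<epsilon>" by simp
    have daL: "(\<lambda>\<omega>. T e \<omega> - a * e \<omega>) \<in> L2 M" by (intro L2_diff L2_cmult TeL eL)
    have "L2_inner M (\<lambda>\<omega>. T e \<omega> - c * e \<omega>) ?u = L2_inner M (T e) ?u" for c
      using ue by (simp add: L2_inner_diff_left[OF TeL L2_cmult[OF eL] uL] L2_inner_cmult_left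
          L2_inner_commute[of M e])
    then have "(L2_norm M ?u)\<^sup>2 = L2_inner M (\<lambda>\<omega>. T e \<omega> - a * e \<omega>) ?u"
      by (simp add: L2_norm_power2)
    also have "\<dots> \<le> L2_norm M (\<lambda>\<omega>. T e \<omega> - a * e \<omega>) * L2_norm M ?u"
      using L2_inner_le_norm[OF daL uL] by linarith
    also have "\<dots> \<le> \<epsilon> * L2_norm M ?u" using close' by (intro mult_right_mono) auto
    finally have "L2_norm M ?u * L2_norm M ?u \<le> \<epsilon> * L2_norm M ?u" by (simp add: power2_eq_square)
    then show ?thesis using \<epsilon> by (cases "L2_norm M ?u = 0") (auto simp: less_le)
  qed
  then have "L2_norm M ?u \<le> 0" by (intro field_le_epsilon[of _ 0]) simp
  then have "L2_norm M ?u = 0" using L2_norm_nonneg[of M ?u] by linarith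
  then have "?u \<doteq> (\<lambda>_. 0)" by (simp add: L2_norm_eq_0_iff[OF uL])
  then have "T e \<doteq> (\<lambda>\<omega>. t * e \<omega>)" by eventually_elim simp
  then show thesis by (rule that)
qed

text \<open>Almost all fibres are non-zero, so one of the countably many fundamental sections is
  non-zero on a part of E of positive measure. Sigma-finiteness makes that part of finite measure,
  and normalizing the section fibrewise makes it square-integrable.\<close>

lemma exists_supported:
  assumes E: "E \<in> sets S" and pos: "0 < emeasure S E"
  obtains f where "f \<in> L2 M" "\<not> f \<doteq> (\<lambda>_. 0)" "AE s in S. \<Psi> f s = indicator E s *\<^sub>R \<Psi> f s"
proof -
  obtain e :: "nat \<Rightarrow> 's \<Rightarrow> 'h" where e: "\<And>n. e n \<in> \<Gamma>"
    and dense: "\<And>s v \<epsilon>. s \<in> space S \<Longrightarrow> v \<in> V s \<Longrightarrow> 0 < \<epsilon> \<Longrightarrow>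
      \<exists>w\<in>span (range (\<lambda>n. e n s)). sqrt (ip s (v - w) (v - w)) < \<epsilon>"
  proof -
    from field_parts(6) obtain e :: "nat \<Rightarrow> 's \<Rightarrow> 'h" where *: "range e \<subseteq> \<Gamma>"
      "\<forall>s\<in>space S. \<forall>v\<in>V s. \<forall>\<epsilon>>0. \<exists>w\<in>span (range (\<lambda>n. e n s)). sqrt (ip s (v - w) (v - w)) < \<epsilon>"
      by (elim exE conjE)
    show thesis
    proof (rule that[of e])
      show "e n \<in> \<Gamma>" for n using *(1) by auto
      show "\<exists>w\<in>span (range (\<lambda>n. e n s)). sqrt (ip s (v - w) (v - w)) < \<epsilon>"
        if "s \<in> space S" "v \<in> V s" "0 < \<epsilon>" for s v \<epsilon>
        using *(2) that by simp
    qed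
  qed
  \<comment> \<open>Sigma-finiteness is given for \<open>N\<close>; it is transported to
    \<open>S\<close> through the completion, off the null set \<open>Z\<close>.\<close>
  obtain Z N where Z: "Z \<in> null_sets S" and N: "sigma_finite_measure N"
    and res: "restrict_space S (space S - Z) = completion N"
    using standard unfolding standard_measure_space_def by (elim conjE bexE exE)
  obtain D :: "nat \<Rightarrow> 's set" where D: "range D \<subseteq> sets N" "(\<Union>i. D i) = space N" "\<And>i. emeasure N (D i) \<noteq> \<infinity>"
    using sigma_finite_measure.sigma_finite[OF N] by metis
  have ZS: "space S - Z \<in> sets S" using Z by auto
  have spN: "space N = space S - Z"
    using arg_cong[OF res, of space] by (simp add: space_restrict_space) blast
  have DS: "D i \<in> sets S" and Dfin: "emeasure S (D i) < \<infinity>" for i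
  proof -
    have Di: "D i \<in> sets (completion N)" "D i \<in> sets N" using D(1) by auto
    then have "D i \<in> sets (restrict_space S (space S - Z))" by (simp add: res)
    then show "D i \<in> sets S" using sets_restrict_space_iff[of "space S - Z" S "D i"] ZS by simp
    have "D i \<subseteq> space S - Z" using spN sets.sets_into_space[OF Di(2)] by simp
    then have "emeasure S (D i) = emeasure (restrict_space S (space S - Z)) (D i)"
      using ZS by (intro emeasure_restrict_space[symmetric]) auto
    also have "\<dots> = emeasure N (D i)" using Di by (simp add: res emeasure_completion)
    finally show "emeasure S (D i) < \<infinity>" using D(3)[of i] by (simp add: less_top)
  qed
  define F where "F = (\<lambda>n. {s \<in> space S. ip s (e n s) (e n s) \<noteq> 0})"
  have FS: "F n \<in> sets S" for n
    unfolding F_def using ip_self_measurable[OF e] by measurable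
  \<comment> \<open>If all fundamental sections vanished at s, their span would be 0, and density
    would force the fibre to be 0.\<close>
  have cover: "AE s in S. s \<in> (\<Union>n. \<Union>i. F n \<inter> D i)"
    using V_nonzero AE_not_in[OF Z] AE_space
  proof eventually_elim
    case (elim s)
    have "\<exists>n. e n s \<noteq> 0"
    proof (rule ccontr)
      assume "\<not> (\<exists>n. e n s \<noteq> 0)"
      then have "span (range (\<lambda>n. e n s)) = {0}" by simp
      then have small: "sqrt (ip s v v) < \<epsilon>" if "v \<in> V s" "0 < \<epsilon>" for v \<epsilon>
        using dense[OF elim(3) that] by simp
      have "v = 0" if v: "v \<in> V s" for v
      proof (rule ccontr)
        assume "v \<noteq> 0"
        then have "0 < sqrt (ip s v v)" using ip_pos[OF elim(3) v] by simp
        then show False using small[OF v] by blast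
      qed
      then show False using elim(1) V_zero[OF elim(3)] by blast
    qed
    then obtain n where "e n s \<noteq> 0" by blast
    then have "s \<in> F n" using elim(3) by (simp add: F_def ip_self_eq_0_iff Gamma_V[OF e])
    moreover obtain i where "s \<in> D i" using D(2) spN elim by blast
    ultimately show ?case by blast
  qed
  have "\<exists>n i. emeasure S (E \<inter> (F n \<inter> D i)) \<noteq> 0"
  proof (rule ccontr)
    assume "\<not> (\<exists>n i. emeasure S (E \<inter> (F n \<inter> D i)) \<noteq> 0)"
    then have "E \<inter> (F n \<inter> D i) \<in> null_sets S" for n i using E FS DS by (auto intro: null_setsI)
    then have "(\<Union>n. \<Union>i. E \<inter> (F n \<inter> D i)) \<in> null_sets S" by (intro null_sets_UN)
    then have "AE s in S. s \<notin> (\<Union>n. \<Union>i. E \<inter> (F n \<inter> D i))" by (rule AE_not_in)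
    with cover have "AE s in S. s \<notin> E" by eventually_elim blast
    then have "emeasure S E = 0" using E by (simp add: AE_iff_null_sets null_setsD1)
    then show False using pos by simp
  qed
  then obtain n i where ni: "emeasure S (E \<inter> (F n \<inter> D i)) \<noteq> 0" by blast
  define A where "A = E \<inter> (F n \<inter> D i)"
  have AS: "A \<in> sets S" unfolding A_def using E FS DS by simp
  have Afin: "emeasure S A < \<infinity>"
    using emeasure_mono[of A "D i" S] DS Dfin[of i] by (auto simp: A_def intro: le_less_trans)
  define v where "v = (\<lambda>s. (indicator A s / sqrt (ip s (e n s) (e n s))) *\<^sub>R e n s)"
  have v\<Gamma>: "v \<in> \<Gamma>"
    unfolding v_def
    by (intro Gamma_scale e borel_measurable_divide borel_measurable_indicator AS Gamma_norm_measurable)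
  have vv: "ip s (v s) (v s) = indicator A s" if s: "s \<in> space S" for s
  proof -
    note V = Gamma_V[OF e s, of n]
    let ?q = "ip s (e n s) (e n s)" and ?c = "indicator A s / sqrt (ip s (e n s) (e n s))"
    have "ip s (v s) (v s) = ?c * (?c * ?q)"
      unfolding v_def by (simp add: ip_scale[OF s V V_scale[OF s V]] ip_scale_right[OF s V V])
    also have "\<dots> = indicator A s"
    proof (cases "s \<in> A")
      case True
      then have "?q \<noteq> 0" by (simp add: A_def F_def)
      then have "0 < ?q" using ip_nonneg[OF s V] by linarith
      then show ?thesis using True by (simp add: field_simps)
    qed simp
    finally show ?thesis .
  qed
  have iv: "integrable S (\<lambda>s. ip s (v s) (v s))"
  proof -
    have "integrable S (indicator A :: 's \<Rightarrow> real)" by (rule integrable_real_indicator[OF AS Afin])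
    then show ?thesis using vv by (subst Bochner_Integration.integrable_cong[OF refl, of _ _ "indicator A"]) auto
  qed
  obtain f where f: "f \<in> L2 M" and fv: "AE s in S. \<Psi> f s = v s" using Psi_onto[OF v\<Gamma> iv] .
  have "\<not> f \<doteq> (\<lambda>_. 0)"
  proof
    assume "f \<doteq> (\<lambda>_. 0)"
    then have "AE s in S. \<Psi> f s = 0" using Psi_eq_0_iff[OF f] by simp
    with fv AE_space have "AE s in S. s \<notin> A"
    proof eventually_elim
      case (elim s)
      then have "v s = 0" by simp
      then show ?case using vv[OF elim(2)] ip_zero_left[OF elim(2) V_zero[OF elim(2)]]
        by (auto simp: indicator_def split: if_splits)
    qed
    then have "emeasure S A = 0" using AS by (simp add: AE_iff_null_sets null_setsD1)
    then show False using ni by (simp add: A_def)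
  qed
  moreover have "AE s in S. \<Psi> f s = indicator E s *\<^sub>R \<Psi> f s"
    using fv by eventually_elim (auto simp: v_def A_def split: split_indicator)
  ultimately show thesis using f that by blast
qed

text \<open>A non-zero vector in the space of an element outside \<open>B\<close> would be
  orthogonal to a total family. For atomicity, cutting e down to a measurable part \<open>G\<close>
  of its support is an operator of the algebra and so acts on e as a scalar; hence that part is
  either null or almost everything.\<close>

theorem total_imp_star:
  assumes total: "\<And>f. f \<in> L2 M \<Longrightarrow> (\<And>z e. z \<in> B \<Longrightarrow> e \<in> L2_circ M B z \<Longrightarrow> L2_inner M f e = 0) \<Longrightarrow>
    AE \<omega> in M. f \<omega> = 0"
  shows "star_condition M B S"
  unfolding star_condition_def
proof
  have "w \<in> B" if w: "w \<in> Cl_circ M B" for w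
  proof (rule ccontr)
    assume wB: "w \<notin> B"
    have wCl: "w \<in> Cl M B" and nz: "L2_circ M B w \<noteq> L2_zero M" using w by (auto simp: Cl_circ_def)
    have wC: "w \<in> CS" using wCl Cl_subset_CS by blast
    obtain f where f: "f \<in> L2_circ M B w" and f0: "f \<notin> L2_zero M"
      using nz L2_zero_subset_circ[OF wC] by blast
    have fL: "f \<in> L2 M" by (rule L2_circ_L2[OF wC f])
    have "f \<doteq> (\<lambda>_. 0)"
    proof (rule total[OF fL])
      fix z e assume z: "z \<in> B" and e: "e \<in> L2_circ M B z"
      have "L2_inner M e f = 0" by (rule L2_circ_orthogonal[OF z e wCl f]) (use z wB in blast)
      then show "L2_inner M f e = 0" by (simp add: L2_inner_commute)
    qed
    then show False using f0 L2_measurable[OF fL] by (simp add: L2_zero_def)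
  qed
  then show "circ M B = Cl_circ M B" by (auto simp: circ_def)
next
  show "purely_atomic S"
    unfolding purely_atomic_def
  proof (intro ballI impI)
    fix E assume E: "E \<in> sets S" and pos: "0 < emeasure S E"
    obtain f where f: "f \<in> L2 M" and f0: "\<not> f \<doteq> (\<lambda>_. 0)"
      and supp: "AE s in S. \<Psi> f s = indicator E s *\<^sub>R \<Psi> f s" using exists_supported[OF E pos] .
    obtain z e where z: "z \<in> B" and e: "e \<in> L2_circ M B z" and fe: "L2_inner M f e \<noteq> 0"
      using total[OF f] f0 by blast
    have eL: "e \<in> L2 M" by (rule L2_circ_L2[OF B_in_CS[OF z] e])
    \<comment> \<open>The candidate for an atom inside E. Since f is carried by E and is not
      orthogonal to e, the support of \<open>\<Psi> e\<close> meets E in positive measure.\<close>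
    define A where "A = E \<inter> {s \<in> space S. ip s (\<Psi> e s) (\<Psi> e s) \<noteq> 0}"
    have "{s \<in> space S. ip s (\<Psi> e s) (\<Psi> e s) \<noteq> 0} \<in> sets S"
      using ip_self_measurable[OF Psi_Gamma[OF eL]] by measurable
    then have AS: "A \<in> sets S" unfolding A_def using E by blast
    have A_ne: "\<Psi> e s \<noteq> 0" if "s \<in> A" for s
      using that ip_zero_left[of s 0] V_zero[of s] by (auto simp: A_def)
    have "emeasure S A \<noteq> 0"
    proof
      assume "emeasure S A = 0"
      then have "AE s in S. s \<notin> A" using AS by (intro AE_not_in null_setsI)
      with supp AE_space have "AE s in S. ip s (\<Psi> f s) (\<Psi> e s) = 0"
      proof eventually_elim
        case (elim s)
        note V = Psi_V[OF f elim(2)] Psi_V[OF eL elim(2)]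
        show ?case
        proof (cases "s \<in> E")
          case True
          then have "\<Psi> e s = 0" using elim V by (simp add: A_def ip_self_eq_0_iff)
          then show ?thesis using ip_scale_right[OF elim(2) V(1) V_zero[OF elim(2)], of 0] by simp
        next
          case False
          then show ?thesis using elim V ip_zero_left by simp
        qed
      qed
      then have "(\<integral>s. ip s (\<Psi> f s) (\<Psi> e s) \<partial>S) = 0" by (rule integral_eq_zero_AE)
      then show False using fe Psi_inner[OF f eL] by simp
    qed
    moreover have "emeasure S G = 0 \<or> emeasure S (A - G) = 0" if G: "G \<in> sets S" "G \<subseteq> A" for G
    proof -
      obtain T where T: "T \<in> noise_operators M B"
        and TG: "\<And>f. f \<in> L2 M \<Longrightarrow> AE s in S. \<Psi> (T f) s = indicator G s *\<^sub>R \<Psi> f s"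
        using indicator_noise_operator[OF G(1)] by blast
      obtain t where t: "T e \<doteq> (\<lambda>\<omega>. t * e \<omega>)" using noise_operator_circ[OF T z e] .
      have TeL: "T e \<in> L2 M" using T eL by (simp add: noise_operators_def L2_operator_def)
      have "AE s in S. \<Psi> (T e) s = \<Psi> (\<lambda>\<omega>. t * e \<omega>) s"
        using t Psi_eq_iff[OF TeL L2_cmult[OF eL]] by simp
      with TG[OF eL] Psi_cmult[OF eL, of t] have *: "AE s in S. s \<in> A \<longrightarrow> indicator G s = t"
      proof eventually_elim
        case (elim s)
        then have "t *\<^sub>R \<Psi> e s = indicator G s *\<^sub>R \<Psi> e s" by simp
        then have "t = indicator G s \<or> \<Psi> e s = 0" by (simp only: scaleR_cancel_right)
        then show ?case using A_ne[of s] by auto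
      qed
      \<comment> \<open>On \<open>A\<close> the section \<open>\<Psi> e\<close> does not vanish, so
        the indicator of \<open>G\<close> equals t almost everywhere there: t = 1 makes A - G null,
        any other t makes \<open>G\<close> null.\<close>
      show ?thesis
      proof (cases "t = 1")
        case True
        then have "AE s in S. s \<notin> A - G" using * by (auto elim!: eventually_mono split: split_indicator_asm)
        then show ?thesis using AS G by (simp add: AE_iff_null_sets null_setsD1)
      next
        case False
        then have "AE s in S. s \<notin> G" using * G(2) by (auto elim!: eventually_mono split: split_indicator_asm)
        then show ?thesis using G by (simp add: AE_iff_null_sets null_setsD1)
      qed
    qed
    ultimately have "measure_atom S A" using AS by (auto simp: measure_atom_def zero_less_iff_neq_zero)
    then show "\<exists>A. measure_atom S A \<and> A \<subseteq> E" by (auto simp: A_def)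
  qed
qed

text \<open>A vector carried by a single atom is an eigenvector of every conditional expectation.\<close>

theorem star_imp_sets:
  assumes star: "star_condition M B S" and u: "u \<in> complete_subfields M"
    and circ_u: "\<And>z. z \<in> B \<Longrightarrow> L2_circ M B z \<subseteq> L2_sub M u"
  shows "u = sets M"
proof
  show "u \<subseteq> sets M" by (rule CS_sets[OF u])
next
  have circ_eq: "circ M B = Cl_circ M B" and atomic: "purely_atomic S"
    using star by (simp_all add: star_condition_def)
  show "sets M \<subseteq> u"
  proof
    fix E0 assume E0: "E0 \<in> sets M"
    let ?h = "indicator E0 :: 'a \<Rightarrow> real"
    have hL: "?h \<in> L2 M" by (rule L2_indicator[OF E0])
    note phL = cexp_in_L2[OF u hL]
    \<comment> \<open>If \<open>E0\<close> were missing from \<open>u\<close>, its residual g would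
      be a non-zero vector orthogonal to everything over \<open>u\<close>, in particular to the
      spaces of all elements of \<open>B\<close>.\<close>
    define g where "g = (\<lambda>\<omega>. ?h \<omega> - cexp M u ?h \<omega>)"
    have gL: "g \<in> L2 M" unfolding g_def by (rule L2_diff[OF hL phL])
    have g_orth: "L2_inner M g v = 0" if "v \<in> L2_sub M u" for v
      unfolding g_def using L2_inner_diff_left[OF hL phL L2_sub_L2[OF u that]] cexp_inner[OF u hL that] by simp
    have "g \<doteq> (\<lambda>_. 0)"
    proof (rule ccontr)
      assume g0: "\<not> g \<doteq> (\<lambda>_. 0)"
      let ?n = "\<lambda>s. ip s (\<Psi> g s) (\<Psi> g s)"
      define E where "E = {s \<in> space S. ?n s \<noteq> 0}"
      have ES: "E \<in> sets S" unfolding E_def using ip_self_measurable[OF Psi_Gamma[OF gL]] by measurable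
      have "emeasure S E \<noteq> 0"
      proof
        assume "emeasure S E = 0"
        then have "AE s in S. s \<notin> E" using ES by (intro AE_not_in null_setsI)
        with AE_space have "AE s in S. \<Psi> g s = 0"
          by eventually_elim (simp add: E_def ip_self_eq_0_iff Psi_V[OF gL])
        then show False using g0 Psi_eq_0_iff[OF gL] by simp
      qed
      then obtain A where A: "measure_atom S A" and AE: "A \<subseteq> E"
        using atomic ES by (auto simp: purely_atomic_def zero_less_iff_neq_zero)
      have AS: "A \<in> sets S" and Apos: "0 < emeasure S A"
        and atom: "\<And>G. G \<in> sets S \<Longrightarrow> G \<subseteq> A \<Longrightarrow> emeasure S G = 0 \<or> emeasure S (A - G) = 0"
        using A by (auto simp: measure_atom_def)
      \<comment> \<open>Cutting g down to an atom inside its support keeps it correlated with g: the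
        inner product is the integral of \<open>?n\<close> over \<open>A\<close>.\<close>
      obtain f where f: "f \<in> L2 M" and fA: "AE s in S. \<Psi> f s = indicator A s *\<^sub>R \<Psi> g s"
        using Psi_restrict[OF gL AS] .
      have fg: "L2_inner M f g \<noteq> 0"
      proof
        assume "L2_inner M f g = 0"
        then have "(\<integral>s. ip s (\<Psi> f s) (\<Psi> g s) \<partial>S) = 0" using Psi_inner[OF f gL] by simp
        also have "(\<integral>s. ip s (\<Psi> f s) (\<Psi> g s) \<partial>S) = (\<integral>s. indicator A s *\<^sub>R ?n s \<partial>S)"
        proof (rule integral_cong_AE)
          show "(\<lambda>s. ip s (\<Psi> f s) (\<Psi> g s)) \<in> borel_measurable S" by (intro ip_measurable Psi_Gamma f gL)
          show "(\<lambda>s. indicator A s *\<^sub>R ?n s) \<in> borel_measurable S"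
            using AS ip_self_measurable[OF Psi_Gamma[OF gL]] by measurable
          show "AE s in S. ip s (\<Psi> f s) (\<Psi> g s) = indicator A s *\<^sub>R ?n s"
            using fA AE_space by eventually_elim (simp add: ip_scale Psi_V[OF gL])
        qed
        finally have "AE s in S. indicator A s *\<^sub>R ?n s = 0"
          using AE_space integrable_mult_indicator[OF AS Psi_integrable[OF gL]]
          by (subst (asm) integral_nonneg_eq_0_iff_AE) (auto simp: ip_nonneg Psi_V[OF gL])
        then have "AE s in S. s \<notin> A"
          by eventually_elim (use AE in \<open>auto simp: E_def\<close>)
        then have "emeasure S A = 0" using AS by (simp add: AE_iff_null_sets null_setsD1)
        then show False using Apos by simp
      qed
      have f0: "\<not> f \<doteq> (\<lambda>_. 0)"
      proof
        assume "f \<doteq> (\<lambda>_. 0)"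
        then have "L2_inner M f g = L2_inner M (\<lambda>_. 0) g"
          by (intro L2_inner_cong L2_measurable f gL L2_zero_fun) auto
        then show False using fg by (simp add: L2_inner_def)
      qed
      have eig: "cexp M b f \<doteq> f \<or> cexp M b f \<doteq> (\<lambda>_. 0)" if b: "b \<in> B" for b
      proof -
        note bC = B_in_CS[OF b]
        note pL = cexp_in_L2[OF bC f]
        obtain \<phi> where \<phi>: "\<phi> \<in> borel_measurable S"
          and diag: "\<And>f. f \<in> L2 M \<Longrightarrow> AE s in S. \<Psi> (cexp M b f) s = \<phi> s *\<^sub>R \<Psi> f s"
          using cexp_noise_operator[OF b] unfolding noise_operators_eq diagonalized_by_def by blast
        have "cexp M b (cexp M b f) \<doteq> cexp M b f" by (rule cexp_F_meas[OF bC cexp_L2_sub[OF bC f]])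
        then have idem: "AE s in S. \<Psi> (cexp M b (cexp M b f)) s = \<Psi> (cexp M b f) s"
          using Psi_eq_iff[OF cexp_in_L2[OF bC pL] pL] by simp
        \<comment> \<open>Idempotence of the conditional expectation forces \<phi> to be 0 or 1
          wherever \<Psi> f is non-zero; the atom decides for one of the two cases on almost all of
          \<open>A\<close>.\<close>
        define G where "G = A \<inter> {s \<in> space S. \<phi> s = 1}"
        have "{s \<in> space S. \<phi> s = 1} \<in> sets S" using \<phi> by measurable
        then have GS: "G \<in> sets S" unfolding G_def using AS by blast
        have "emeasure S G = 0 \<or> emeasure S (A - G) = 0" by (rule atom[OF GS]) (simp add: G_def)
        then show ?thesis
        proof
          assume "emeasure S G = 0"
          then have "AE s in S. s \<notin> G" using GS by (intro AE_not_in null_setsI)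
          with AE_space fA diag[OF f] diag[OF pL] idem have "AE s in S. \<Psi> (cexp M b f) s = 0"
          proof eventually_elim
            case (elim s)
            show ?case
            proof (cases "s \<in> A")
              case True
              then have "\<phi> s \<noteq> 1" using elim by (simp add: G_def)
              moreover have "(\<phi> s * (\<phi> s - 1)) *\<^sub>R \<Psi> f s = 0"
                using elim by (simp add: algebra_simps)
              ultimately have "\<phi> s *\<^sub>R \<Psi> f s = 0" by auto
              then show ?thesis using elim by simp
            next
              case False
              then show ?thesis using elim by simp
            qed
          qed
          then show ?thesis using Psi_eq_0_iff[OF pL] by simp
        next
          assume "emeasure S (A - G) = 0"
          then have "AE s in S. s \<notin> A - G" using AS GS by (intro AE_not_in null_setsI) auto
          with AE_space fA diag[OF f] have "AE s in S. \<Psi> (cexp M b f) s = \<Psi> f s"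
            by eventually_elim (auto simp: G_def split: split_indicator)
          then show ?thesis using Psi_eq_iff[OF pL f] by simp
        qed
      qed
      obtain w where w: "w \<in> Cl M B" and fw: "f \<in> L2_circ M B w"
        using eigenvector_in_L2_circ[OF f f0 eig] .
      have "f \<notin> L2_zero M" using f0 by (simp add: L2_zero_def)
      then have "w \<in> Cl_circ M B" using w fw by (auto simp: Cl_circ_def)
      then have "w \<in> B" using circ_eq by (auto simp: circ_def)
      \<comment> \<open>Now f is measurable over \<open>u\<close> and correlated with g, although g
        is orthogonal to everything over \<open>u\<close>.\<close>
      then have "f \<in> L2_sub M u" using circ_u fw by blast
      then show False using g_orth fg by (simp add: L2_inner_commute)
    qed
    then have "cexp M u ?h \<doteq> ?h" unfolding g_def by eventually_elim simp
    then show "E0 \<in> u" using L2_sub_iff_cexp[OF u hL] indicator_in_L2_sub_iff[OF u E0] by simp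
  qed
qed

end

section \<open>Sequences of signs adapted to a decreasing sequence\<close>

context prob_space
begin

lemma space_in_CS: "x \<in> CS \<Longrightarrow> space M \<in> x"
  using CS_trivial[of x] by (auto simp: trivial_field_def prob_space)

text \<open>An event of \<open>z (Suc n)\<close> and an event of the next tail both lie in
  \<open>x (Suc n)\<close>, so a product formula with one tail event peels off one factor at a time.
  In the first conclusion the last index \<open>Suc n\<close> stands for the tail
  \<open>x (Suc n)\<close>.\<close>

lemma indep_sets_decreasing:
  assumes x: "\<And>n. x n \<in> CS" and z: "\<And>n. z n \<in> CS" and zx: "\<And>n. z n \<subseteq> x n"
    and dec: "\<And>n. x (Suc n) \<subseteq> x n" and ind: "\<And>n. indep_set (z n) (x (Suc n))"
  shows "indep_sets (\<lambda>j. if j \<le> n then z j else x (Suc n)) {..Suc n}"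
    and "indep_sets z UNIV"
proof -
  have prod: "prob ((\<Inter>i\<le>n. A i) \<inter> X) = (\<Prod>i\<le>n. prob (A i)) * prob X"
    if "\<And>i. i \<le> n \<Longrightarrow> A i \<in> z i" "X \<in> x (Suc n)" for n A X
    using that
  proof (induction n arbitrary: X)
    case 0
    then show ?case using indep_setD[OF ind[of 0]] by simp
  next
    case (Suc n)
    interpret X: sigma_algebra "space M" "x (Suc n)" by (rule CS_sigma_algebra[OF x])
    have AS: "A (Suc n) \<in> z (Suc n)" using Suc.prems by simp
    have "A (Suc n) \<inter> X \<in> x (Suc n)"
      using AS zx[of "Suc n"] Suc.prems(2) dec[of "Suc n"] by blast
    then have "prob ((\<Inter>i\<le>n. A i) \<inter> (A (Suc n) \<inter> X)) = (\<Prod>i\<le>n. prob (A i)) * prob (A (Suc n) \<inter> X)"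
      using Suc.prems(1) by (intro Suc.IH) auto
    moreover have "prob (A (Suc n) \<inter> X) = prob (A (Suc n)) * prob X"
      by (rule indep_setD[OF ind AS Suc.prems(2)])
    moreover have "(\<Inter>i\<le>Suc n. A i) \<inter> X = (\<Inter>i\<le>n. A i) \<inter> (A (Suc n) \<inter> X)" by (auto simp: atMost_Suc)
    ultimately show ?case by (simp add: atMost_Suc mult_ac)
  qed
  show fin: "indep_sets (\<lambda>j. if j \<le> n then z j else x (Suc n)) {..Suc n}" for n
  proof (subst indep_sets_finite)
    show "space M \<in> (if j \<le> n then z j else x (Suc n))" for j
      using space_in_CS[OF z] space_in_CS[OF x] by simp
    show "(if j \<le> n then z j else x (Suc n)) \<subseteq> events" for j
      using CS_sets[OF z] CS_sets[OF x] by simp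
    show "\<forall>A\<in>Pi {..Suc n} (\<lambda>j. if j \<le> n then z j else x (Suc n)).
        prob (\<Inter>j\<in>{..Suc n}. A j) = (\<Prod>j\<in>{..Suc n}. prob (A j))"
    proof
      fix A assume A: "A \<in> Pi {..Suc n} (\<lambda>j. if j \<le> n then z j else x (Suc n))"
      have "A i \<in> z i" if "i \<le> n" for i using Pi_mem[OF A, of i] that by simp
      moreover have "A (Suc n) \<in> x (Suc n)" using Pi_mem[OF A, of "Suc n"] by simp
      ultimately have "prob ((\<Inter>i\<le>n. A i) \<inter> A (Suc n)) = (\<Prod>i\<le>n. prob (A i)) * prob (A (Suc n))" by (rule prod)
      moreover have "(\<Inter>j\<in>{..Suc n}. A j) = (\<Inter>i\<le>n. A i) \<inter> A (Suc n)" by (auto simp: atMost_Suc)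
      ultimately show "prob (\<Inter>j\<in>{..Suc n}. A j) = (\<Prod>j\<in>{..Suc n}. prob (A j))"
        by (simp add: atMost_Suc mult.commute)
    qed
  qed auto
  show "indep_sets z UNIV"
  proof (subst indep_sets_finite_index_sets, intro allI impI)
    fix J :: "nat set" assume "finite J"
    then obtain n where J: "J \<subseteq> {..n}" using finite_nat_iff_bounded_le by blast
    then have "indep_sets (\<lambda>j. if j \<le> n then z j else x (Suc n)) J"
      by (intro indep_sets_mono_index[OF _ fin[of n]]) auto
    moreover have "indep_sets (\<lambda>j. if j \<le> n then z j else x (Suc n)) J = indep_sets z J"
      using J by (intro indep_sets_cong) auto
    ultimately show "indep_sets z J" by simp
  qed
qed

text \<open>Conditioning on x fixes the approximating vectors and is a contraction, hence it fixes
  their limit.\<close>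

lemma L2_closure_L2_sub:
  assumes x: "x \<in> CS" and G: "G \<subseteq> L2_sub M x"
  shows "L2_closure M G \<subseteq> L2_sub M x"
proof
  fix f assume f: "f \<in> L2_closure M G"
  then have fL: "f \<in> L2 M" by (simp add: L2_closure_def)
  note pL = cexp_in_L2[OF x fL]
  have "L2_norm M (\<lambda>\<omega>. f \<omega> - cexp M x f \<omega>) \<le> e" if "0 < e" for e
  proof -
    have "0 < e / 2" using \<open>0 < e\<close> by simp
    then obtain h where h: "h \<in> G" and fh: "L2_norm M (\<lambda>\<omega>. f \<omega> - h \<omega>) < e / 2"
      using f unfolding L2_closure_def by blast
    have hx: "h \<in> L2_sub M x" using h G by blast
    have hL: "h \<in> L2 M" by (rule L2_sub_L2[OF x hx])
    have "L2_norm M (\<lambda>\<omega>. h \<omega> - cexp M x f \<omega>) = L2_norm M (\<lambda>\<omega>. cexp M x h \<omega> - cexp M x f \<omega>)"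
      by (intro L2_norm_cong L2_measurable L2_diff cexp_in_L2 x hL fL)
        (use cexp_F_meas[OF x hx] in \<open>eventually_elim, simp\<close>)
    also have "\<dots> \<le> L2_norm M (\<lambda>\<omega>. h \<omega> - f \<omega>)" by (rule cexp_diff_norm_le[OF x hL fL])
    also have "\<dots> < e / 2" using fh by (subst L2_norm_minus_commute)
    finally show ?thesis using L2_norm_triangle_diff[OF fL hL pL] fh by linarith
  qed
  then have "L2_norm M (\<lambda>\<omega>. f \<omega> - cexp M x f \<omega>) \<le> 0" by (intro field_le_epsilon[of _ 0]) simp
  then have "L2_norm M (\<lambda>\<omega>. f \<omega> - cexp M x f \<omega>) = 0"
    using L2_norm_nonneg[of M "\<lambda>\<omega>. f \<omega> - cexp M x f \<omega>"] by linarith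
  then have "AE \<omega> in M. f \<omega> - cexp M x f \<omega> = 0" by (simp only: L2_norm_eq_0_iff[OF L2_diff[OF fL pL]])
  then have "cexp M x f \<doteq> f" by eventually_elim simp
  then show "f \<in> L2_sub M x" by (simp only: L2_sub_iff_cexp[OF x fL])
qed

lemma lin_span_in_L2_sub:
  assumes x: "x \<in> CS" and G: "G \<subseteq> L2_sub M x"
  shows "lin_span G \<subseteq> L2_sub M x"
proof
  fix h assume "h \<in> lin_span G"
  then obtain F c where F: "finite F" "F \<subseteq> G" and h: "h = (\<lambda>\<omega>. \<Sum>g\<in>F. c g * g \<omega>)"
    unfolding lin_span_def mem_Collect_eq by (elim exE conjE)
  have "g \<in> L2 M" "g \<in> borel_measurable (sigma (space M) x)" if "g \<in> F" for g
    using F(2) G that L2_sub_iff[OF x] by auto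
  then show "h \<in> L2_sub M x"
    unfolding L2_sub_iff[OF x] h
    by (intro conjI L2_sum L2_cmult borel_measurable_sum borel_measurable_times borel_measurable_const) auto
qed

lemma sign_prod_in_L2_sub:
  assumes x: "x \<in> CS" and \<zeta>: "\<And>k. k \<in> K \<Longrightarrow> random_sign M (\<zeta> k)" "\<And>k. k \<in> K \<Longrightarrow> \<zeta> k \<in> L2_sub M x"
  shows "(\<lambda>\<omega>. \<Prod>k\<in>K. \<zeta> k \<omega>) \<in> L2_sub M x"
  unfolding L2_sub_iff[OF x]
proof
  show "(\<lambda>\<omega>. \<Prod>k\<in>K. \<zeta> k \<omega>) \<in> L2 M" by (rule L2_sign_prod[OF \<zeta>(1)])
  show "(\<lambda>\<omega>. \<Prod>k\<in>K. \<zeta> k \<omega>) \<in> borel_measurable (sigma (space M) x)"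
    using \<zeta>(2) by (intro borel_measurable_prod) (simp add: L2_sub_iff[OF x])
qed

lemma AE_abs_sign_prod_le:
  assumes "\<And>k. k \<in> K \<Longrightarrow> random_sign M (\<zeta> k)"
  shows "AE \<omega> in M. \<bar>\<Prod>k\<in>K. \<zeta> k \<omega>\<bar> \<le> 1"
  using AE_sign_prod[of K \<zeta>, OF random_sign_AE[OF assms]] by (auto elim: eventually_mono)

text \<open>The residual of f after projection to the closed span is orthogonal to all sign
  products, so it vanishes.\<close>

theorem sigma_rv_span:
  assumes \<zeta>: "\<And>k. k \<in> I \<Longrightarrow> random_sign M (\<zeta> k)"
    and P: "\<And>K. finite K \<Longrightarrow> K \<subseteq> I \<Longrightarrow> (\<lambda>\<omega>. \<Prod>k\<in>K. \<zeta> k \<omega>) \<in> G"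
    and G: "G \<subseteq> L2_sub M (sigma_rv M \<zeta> I)"
  shows "L2_closure M (lin_span G) = L2_sub M (sigma_rv M \<zeta> I)"
proof
  let ?\<sigma> = "sigma_rv M \<zeta> I"
  have \<sigma>: "?\<sigma> \<in> CS" using random_sign_measurable[OF \<zeta>] by (rule sigma_rv_in_CS)
  have span: "lin_span G \<subseteq> L2_sub M ?\<sigma>" by (rule lin_span_in_L2_sub[OF \<sigma> G])
  show sub: "L2_closure M (lin_span G) \<subseteq> L2_sub M ?\<sigma>" by (rule L2_closure_L2_sub[OF \<sigma> span])
  show "L2_sub M ?\<sigma> \<subseteq> L2_closure M (lin_span G)"
  proof
    fix f assume f: "f \<in> L2_sub M ?\<sigma>"
    have fL: "f \<in> L2 M" by (rule L2_sub_L2[OF \<sigma> f])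
    have spanL: "lin_span G \<subseteq> L2 M" using span L2_sub_L2[OF \<sigma>] by blast
    have ne: "lin_span G \<noteq> {}" using lin_span_base[OF P[of "{}"]] by auto
    obtain v where v: "v \<in> L2_closure M (lin_span G)"
      and orth: "\<And>h. h \<in> lin_span G \<Longrightarrow> L2_inner M (\<lambda>\<omega>. f \<omega> - v \<omega>) h = 0"
      using L2_projection[OF spanL ne lin_span_add lin_span_cmult fL] by blast
    have v\<sigma>: "v \<in> L2_sub M ?\<sigma>" using v sub by blast
    have vL: "v \<in> L2 M" by (rule L2_sub_L2[OF \<sigma> v\<sigma>])
    have "(\<lambda>\<omega>. f \<omega> - v \<omega>) \<doteq> (\<lambda>_. 0)"
      by (rule orthogonal_sign_prods_imp_zero[OF \<zeta> L2_sub_diff[OF \<sigma> f v\<sigma>] orth[OF lin_span_base[OF P]]])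
    then have fv: "v \<doteq> f" by eventually_elim simp
    have "\<exists>h\<in>lin_span G. L2_norm M (\<lambda>\<omega>. f \<omega> - h \<omega>) < e" if e: "0 < e" for e
    proof -
      obtain h where h: "h \<in> lin_span G" and vh: "L2_norm M (\<lambda>\<omega>. v \<omega> - h \<omega>) < e"
        using v e unfolding L2_closure_def by blast
      have hL: "h \<in> L2 M" using h spanL by blast
      have "L2_norm M (\<lambda>\<omega>. f \<omega> - h \<omega>) = L2_norm M (\<lambda>\<omega>. v \<omega> - h \<omega>)"
        by (intro L2_norm_cong L2_measurable L2_diff fL vL hL) (use fv in \<open>eventually_elim, simp\<close>)
      then have "L2_norm M (\<lambda>\<omega>. f \<omega> - h \<omega>) < e" using vh by simp
      then show ?thesis using h by (rule bexI)
    qed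
    then show "f \<in> L2_closure M (lin_span G)" using fL by (simp add: L2_closure_def)
  qed
qed

text \<open>If the signs generate everything and each one is orthogonal to the future, then the
  component of the future orthogonal to the future signs is orthogonal to all products of
  signs: the first sign outside the future can be integrated out.\<close>

theorem tail_generation:
  assumes x: "\<And>n. x n \<in> CS" and dec: "\<And>n. x (Suc n) \<subseteq> x n"
    and \<zeta>: "\<And>n. random_sign M (\<zeta> n)" and \<zeta>x: "\<And>n. \<zeta> n \<in> L2_sub M (x n)"
    and orth: "\<And>n v. v \<in> L2_sub M (x (Suc n)) \<Longrightarrow> L2_inner M (\<zeta> n) v = 0"
    and gen: "sigma_rv M \<zeta> UNIV = sets M"
  shows "x n = sigma_rv M \<zeta> {n..}"
proof
  have anti: "x m \<subseteq> x k" if "k \<le> m" for k m using that by (rule lift_Suc_antimono_le[of x, OF dec])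
  let ?\<sigma> = "sigma_rv M \<zeta> {n..}"
  have \<sigma>: "?\<sigma> \<in> CS" using random_sign_measurable[OF \<zeta>] by (rule sigma_rv_in_CS)
  show \<sigma>x: "?\<sigma> \<subseteq> x n"
  proof (rule sigma_rv_least[OF x])
    fix k assume "k \<in> {n..}"
    then have "x k \<subseteq> x n" by (intro anti) simp
    then show "\<zeta> k \<in> L2_sub M (x n)" by (rule L2_sub_mono[OF x x _ \<zeta>x])
  qed
  show "x n \<subseteq> ?\<sigma>"
  proof
    fix E assume E: "E \<in> x n"
    let ?f = "indicator E :: 'a \<Rightarrow> real"
    have EM: "E \<in> sets M" using E CS_sets[OF x] by blast
    have f: "?f \<in> L2_sub M (x n)" by (rule L2_sub_indicator[OF x E])
    have fL: "?f \<in> L2 M" by (rule L2_indicator[OF EM])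
    note pL = cexp_in_L2[OF \<sigma> fL]
    let ?u = "\<lambda>\<omega>. ?f \<omega> - cexp M ?\<sigma> ?f \<omega>"
    have u: "?u \<in> L2_sub M (x n)"
      by (rule L2_sub_diff[OF x f L2_sub_mono[OF \<sigma> x \<sigma>x cexp_L2_sub[OF \<sigma> fL]]])
    have uL: "?u \<in> L2 M" by (rule L2_sub_L2[OF x u])
    have u_orth: "L2_inner M ?u v = 0" if "v \<in> L2_sub M ?\<sigma>" for v
      using L2_inner_diff_left[OF fL pL L2_sub_L2[OF \<sigma> that]] cexp_inner[OF \<sigma> fL that] by simp
    have "?u \<doteq> (\<lambda>_. 0)"
    proof (rule orthogonal_sign_prods_imp_zero[of UNIV \<zeta>, OF \<zeta>])
      show "?u \<in> L2_sub M (sigma_rv M \<zeta> UNIV)" unfolding gen L2_sub_sets by (rule uL)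
      fix K :: "nat set" assume K: "finite K"
      show "L2_inner M ?u (\<lambda>\<omega>. \<Prod>k\<in>K. \<zeta> k \<omega>) = 0"
      proof (cases "K \<subseteq> {n..}")
        case True
        then show ?thesis
          using sigma_rv_L2_sub[of "{n..}" \<zeta>, OF random_sign_measurable[OF \<zeta>] _ random_sign_L2[OF \<zeta>]]
          by (intro u_orth sign_prod_in_L2_sub \<sigma> \<zeta>) auto
      next
        case False
        then have ne: "K \<noteq> {}" by blast
        \<comment> \<open>The smallest index of K lies below n. All other factors, and
          \<open>?u\<close> itself, are measurable over \<open>x (Suc m)\<close>, to which the sign
          of index m is orthogonal.\<close>
        define m where "m = Min K"
        have m: "m \<in> K" using Min_in[OF K ne] by (simp add: m_def)
        obtain k where "k \<in> K" "k < n" using False by fastforce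
        then have mn: "m < n" using Min_le[OF K, of k] by (simp add: m_def)
        have later: "Suc m \<le> k" if "k \<in> K - {m}" for k
          using that Min_le[OF K, of k] by (auto simp: m_def)
        let ?P = "\<lambda>\<omega>. \<Prod>k\<in>K - {m}. \<zeta> k \<omega>"
        have P: "?P \<in> L2_sub M (x (Suc m))"
          by (intro sign_prod_in_L2_sub x \<zeta> L2_sub_mono[OF x x anti \<zeta>x] later)
        have "?u \<in> L2_sub M (x (Suc m))" using mn by (intro L2_sub_mono[OF x x anti u]) simp
        then have "(\<lambda>\<omega>. ?P \<omega> * ?u \<omega>) \<in> L2_sub M (x (Suc m))"
          by (rule L2_sub_bounded_mult[OF x _ P AE_abs_sign_prod_le[OF \<zeta>]])
        then have "L2_inner M (\<zeta> m) (\<lambda>\<omega>. ?P \<omega> * ?u \<omega>) = 0" by (rule orth)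
        moreover have "(\<Prod>k\<in>K. \<zeta> k \<omega>) = \<zeta> m \<omega> * ?P \<omega>" for \<omega> using K m by (rule prod.remove)
        ultimately show ?thesis by (simp add: L2_inner_def mult_ac)
      qed
    qed
    then have "cexp M ?\<sigma> ?f \<doteq> ?f" by eventually_elim simp
    then show "E \<in> ?\<sigma>" using L2_sub_iff_cexp[OF \<sigma> fL] indicator_in_L2_sub_iff[OF \<sigma> EM] by simp
  qed
qed

text \<open>For a sign, orthogonality to \<open>x (Suc n)\<close> already amounts to independence,
  because the indicator of an event of its field is affine in the sign.\<close>

theorem tail_generation_product_type:
  assumes x: "\<And>n. x n \<in> CS" and dec: "\<And>n. x (Suc n) \<subseteq> x n"
    and \<zeta>: "\<And>n. random_sign M (\<zeta> n)" and \<zeta>x: "\<And>n. \<zeta> n \<in> L2_sub M (x n)"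
    and orth: "\<And>n v. v \<in> L2_sub M (x (Suc n)) \<Longrightarrow> L2_inner M (\<zeta> n) v = 0"
    and gen: "sigma_rv M \<zeta> UNIV = sets M"
  shows "product_type M x"
proof -
  let ?z = "\<lambda>n. sigma_rv M \<zeta> {n}"
  have z: "?z n \<in> CS" for n using random_sign_measurable[OF \<zeta>] by (rule sigma_rv_in_CS)
  have ind: "indep_set (?z n) (x (Suc n))" for n
  proof (rule indep_setI)
    show "?z n \<subseteq> events" "x (Suc n) \<subseteq> events" by (rule CS_sets[OF z] CS_sets[OF x])+
    fix E D assume E: "E \<in> ?z n" and D: "D \<in> x (Suc n)"
    have EM: "E \<in> sets M" and DM: "D \<in> sets M" using E D CS_sets[OF z] CS_sets[OF x] by auto
    obtain \<alpha> \<beta> where ab: "(indicator E :: 'a \<Rightarrow> real) \<doteq> (\<lambda>\<omega>. \<alpha> + \<beta> * \<zeta> n \<omega>)"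
      using indicator_sigma_rv_sign[OF \<zeta> E] .
    have eq: "prob (E \<inter> F) = \<alpha> * prob F" if F: "F \<in> x (Suc n)" for F
    proof -
      have FM: "F \<in> sets M" using F CS_sets[OF x] by blast
      have "prob (E \<inter> F) = L2_inner M (indicator E) (indicator F)"
        by (simp only: L2_inner_indicator_indicator[OF EM FM])
      also have "\<dots> = L2_inner M (\<lambda>\<omega>. \<alpha> + \<beta> * \<zeta> n \<omega>) (indicator F)"
        by (intro L2_inner_cong L2_measurable L2_add L2_const L2_cmult L2_indicator EM FM random_sign_L2 \<zeta> ab) auto
      also have "\<dots> = L2_inner M (\<lambda>_. \<alpha>) (indicator F) + \<beta> * L2_inner M (\<zeta> n) (indicator F)"
        by (simp add: L2_inner_add_left[OF L2_const L2_cmult[OF random_sign_L2[OF \<zeta>]] L2_indicator[OF FM]]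
            L2_inner_cmult_left)
      also have "L2_inner M (\<zeta> n) (indicator F) = 0" by (rule orth[OF L2_sub_indicator[OF x F]])
      finally show ?thesis using FM by (simp add: L2_inner_def)
    qed
    \<comment> \<open>Taking F to be the whole space identifies the constant \<alpha> as the
      probability of E.\<close>
    have "space M \<in> x (Suc n)" by (rule space_in_CS[OF x])
    from eq[OF this] have "prob E = \<alpha>" using sets.sets_into_space[OF EM] by (simp add: prob_space Int_absorb2)
    with eq[OF D] show "prob (E \<inter> D) = prob E * prob D" by simp
  qed
  have zx: "?z n \<subseteq> x n" for n by (rule sigma_rv_least[OF x]) (use \<zeta>x in simp)
  have "indep_sets ?z UNIV" by (rule indep_sets_decreasing(2)[of x ?z, OF x z zx dec ind])
  moreover have "x n = Join M {?z k | k. n \<le> k}" for n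
  proof -
    have J: "Join M {?z k | k. n \<le> k} \<in> CS" using z by (intro Join_in_CS) auto
    have "sigma_rv M \<zeta> {n..} = Join M {?z k | k. n \<le> k}"
    proof
      show "sigma_rv M \<zeta> {n..} \<subseteq> Join M {?z k | k. n \<le> k}"
      proof (rule sigma_rv_least[OF J])
        fix k assume "k \<in> {n..}"
        then have "?z k \<subseteq> Join M {?z k | k. n \<le> k}" by (intro Join_upper) auto
        moreover have "\<zeta> k \<in> L2_sub M (?z k)"
          using random_sign_measurable[OF \<zeta>] random_sign_L2[OF \<zeta>] by (intro sigma_rv_L2_sub) auto
        ultimately show "\<zeta> k \<in> L2_sub M (Join M {?z k | k. n \<le> k})" by (rule L2_sub_mono[OF z J])
      qed
      show "Join M {?z k | k. n \<le> k} \<subseteq> sigma_rv M \<zeta> {n..}"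
      proof (rule Join_least)
        show "sigma_rv M \<zeta> {n..} \<in> CS" using random_sign_measurable[OF \<zeta>] by (rule sigma_rv_in_CS)
        fix a assume "a \<in> {?z k | k. n \<le> k}"
        then obtain k where "a = ?z k" "n \<le> k" by blast
        then show "a \<subseteq> sigma_rv M \<zeta> {n..}" using sigma_rv_mono[of "{k}" "{n..}" \<zeta>] by simp
      qed
    qed
    then show ?thesis using tail_generation[OF x dec \<zeta> \<zeta>x orth gen] by simp
  qed
  ultimately show ?thesis
    unfolding product_type_def by (intro exI[of _ ?z] conjI allI z)
qed

end

section \<open>The noise Boolean algebra of a decreasing sequence\<close>

locale sign_sequence = prob_space M for M :: "'a measure" +
  fixes x y :: "nat \<Rightarrow> 'a set set" and \<eta> :: "nat \<Rightarrow> 'a \<Rightarrow> real"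
  assumes x_CS: "x n \<in> complete_subfields M"
    and y_CS: "y n \<in> complete_subfields M"
    and x_0: "x 0 = sets M"
    and y_nontrivial: "y n \<noteq> trivial_field M"
    and y_indep: "indep_set (y n) (x (Suc n))"
    and x_Join: "x n = Join M {x (Suc n), y n}"
    and \<eta>_sign: "random_sign M (\<eta> n)"
    and y_sigma: "y n = sigma_rv M \<eta> {n}"
    and x_tail: "(\<Inter>n. x n) = trivial_field M"
begin

section \<open>Finite levels of the algebra as Boolean algebras of index sets\<close>

abbreviation B :: "'a set set set" where "B \<equiv> sequence_algebra M x y"

text \<open>The independent generators of level n. Index \<open>Suc n\<close> stands for the tail
  \<open>x (Suc n)\<close>, so that level n of the algebra becomes the image of the subsets of
  {..Suc n} under \<open>G n\<close>.\<close>

definition g :: "nat \<Rightarrow> nat \<Rightarrow> 'a set set" where "g n j = (if j \<le> n then y j else x (Suc n))"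

definition G :: "nat \<Rightarrow> nat set \<Rightarrow> 'a set set" where "G n J = Join M (g n ` J)"

lemma x_dec: "x (Suc n) \<subseteq> x n"
  using Join_upper[of "x (Suc n)" "{x (Suc n), y n}"] x_Join[of n] by simp

lemma y_x: "y n \<subseteq> x n"
  using Join_upper[of "y n" "{x (Suc n), y n}"] x_Join[of n] by simp

lemma x_anti: "m \<le> n \<Longrightarrow> x n \<subseteq> x m"
  by (rule lift_Suc_antimono_le[of x, OF x_dec])

lemma x_nontrivial: "x n \<noteq> trivial_field M"
  using y_x[of n] y_nontrivial[of n] CS_trivial[OF y_CS[of n]] by auto

lemma eta_y: "\<eta> n \<in> L2_sub M (y n)"
  unfolding y_sigma using random_sign_measurable[OF \<eta>_sign] random_sign_L2[OF \<eta>_sign]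
  by (intro sigma_rv_L2_sub) auto

lemma g_CS: "g n j \<in> CS"
  using x_CS y_CS by (simp add: g_def)

lemma g_nontrivial: "g n j \<noteq> trivial_field M"
  using x_nontrivial y_nontrivial by (simp add: g_def)

lemma G_CS: "G n J \<in> CS"
  unfolding G_def using g_CS by (intro Join_in_CS) auto

lemma G_mono: "J \<subseteq> K \<Longrightarrow> G n J \<subseteq> G n K"
  unfolding G_def by (intro Join_mono) auto

lemma G_empty: "G n {} = trivial_field M"
  by (simp add: G_def Join_empty)

lemma G_singleton: "G n {j} = g n j"
  by (simp add: G_def Join_singleton[OF g_CS])

lemma G_Join: "Join M {G n J, G n K} = G n (J \<union> K)"
proof -
  have "g n ` J \<subseteq> CS" "g n ` K \<subseteq> CS" using g_CS by auto
  then show ?thesis by (simp add: G_def Join_Join image_Un)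
qed

text \<open>Independent generators are grouped into two disjoint blocks. A non-empty block already
  contains the trivial field, so its join is the plain generated sigma-field; the empty block is the
  trivial field itself and is treated apart.\<close>

lemma G_indep:
  assumes "J \<subseteq> {..Suc n}" "K \<subseteq> {..Suc n}" "J \<inter> K = {}"
  shows "indep_set (G n J) (G n K)"
proof (cases "J = {} \<or> K = {}")
  case True
  then show ?thesis
    using indep_trivial[OF G_CS] indep_set_commute[OF indep_trivial[OF G_CS]] by (auto simp: G_empty)
next
  case False
  let ?I = "case_bool J K"
  have eq: "G n L = sigma_sets (space M) (\<Union>i\<in>L. g n i)" if "L \<noteq> {}" for L
  proof -
    obtain i where "i \<in> L" using \<open>L \<noteq> {}\<close> by blast
    then have "trivial_field M \<subseteq> (\<Union>i\<in>L. g n i)" using CS_trivial[OF g_CS] by blast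
    then have "trivial_field M \<union> (\<Union>i\<in>L. g n i) = (\<Union>i\<in>L. g n i)" by blast
    then show ?thesis by (simp add: G_def Join_def)
  qed
  have "indep_sets (g n) {..Suc n}"
    unfolding g_def by (rule indep_sets_decreasing(1)[of x y, OF x_CS y_CS y_x x_dec y_indep])
  moreover have "(\<Union>b\<in>UNIV. ?I b) \<subseteq> {..Suc n}" using assms(1,2) by (auto simp: UNIV_bool)
  ultimately have "indep_sets (g n) (\<Union>b\<in>UNIV. ?I b)" by (rule indep_sets_mono_index[rotated])
  then have "indep_sets (\<lambda>b. sigma_sets (space M) (\<Union>i\<in>?I b. g n i)) UNIV"
  proof (rule indep_sets_collect_sigma)
    show "Int_stable (g n i)" for i
      using sigma_algebra.axioms(1)[OF CS_sigma_algebra[OF g_CS]] algebra.axioms(1) ring_of_sets.axioms(1)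
        semiring_of_sets.Int by (intro Int_stableI) blast
    show "disjoint_family_on ?I UNIV"
      using assms(3) by (auto simp: disjoint_family_on_def split: bool.splits)
  qed
  also have "(\<lambda>b. sigma_sets (space M) (\<Union>i\<in>?I b. g n i)) = case_bool (G n J) (G n K)"
    using False by (auto simp: eq fun_eq_iff split: bool.splits)
  finally show ?thesis unfolding indep_set_def .
qed

text \<open>\<open>G n J\<close> splits into the part over J \<inter> K, which is contained in
  \<open>G n K\<close>, and the part over J - K, which is independent of it.\<close>

lemma cexp_G:
  assumes J: "J \<subseteq> {..Suc n}" and K: "K \<subseteq> {..Suc n}" and f: "f \<in> L2 M"
  shows "cexp M (G n K) (cexp M (G n J) f) \<doteq> cexp M (G n (J \<inter> K)) f"
proof -
  have "Join M {G n (J \<inter> K), G n (J - K)} = G n J" by (simp add: G_Join Int_Diff_Un)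
  then have "cexp M (G n J) f \<in> L2_sub M (Join M {G n (J \<inter> K), G n (J - K)})"
    using cexp_L2_sub[OF G_CS f] by simp
  moreover have "indep_set (G n (J - K)) (G n K)" using J K by (intro G_indep) auto
  ultimately have "cexp M (G n K) (cexp M (G n J) f) \<doteq> cexp M (G n (J \<inter> K)) (cexp M (G n J) f)"
    using G_mono[of "J \<inter> K" K n] by (intro cexp_Join_indep[OF G_CS G_CS G_CS]) auto
  moreover have "cexp M (G n (J \<inter> K)) (cexp M (G n J) f) \<doteq> cexp M (G n (J \<inter> K)) f"
    by (rule cexp_tower[OF G_CS G_CS G_mono f]) simp
  ultimately show ?thesis by eventually_elim simp
qed

text \<open>The intersection is read off from operators: an event in both fields is fixed by both
  conditional expectations, hence by their product, which is conditioning on the field of J \<inter>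
  K.\<close>

lemma G_Int:
  assumes J: "J \<subseteq> {..Suc n}" and K: "K \<subseteq> {..Suc n}"
  shows "G n J \<inter> G n K = G n (J \<inter> K)"
proof
  show "G n J \<inter> G n K \<subseteq> G n (J \<inter> K)"
  proof
    fix E assume "E \<in> G n J \<inter> G n K"
    then have EJ: "E \<in> G n J" and EK: "E \<in> G n K" by auto
    have EM: "E \<in> sets M" using EJ CS_sets[OF G_CS] by blast
    let ?f = "indicator E :: 'a \<Rightarrow> real"
    have fL: "?f \<in> L2 M" by (rule L2_indicator[OF EM])
    have "cexp M (G n J) ?f \<doteq> ?f" by (rule cexp_F_meas[OF G_CS L2_sub_indicator[OF G_CS EJ]])
    then have "cexp M (G n K) (cexp M (G n J) ?f) \<doteq> cexp M (G n K) ?f"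
      by (intro cexp_cong G_CS L2_measurable cexp_in_L2 fL)
    moreover have "cexp M (G n K) ?f \<doteq> ?f" by (rule cexp_F_meas[OF G_CS L2_sub_indicator[OF G_CS EK]])
    ultimately have "cexp M (G n (J \<inter> K)) ?f \<doteq> ?f"
      using cexp_G[OF J K fL] by eventually_elim simp
    then have "?f \<in> L2_sub M (G n (J \<inter> K))" by (simp only: L2_sub_iff_cexp[OF G_CS fL])
    then show "E \<in> G n (J \<inter> K)" by (simp only: indicator_in_L2_sub_iff[OF G_CS EM])
  qed
  show "G n (J \<inter> K) \<subseteq> G n J \<inter> G n K" using G_mono[of "J \<inter> K" J n] G_mono[of "J \<inter> K" K n] by simp
qed

text \<open>A generator with index in J but not in K would be independent of a field that contains
  it, hence trivial.\<close>

lemma G_subset_iff: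
  assumes J: "J \<subseteq> {..Suc n}" and K: "K \<subseteq> {..Suc n}"
  shows "G n J \<subseteq> G n K \<longleftrightarrow> J \<subseteq> K"
proof
  assume sub: "G n J \<subseteq> G n K"
  show "J \<subseteq> K"
  proof
    fix j assume j: "j \<in> J"
    show "j \<in> K"
    proof (rule ccontr)
      assume "j \<notin> K"
      then have "indep_set (G n {j}) (G n K)" using j J K by (intro G_indep) auto
      moreover have "G n {j} \<subseteq> G n K" using sub G_mono[of "{j}" J n] j by auto
      ultimately have "G n {j} = trivial_field M" by (rule indep_Int_trivial[OF G_CS])
      then show False using g_nontrivial by (simp add: G_singleton)
    qed
  qed
qed (rule G_mono)

lemma sequence_algebra_eq: "B = (\<Union>n. G n ` Pow {..Suc n})"
proof -
  have "{Join M C | C. C \<subseteq> insert (x (Suc n)) (y ` {..n})} = G n ` Pow {..Suc n}" for n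
  proof -
    have eq: "insert (x (Suc n)) (y ` {..n}) = g n ` {..Suc n}"
      by (auto simp: g_def atMost_Suc image_iff)
    show ?thesis unfolding eq by (auto simp: G_def subset_image_iff)
  qed
  then show ?thesis by (simp add: sequence_algebra_def)
qed

lemma G_in_B: "J \<subseteq> {..Suc n} \<Longrightarrow> G n J \<in> B"
  unfolding sequence_algebra_eq by blast

text \<open>Passing to level n + 1 splits the tail \<open>x (Suc n)\<close> into
  \<open>y (Suc n)\<close> and \<open>x (Suc (Suc n))\<close>; the other generators are the same at
  both levels.\<close>

lemma G_lift: "G n J = G (Suc n) (J \<inter> {..n} \<union> (if Suc n \<in> J then {Suc n, Suc (Suc n)} else {}))"
  if "J \<subseteq> {..Suc n}"
proof -
  have eq: "g n ` (J \<inter> {..n}) = g (Suc n) ` (J \<inter> {..n})" by (auto simp: g_def)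
  show ?thesis
  proof (cases "Suc n \<in> J")
    case True
    then have "J = insert (Suc n) (J \<inter> {..n})" using that by (auto simp: atMost_Suc)
    then have "G n J = Join M (insert (g n (Suc n)) (g n ` (J \<inter> {..n})))"
      unfolding G_def by (metis image_insert)
    also have "g n (Suc n) = Join M {g (Suc n) (Suc n), g (Suc n) (Suc (Suc n))}"
      using x_Join[of "Suc n"] by (simp add: g_def insert_commute)
    also have "Join M (insert (Join M {g (Suc n) (Suc n), g (Suc n) (Suc (Suc n))}) (g n ` (J \<inter> {..n})))
        = Join M ({g (Suc n) (Suc n), g (Suc n) (Suc (Suc n))} \<union> g n ` (J \<inter> {..n}))"
      using g_CS by (intro Join_Un_Join) auto
    also have "\<dots> = G (Suc n) (J \<inter> {..n} \<union> {Suc n, Suc (Suc n)})"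
      unfolding G_def eq image_Un by (simp add: Un_commute)
    finally show ?thesis using True by simp
  next
    case False
    then have "J = J \<inter> {..n}" using that by (auto simp: atMost_Suc)
    then show ?thesis using eq False unfolding G_def by simp
  qed
qed

lemma G_top: "G n {..Suc n} = sets M"
proof (induction n)
  case 0
  have "{..Suc 0} = {0, Suc 0}" by auto
  then show ?case using x_Join[of 0] x_0 by (simp add: G_def g_def insert_commute)
next
  case (Suc n)
  have "{..Suc n} \<inter> {..n} \<union> {Suc n, Suc (Suc n)} = {..Suc (Suc n)}" by auto
  then show ?case using G_lift[of "{..Suc n}" n] Suc by simp
qed

text \<open>Levels are nested by \<open>G_lift\<close>, so finitely many elements of
  \<open>B\<close> can be compared at one level.\<close>

lemma B_level:
  assumes "b \<in> B"
  obtains N where "\<And>m. N \<le> m \<Longrightarrow> \<exists>J\<subseteq>{..Suc m}. b = G m J"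
proof -
  obtain N J where J: "J \<subseteq> {..Suc N}" "b = G N J" using assms by (auto simp: sequence_algebra_eq)
  have "\<exists>J\<subseteq>{..Suc m}. b = G m J" if "N \<le> m" for m
    using that
  proof (induction m rule: dec_induct)
    case (step m)
    then obtain J where J: "J \<subseteq> {..Suc m}" "b = G m J" by blast
    let ?J = "J \<inter> {..m} \<union> (if Suc m \<in> J then {Suc m, Suc (Suc m)} else {})"
    have "?J \<subseteq> {..Suc (Suc m)}" by auto
    then show ?case using J(2) G_lift[OF J(1)] by metis
  qed (use J in blast)
  then show thesis by (rule that)
qed

lemma B_common_level:
  assumes "b \<in> B" "c \<in> B"
  obtains m J K where "k \<le> m" "J \<subseteq> {..Suc m}" "K \<subseteq> {..Suc m}" "b = G m J" "c = G m K"
proof -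
  obtain N N' where "\<And>m. N \<le> m \<Longrightarrow> \<exists>J\<subseteq>{..Suc m}. b = G m J" "\<And>m. N' \<le> m \<Longrightarrow> \<exists>J\<subseteq>{..Suc m}. c = G m J"
    using B_level[OF assms(1)] B_level[OF assms(2)] by metis
  then obtain J K where "J \<subseteq> {..Suc (max k (max N N'))}" "b = G (max k (max N N')) J"
    "K \<subseteq> {..Suc (max k (max N N'))}" "c = G (max k (max N N')) K"
    by (meson max.cobounded1 max.cobounded2 max.coboundedI2)
  then show thesis by (intro that[of "max k (max N N')" J K]) auto
qed

lemma x_in_B: "x n \<in> B"
proof (cases n)
  case 0
  then show ?thesis using G_in_B[of "{..Suc 0}" 0] G_top[of 0] x_0 by simp
next
  case (Suc m)
  then show ?thesis using G_in_B[of "{Suc m}" m] by (simp add: G_singleton g_def)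
qed

lemma trivial_in_B: "trivial_field M \<in> B"
  using G_in_B[of "{}" 0] by (simp add: G_empty)

lemma countable_B: "countable B"
proof -
  have "countable (G n ` Pow {..Suc n})" for n by (intro countable_finite finite_imageI) simp
  then show ?thesis unfolding sequence_algebra_eq by (rule countable_UN[OF countableI_type])
qed

lemma B_subset_CS: "B \<subseteq> CS"
  unfolding sequence_algebra_eq using G_CS by auto

sublocale commuting_lattice M B
proof
  show "B \<subseteq> CS" by (rule B_subset_CS)
  show "countable B" by (rule countable_B)
  show "sets M \<in> B" using G_in_B[of "{..Suc 0}" 0] G_top[of 0] by simp
  fix b c assume "b \<in> B" "c \<in> B"
  then obtain m J K where bc: "J \<subseteq> {..Suc m}" "K \<subseteq> {..Suc m}" "b = G m J" "c = G m K"
    using B_common_level[of b c 0] by metis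
  show "b \<inter> c \<in> B" using bc G_in_B[of "J \<inter> K" m] by (auto simp: G_Int)
  fix f assume "f \<in> L2 M"
  then show "cexp M b (cexp M c f) \<doteq> cexp M (b \<inter> c) f"
    using cexp_G[OF bc(2,1)] bc by (simp add: G_Int Int_commute)
qed

text \<open>At a common level the operations on fields are those on index sets: distributivity is
  inherited from sets, and the complementary index set provides an independent complement.\<close>

theorem noise_Boolean_algebra_sequence: "noise_Boolean_algebra M B"
  unfolding noise_Boolean_algebra_def
proof (intro conjI ballI)
  show "B \<noteq> {}" using trivial_in_B by blast
  show "B \<subseteq> CS" by (rule B_subset_CS)
next
  fix b c assume "b \<in> B" "c \<in> B"
  then obtain m J K where bc: "J \<subseteq> {..Suc m}" "K \<subseteq> {..Suc m}" "b = G m J" "c = G m K"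
    using B_common_level[of b c 0] by metis
  then show "b \<inter> c \<in> B" "Join M {b, c} \<in> B"
    using G_in_B[of "J \<inter> K" m] G_in_B[of "J \<union> K" m] by (auto simp: G_Int G_Join)
next
  fix b c d assume "b \<in> B" "c \<in> B" "d \<in> B"
  then obtain N1 N2 N3 where "\<And>m. N1 \<le> m \<Longrightarrow> \<exists>J\<subseteq>{..Suc m}. b = G m J"
    "\<And>m. N2 \<le> m \<Longrightarrow> \<exists>J\<subseteq>{..Suc m}. c = G m J" "\<And>m. N3 \<le> m \<Longrightarrow> \<exists>J\<subseteq>{..Suc m}. d = G m J"
    using B_level[of b] B_level[of c] B_level[of d] by metis
  moreover define m where "m = max N1 (max N2 N3)"
  ultimately obtain J K L where "J \<subseteq> {..Suc m}" "b = G m J" "K \<subseteq> {..Suc m}" "c = G m K"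
    "L \<subseteq> {..Suc m}" "d = G m L"
    by (meson max.cobounded1 max.cobounded2 max.coboundedI2)
  then show "b \<inter> Join M {c, d} = Join M {b \<inter> c, b \<inter> d}"
    by (simp add: G_Int G_Join Int_Un_distrib)
next
  fix b assume "b \<in> B"
  then obtain m J where b: "J \<subseteq> {..Suc m}" "b = G m J" using B_common_level[of b b 0] by metis
  have "indep_set b (G m ({..Suc m} - J))" unfolding b(2) using b(1) by (intro G_indep) auto
  moreover have "Join M {b, G m ({..Suc m} - J)} = sets M"
    using b(1) by (simp add: b(2) G_Join G_top Un_absorb1)
  ultimately show "\<exists>c\<in>B. indep_set b c \<and> Join M {b, c} = sets M"
    using G_in_B[of "{..Suc m} - J" m] by blast
qed

section \<open>Adjoining one sign to an element of the algebra\<close>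

lemma cexp_zero_antimono:
  assumes "a \<in> CS" "c \<in> CS" "a \<subseteq> c" "f \<in> L2 M" "cexp M c f \<doteq> (\<lambda>_. 0)"
  shows "cexp M a f \<doteq> (\<lambda>_. 0)"
  using assms L2_sub_mono[OF assms(1-3)] by (simp only: cexp_eq_0_iff) blast

text \<open>Factors measurable over \<open>c\<close> come out of the integral and leave the mean of
  \<eta> i, which is zero.\<close>

lemma cexp_eta_mult_zero:
  assumes c: "c \<in> CS" and ind: "indep_set (y i) c" and h: "h \<in> L2_sub M c"
  shows "cexp M c (\<lambda>\<omega>. \<eta> i \<omega> * h \<omega>) \<doteq> (\<lambda>_. 0)"
proof (rule cexp_charact[OF c _ L2_sub_const[OF c]])
  have hL: "h \<in> L2 M" by (rule L2_sub_L2[OF c h])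
  show "(\<lambda>\<omega>. \<eta> i \<omega> * h \<omega>) \<in> L2 M"
    by (rule L2_bounded_mult[OF hL random_sign_measurable[OF \<eta>_sign] random_sign_AE_abs[OF \<eta>_sign]])
  fix E assume E: "E \<in> c"
  have "(\<lambda>\<omega>. indicator E \<omega> * h \<omega>) \<in> L2_sub M c"
    by (rule L2_sub_bounded_mult[OF c h L2_sub_indicator[OF c E], of 1]) (auto split: split_indicator)
  then have "L2_inner M (\<eta> i) (\<lambda>\<omega>. indicator E \<omega> * h \<omega>) = 0"
    using indep_L2_inner[OF y_CS c ind eta_y] random_sign_expectation[OF \<eta>_sign] by simp
  then show "L2_inner M (\<lambda>\<omega>. \<eta> i \<omega> * h \<omega>) (indicator E) = L2_inner M (\<lambda>_. 0) (indicator E)"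
    by (simp add: L2_inner_def mult_ac)
qed

text \<open>Multiplication by \<eta> i exchanges the space of z with that of its join with
  \<open>y i\<close>. An f in the latter has no component over z, so only the term with \<eta> i
  survives in \<open>sign_decomposition\<close>.\<close>

theorem L2_circ_Join_y:
  assumes z: "z \<in> B" and yz: "\<not> y i \<subseteq> z"
  shows "f \<in> L2_circ M B (Join M {z, y i}) \<longleftrightarrow>
    f \<in> borel_measurable M \<and> (\<exists>h\<in>L2_circ M B z. f \<doteq> (\<lambda>\<omega>. \<eta> i \<omega> * h \<omega>))"
proof -
  \<comment> \<open>Translates z, a second element w and \<open>y i\<close> into index sets at one
    level m \<ge> i; that \<open>y i\<close> is not below z becomes i \<notin> J.\<close>
  have level: thesis
    if "w \<in> B" "\<And>m J K. i \<le> m \<Longrightarrow> J \<subseteq> {..Suc m} \<Longrightarrow> K \<subseteq> {..Suc m} \<Longrightarrow> i \<in> {..Suc m} \<Longrightarrow> i \<notin> J \<Longrightarrow>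
      z = G m J \<Longrightarrow> w = G m K \<Longrightarrow> y i = G m {i} \<Longrightarrow> Join M {z, y i} = G m (insert i J) \<Longrightarrow> thesis" for w thesis
  proof -
    obtain m J K where m: "i \<le> m" "J \<subseteq> {..Suc m}" "K \<subseteq> {..Suc m}" "z = G m J" "w = G m K"
      using B_common_level[OF z \<open>w \<in> B\<close>, of i] by metis
    have yi: "y i = G m {i}" using m(1) by (simp add: G_singleton g_def)
    have "i \<notin> J"
    proof
      assume "i \<in> J"
      then have "G m {i} \<subseteq> G m J" by (intro G_mono) simp
      then show False using yz yi m(4) by simp
    qed
    moreover have "Join M {z, y i} = G m (insert i J)" unfolding m(4) yi G_Join by simp
    ultimately show thesis using that(2) m yi by simp
  qed
  define z' where "z' = Join M {z, y i}"
  have zC: "z \<in> CS" by (rule B_in_CS[OF z])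
  have z'B: "z' \<in> B" and zz': "z \<subset> z'" and ind: "indep_set (y i) z"
  proof -
    show "z' \<in> B" unfolding z'_def
      using noise_Boolean_algebra_sequence z G_in_B[of "{i}" i]
      by (simp add: noise_Boolean_algebra_def G_singleton g_def)
    show "z \<subset> z'" "indep_set (y i) z"
    proof -
      show "z \<subset> z'"
        by (rule level[OF z]) (auto simp: z'_def psubset_eq G_subset_iff G_mono dest: equalityD2)
      show "indep_set (y i) z" by (rule level[OF z]) (auto intro!: G_indep)
    qed
  qed
  have z'C: "z' \<in> CS" by (rule B_in_CS[OF z'B])
  have yz': "y i \<subseteq> z'" unfolding z'_def by (intro Join_upper) simp
  note \<eta>m = random_sign_measurable[OF \<eta>_sign[of i]] and \<eta>b = random_sign_AE_abs[OF \<eta>_sign[of i]]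
  show ?thesis
    unfolding z'_def[symmetric]
  proof
    assume f: "f \<in> L2_circ M B z'"
    have fL: "f \<in> L2 M" by (rule L2_circ_L2[OF z'C f])
    have fz': "f \<in> L2_sub M z'" and f0: "\<And>w. w \<in> B \<Longrightarrow> w \<subset> z' \<Longrightarrow> cexp M w f \<doteq> (\<lambda>_. 0)"
      using f unfolding L2_circ_iff_B[OF z'B] by auto
    have efL: "(\<lambda>\<omega>. \<eta> i \<omega> * f \<omega>) \<in> L2 M" by (rule L2_bounded_mult[OF fL \<eta>m \<eta>b])
    define h where "h = cexp M z (\<lambda>\<omega>. \<eta> i \<omega> * f \<omega>)"
    have hz: "h \<in> L2_sub M z" unfolding h_def by (rule cexp_L2_sub[OF zC efL])
    have "f \<doteq> (\<lambda>\<omega>. cexp M z f \<omega> + \<eta> i \<omega> * h \<omega>)"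
      unfolding h_def by (rule sign_decomposition[OF zC \<eta>_sign y_sigma ind fz'[unfolded z'_def]])
    with f0[OF z zz'] have "f \<doteq> (\<lambda>\<omega>. \<eta> i \<omega> * h \<omega>)" by eventually_elim simp
    moreover have "h \<in> L2_circ M B z"
      unfolding L2_circ_iff_B[OF z]
    proof (intro conjI ballI impI hz)
      fix w assume w: "w \<in> B" and wz: "w \<subset> z"
      have wC: "w \<in> CS" by (rule B_in_CS[OF w])
      obtain m J K where m: "i \<le> m" "J \<subseteq> {..Suc m}" "K \<subseteq> {..Suc m}" "i \<in> {..Suc m}" "i \<notin> J"
        "z = G m J" "w = G m K" "y i = G m {i}" "z' = G m (insert i J)"
        using level[OF w] unfolding z'_def by metis
      have KJ: "K \<subset> J" using wz m(2,3) unfolding m(6,7) psubset_eq by (auto simp: G_subset_iff)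
      \<comment> \<open>Adding i to the index set of w makes \<eta> i measurable over
        \<open>v\<close>, while \<open>v\<close> stays strictly below \<open>z'\<close> because i is
        not in J.\<close>
      define v where "v = G m (insert i K)"
      have vB: "v \<in> B" unfolding v_def using m(3,4) by (intro G_in_B) simp
      have vC: "v \<in> CS" by (rule B_in_CS[OF vB])
      have "insert i K \<subseteq> insert i J" "\<not> insert i J \<subseteq> insert i K" using KJ m(5) by auto
      then have "G m (insert i K) \<subseteq> G m (insert i J)" "\<not> G m (insert i J) \<subseteq> G m (insert i K)"
        using m(2,3,4) by (simp_all add: G_subset_iff)
      then have "v \<subset> z'" unfolding v_def m(9) by blast
      then have vf: "cexp M v f \<doteq> (\<lambda>_. 0)" by (rule f0[OF vB])
      have "y i \<subseteq> v" unfolding v_def m(8) by (intro G_mono) simp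
      then have "\<eta> i \<in> L2_sub M v" by (rule L2_sub_mono[OF y_CS vC _ eta_y])
      from cexp_bounded_mult[OF vC fL this \<eta>b] vf have "cexp M v (\<lambda>\<omega>. \<eta> i \<omega> * f \<omega>) \<doteq> (\<lambda>_. 0)"
        by eventually_elim simp
      moreover have "w \<subseteq> v" unfolding v_def m(7) by (intro G_mono) auto
      ultimately have "cexp M w (\<lambda>\<omega>. \<eta> i \<omega> * f \<omega>) \<doteq> (\<lambda>_. 0)"
        by (intro cexp_zero_antimono[OF wC vC _ efL])
      moreover have "cexp M w h \<doteq> cexp M w (\<lambda>\<omega>. \<eta> i \<omega> * f \<omega>)"
        unfolding h_def using wz by (intro cexp_tower wC zC efL) auto
      ultimately show "cexp M w h \<doteq> (\<lambda>_. 0)" by eventually_elim simp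
    qed
    ultimately show "f \<in> borel_measurable M \<and> (\<exists>h\<in>L2_circ M B z. f \<doteq> (\<lambda>\<omega>. \<eta> i \<omega> * h \<omega>))"
      using L2_measurable[OF fL] by blast
  next
    assume "f \<in> borel_measurable M \<and> (\<exists>h\<in>L2_circ M B z. f \<doteq> (\<lambda>\<omega>. \<eta> i \<omega> * h \<omega>))"
    then obtain h where fm: "f \<in> borel_measurable M" and h: "h \<in> L2_circ M B z"
      and fh: "f \<doteq> (\<lambda>\<omega>. \<eta> i \<omega> * h \<omega>)" by (elim conjE bexE)
    have hL: "h \<in> L2 M" by (rule L2_circ_L2[OF zC h])
    have hz: "h \<in> L2_sub M z" using h by (simp add: L2_circ_def)
    let ?p = "\<lambda>\<omega>. \<eta> i \<omega> * h \<omega>"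
    have pL: "?p \<in> L2 M" by (rule L2_bounded_mult[OF hL \<eta>m \<eta>b])
    have "?p \<in> L2_circ M B z'"
      unfolding L2_circ_iff_B[OF z'B]
    proof (intro conjI ballI impI)
      show "?p \<in> L2_sub M z'"
        using zz' by (intro L2_sub_bounded_mult[OF z'C _ _ \<eta>b] L2_sub_mono[OF zC z'C _ hz]
            L2_sub_mono[OF y_CS z'C yz' eta_y]) auto
      fix w assume w: "w \<in> B" and wz: "w \<subset> z'"
      have wC: "w \<in> CS" by (rule B_in_CS[OF w])
      obtain m J K where m: "i \<le> m" "J \<subseteq> {..Suc m}" "K \<subseteq> {..Suc m}" "i \<in> {..Suc m}" "i \<notin> J"
        "z = G m J" "w = G m K" "y i = G m {i}" "z' = G m (insert i J)"
        using level[OF w] unfolding z'_def by metis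
      \<comment> \<open>If w contains \<open>y i\<close>, it cannot contain z, so it kills h, and
        \<eta> i factors out. Otherwise z and w both lie in the field \<open>c\<close> of all
        generators except \<open>y i\<close>, which is independent of \<open>y i\<close>.\<close>
      show "cexp M w ?p \<doteq> (\<lambda>_. 0)"
      proof (cases "i \<in> K")
        case True
        have "\<not> J \<subseteq> K"
        proof
          assume "J \<subseteq> K"
          then have "insert i J \<subseteq> K" using True by simp
          then have "z' \<subseteq> w" unfolding m(7,9) by (rule G_mono)
          then show False using wz by blast
        qed
        then have "\<not> z \<subseteq> w" using m(2,3) unfolding m(6,7) by (simp add: G_subset_iff)
        then have wh: "cexp M w h \<doteq> (\<lambda>_. 0)" using cexp_circ[OF z h w] by simp
        have "y i \<subseteq> w" unfolding m(7,8) using True by (intro G_mono) simp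
        then have "\<eta> i \<in> L2_sub M w" by (rule L2_sub_mono[OF y_CS wC _ eta_y])
        from cexp_bounded_mult[OF wC hL this \<eta>b] wh show ?thesis by eventually_elim simp
      next
        case False
        define c where "c = G m ({..Suc m} - {i})"
        have c: "c \<in> CS" unfolding c_def by (rule G_CS)
        have "z \<subseteq> c" "w \<subseteq> c" unfolding c_def m(6,7) using m(2,3,5) False by (auto intro!: G_mono)
        moreover have "indep_set (y i) c" unfolding m(8) c_def using m(4) by (intro G_indep) auto
        ultimately show ?thesis
          by (intro cexp_zero_antimono[OF wC c _ pL] cexp_eta_mult_zero c L2_sub_mono[OF zC c _ hz])
      qed
    qed
    then show "f \<in> L2_circ M B z'" using fh by (intro L2_circ_cong[OF z'C _ fm]) (auto elim: AE_mp)
  qed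
qed

section \<open>The spaces of the fields x n: zero or the line of a sign\<close>

abbreviation H :: "nat \<Rightarrow> ('a \<Rightarrow> real) set" where "H n \<equiv> L2_circ M B (x n)"

lemma H_iff: "f \<in> H n \<longleftrightarrow> f \<in> borel_measurable M \<and> (\<exists>h\<in>H (Suc n). f \<doteq> (\<lambda>\<omega>. \<eta> n \<omega> * h \<omega>))"
proof -
  \<comment> \<open>The inclusion would make \<open>y n\<close> independent of itself, hence
    trivial.\<close>
  have "\<not> y n \<subseteq> x (Suc n)" using indep_Int_trivial[OF y_CS y_indep, of n] y_nontrivial[of n] by blast
  from L2_circ_Join_y[OF x_in_B this] show ?thesis unfolding x_Join[of n, symmetric] .
qed

lemma H_L2: "f \<in> H n \<Longrightarrow> f \<in> L2 M"
  by (rule L2_circ_L2[OF x_CS])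

lemma H_L2_sub: "f \<in> H n \<Longrightarrow> f \<in> L2_sub M (x n)"
  by (simp add: L2_circ_def)

lemma eta_mult_H:
  assumes "f \<in> H n"
  shows "(\<lambda>\<omega>. \<eta> n \<omega> * f \<omega>) \<in> H (Suc n)"
proof -
  obtain h where h: "h \<in> H (Suc n)" and fh: "f \<doteq> (\<lambda>\<omega>. \<eta> n \<omega> * h \<omega>)" using assms H_iff by blast
  have "h \<doteq> (\<lambda>\<omega>. \<eta> n \<omega> * f \<omega>)"
    using fh random_sign_square[OF \<eta>_sign[of n]]
  proof eventually_elim
    case (elim \<omega>)
    have "\<eta> n \<omega> * f \<omega> = (\<eta> n \<omega> * \<eta> n \<omega>) * h \<omega>" using elim(1) by simp
    then show ?case using elim(2) by simp
  qed
  moreover have "(\<lambda>\<omega>. \<eta> n \<omega> * f \<omega>) \<in> borel_measurable M"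
    using random_sign_measurable[OF \<eta>_sign] L2_measurable[OF H_L2[OF assms]] by (intro borel_measurable_times)
  ultimately show ?thesis using L2_circ_cong[OF x_CS h] by blast
qed

lemma eta_mult_H':
  assumes "h \<in> H (Suc n)"
  shows "(\<lambda>\<omega>. \<eta> n \<omega> * h \<omega>) \<in> H n"
  unfolding H_iff[of _ n] using random_sign_measurable[OF \<eta>_sign] L2_measurable[OF H_L2[OF assms]] assms
  by (intro conjI borel_measurable_times bexI[of _ h]) auto

text \<open>The product of two elements of \<open>H n\<close> is unchanged when both are multiplied by the same
  signs, so it is measurable with respect to the whole tail.\<close>

lemma H_mult_const:
  assumes f: "f \<in> H n" and f': "f' \<in> H n"
  obtains c where "AE \<omega> in M. f \<omega> * f' \<omega> = c"
proof -
  \<comment> \<open>A product of two square-integrable functions is only known to be integrable. The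
    bounded injective function arctan brings it into the spaces \<open>L2_sub\<close>, and tan
    recovers the constant at the end.\<close>
  let ?t = "\<lambda>\<omega>. arctan (f \<omega> * f' \<omega>)"
  have tm: "?t \<in> borel_measurable M"
    using L2_measurable[OF H_L2[OF f]] L2_measurable[OF H_L2[OF f']]
    by (intro measurable_compose[OF _ borel_measurable_continuous_onI[of arctan]] borel_measurable_times
        continuous_on_arctan continuous_on_id)
  have reps: "\<exists>h\<in>H (n + m). \<exists>h'\<in>H (n + m). (\<lambda>\<omega>. f \<omega> * f' \<omega>) \<doteq> (\<lambda>\<omega>. h \<omega> * h' \<omega>)" for m
  proof (induction m)
    case 0
    show ?case using f f' by (intro bexI[of _ f] bexI[of _ f']) simp_all
  next
    case (Suc m)
    then obtain h h' where h: "h \<in> H (n + m)" "h' \<in> H (n + m)"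
      and eq: "(\<lambda>\<omega>. f \<omega> * f' \<omega>) \<doteq> (\<lambda>\<omega>. h \<omega> * h' \<omega>)" by blast
    have "(\<lambda>\<omega>. f \<omega> * f' \<omega>) \<doteq> (\<lambda>\<omega>. (\<eta> (n + m) \<omega> * h \<omega>) * (\<eta> (n + m) \<omega> * h' \<omega>))"
      using eq random_sign_square[OF \<eta>_sign[of "n + m"]]
    proof eventually_elim
      case (elim \<omega>)
      have "(\<eta> (n + m) \<omega> * h \<omega>) * (\<eta> (n + m) \<omega> * h' \<omega>) = (\<eta> (n + m) \<omega> * \<eta> (n + m) \<omega>) * (h \<omega> * h' \<omega>)"
        by simp
      then show ?case using elim by simp
    qed
    then show ?case using eta_mult_H[OF h(1)] eta_mult_H[OF h(2)]
      by (intro bexI[of _ "\<lambda>\<omega>. \<eta> (n + m) \<omega> * h \<omega>"] bexI[of _ "\<lambda>\<omega>. \<eta> (n + m) \<omega> * h' \<omega>"]) simp_all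
  qed
  have "?t \<in> L2_sub M (x (n + m))" for m
  proof -
    obtain h h' where h: "h \<in> H (n + m)" "h' \<in> H (n + m)"
      and eq: "(\<lambda>\<omega>. f \<omega> * f' \<omega>) \<doteq> (\<lambda>\<omega>. h \<omega> * h' \<omega>)" using reps by blast
    let ?s = "\<lambda>\<omega>. arctan (h \<omega> * h' \<omega>)"
    have "h \<in> borel_measurable (sigma (space M) (x (n + m)))" "h' \<in> borel_measurable (sigma (space M) (x (n + m)))"
      using H_L2_sub[OF h(1)] H_L2_sub[OF h(2)] L2_sub_iff[OF x_CS] by blast+
    then have sm: "?s \<in> borel_measurable (sigma (space M) (x (n + m)))"
      by (intro measurable_compose[OF _ borel_measurable_continuous_onI[of arctan]] borel_measurable_times
          continuous_on_arctan continuous_on_id)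
    have "\<bar>?s \<omega>\<bar> \<le> 2" for \<omega>
      using arctan_lbound[of "h \<omega> * h' \<omega>"] arctan_ubound[of "h \<omega> * h' \<omega>"] pi_less_4 by linarith
    then have "?s \<in> L2 M"
      using measurable_from_subalg[OF subalgebra_CS[OF x_CS] sm] by (intro L2_bounded[where K = 2]) auto
    then have s: "?s \<in> L2_sub M (x (n + m))" using sm L2_sub_iff[OF x_CS] by blast
    show ?thesis by (rule L2_sub_cong_AE[OF x_CS s tm]) (use eq in \<open>eventually_elim, simp\<close>)
  qed
  then have "?t \<in> L2_sub M (\<Inter>m. x (n + m))" by (intro L2_sub_INT x_CS) auto
  moreover have "(\<Inter>m. x (n + m)) = trivial_field M"
  proof -
    have "(\<Inter>m. x (n + m)) \<subseteq> x k" for k using x_anti[of k "n + k"] by auto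
    then show ?thesis by (auto simp: x_tail[symmetric])
  qed
  ultimately obtain c where "?t \<doteq> (\<lambda>_. c)" using L2_sub_trivial by auto
  then have "AE \<omega> in M. f \<omega> * f' \<omega> = tan c"
  proof eventually_elim
    case (elim \<omega>)
    then show ?case using tan_arctan[of "f \<omega> * f' \<omega>"] by simp
  qed
  then show thesis by (rule that)
qed

lemma H_expectation:
  assumes f: "f \<in> H n"
  shows "expectation f = 0"
proof -
  have "trivial_field M \<subset> x n" using CS_trivial[OF x_CS, of n] x_nontrivial[of n] by blast
  then have "cexp M (trivial_field M) f \<doteq> (\<lambda>_. 0)"
    using f trivial_in_B by (simp add: L2_circ_iff_B[OF x_in_B])
  with cexp_trivial[OF H_L2[OF f]] have "AE \<omega> in M. expectation f = 0" by eventually_elim simp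
  then show ?thesis by simp
qed

lemma H_random_sign:
  assumes "f \<in> H n" "AE \<omega> in M. f \<omega> * f \<omega> = 1"
  shows "random_sign M f"
  unfolding random_sign_iff
  using assms(2) L2_measurable[OF H_L2[OF assms(1)]] H_expectation[OF assms(1)]
  by (auto simp: square_eq_1_iff elim: eventually_mono)

text \<open>By \<open>H_mult_const\<close> the square of f is almost surely a constant, and it is
  positive because f is not zero; dividing f by the root of this constant leaves the values 1 and
  -1.\<close>

lemma H_exists_sign:
  assumes f: "f \<in> H n" and f0: "\<not> f \<doteq> (\<lambda>_. 0)"
  obtains \<xi> where "\<xi> \<in> H n" "random_sign M \<xi>"
proof -
  obtain c where c: "AE \<omega> in M. f \<omega> * f \<omega> = c" using H_mult_const[OF f f] .
  have "0 < c"
  proof (rule ccontr)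
    assume "\<not> 0 < c"
    from c have "f \<doteq> (\<lambda>_. 0)"
    proof eventually_elim
      case (elim \<omega>)
      then have "f \<omega> * f \<omega> \<le> 0" using \<open>\<not> 0 < c\<close> by simp
      then show ?case by (auto simp: mult_le_0_iff)
    qed
    then show False using f0 by simp
  qed
  let ?\<xi> = "\<lambda>\<omega>. (1 / sqrt c) * f \<omega>"
  have \<xi>: "?\<xi> \<in> H n" by (rule L2_circ_cmult[OF x_CS f])
  have "AE \<omega> in M. ?\<xi> \<omega> * ?\<xi> \<omega> = 1"
    using c
  proof eventually_elim
    case (elim \<omega>)
    have "?\<xi> \<omega> * ?\<xi> \<omega> = (f \<omega> * f \<omega>) / (sqrt c * sqrt c)" by simp
    also have "sqrt c * sqrt c = c" using \<open>0 < c\<close> by simp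
    also have "(f \<omega> * f \<omega>) / c = c / c" by (simp only: elim)
    also have "c / c = 1" using \<open>0 < c\<close> by simp
    finally show ?case .
  qed
  then show thesis using that[OF \<xi>] H_random_sign[OF \<xi>] by blast
qed

text \<open>The product of f with \<xi> is a constant c and the square of \<xi> is one, so f is c
  times \<xi>.\<close>

lemma H_eq_line:
  assumes \<xi>: "\<xi> \<in> H n" "random_sign M \<xi>"
  shows "H n = L2_line M \<xi>"
proof
  show "H n \<subseteq> L2_line M \<xi>"
  proof
    fix f assume f: "f \<in> H n"
    obtain c where "AE \<omega> in M. f \<omega> * \<xi> \<omega> = c" using H_mult_const[OF f \<xi>(1)] .
    then have "f \<doteq> (\<lambda>\<omega>. c * \<xi> \<omega>)"
      using random_sign_square[OF \<xi>(2)]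
    proof eventually_elim
      case (elim \<omega>)
      have "c * \<xi> \<omega> = f \<omega> * (\<xi> \<omega> * \<xi> \<omega>)" using elim(1) by simp
      then show ?case using elim(2) by simp
    qed
    then show "f \<in> L2_line M \<xi>" using L2_measurable[OF H_L2[OF f]] by (auto simp: L2_line_def)
  qed
  show "L2_line M \<xi> \<subseteq> H n"
  proof
    fix f assume "f \<in> L2_line M \<xi>"
    then obtain c where fm: "f \<in> borel_measurable M" and "f \<doteq> (\<lambda>\<omega>. c * \<xi> \<omega>)" by (auto simp: L2_line_def)
    then have "(\<lambda>\<omega>. c * \<xi> \<omega>) \<doteq> f" by (elim AE_symmetric)
    then show "f \<in> H n" by (rule L2_circ_cong[OF x_CS L2_circ_cmult[OF x_CS \<xi>(1)] fm])
  qed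
qed

lemma sign_in_line:
  assumes "random_sign M \<xi>"
  shows "\<xi> \<in> L2_line M \<xi>"
  using random_sign_measurable[OF assms] by (auto simp: L2_line_def intro!: exI[of _ 1])

lemma sign_line_unique:
  assumes \<xi>: "random_sign M \<xi>" and \<zeta>: "random_sign M \<zeta>" and line: "\<zeta> \<in> L2_line M \<xi>"
  shows "\<zeta> \<doteq> \<xi> \<or> (AE \<omega> in M. \<zeta> \<omega> = - \<xi> \<omega>)"
proof -
  obtain c where c: "\<zeta> \<doteq> (\<lambda>\<omega>. c * \<xi> \<omega>)" using line by (auto simp: L2_line_def)
  have "AE \<omega> in M. c = 1 \<or> c = - 1"
    using c random_sign_AE[OF \<xi>] random_sign_AE[OF \<zeta>] by eventually_elim auto
  then have "c = 1 \<or> c = - 1" by simp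
  then show ?thesis
  proof
    assume "c = 1"
    then show ?thesis using c by simp
  next
    assume "c = - 1"
    then have "AE \<omega> in M. \<zeta> \<omega> = - \<xi> \<omega>" using c by simp
    then show ?thesis by (rule disjI2)
  qed
qed

text \<open>Multiplication by the \<eta> k carries a sign from any level down to level 0 and from
  there to every other level, so a single non-zero space makes all of them lines.\<close>

theorem H_dichotomy:
  "(\<forall>n. H n = L2_zero M) \<or>
   (\<exists>\<xi>. (\<forall>n. random_sign M (\<xi> n) \<and> H n = L2_line M (\<xi> n) \<and>
             (\<forall>\<zeta>. random_sign M \<zeta> \<and> H n = L2_line M \<zeta> \<longrightarrow> \<zeta> \<doteq> \<xi> n \<or> (AE \<omega> in M. \<zeta> \<omega> = - \<xi> n \<omega>))) \<and>
        (\<forall>n. AE \<omega> in M. \<xi> n \<omega> = \<eta> n \<omega> * \<xi> (Suc n) \<omega>))"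
proof (cases "\<exists>n. H n \<noteq> L2_zero M")
  case True
  then obtain n where "H n \<noteq> L2_zero M" by blast
  then obtain f where f: "f \<in> H n" and "f \<notin> L2_zero M" using L2_zero_subset_circ[OF x_CS] by blast
  then have f0: "\<not> f \<doteq> (\<lambda>_. 0)" using L2_measurable[OF H_L2[OF f]] by (simp add: L2_zero_def)
  have "\<exists>\<xi>. \<xi> \<in> H n \<and> random_sign M \<xi>" using H_exists_sign[OF f f0] by metis
  then have "\<exists>\<xi>. \<xi> \<in> H 0 \<and> random_sign M \<xi>"
  proof (induction n)
    case (Suc n)
    then obtain \<xi> where \<xi>: "\<xi> \<in> H (Suc n)" "random_sign M \<xi>" by metis
    have "AE \<omega> in M. (\<eta> n \<omega> * \<xi> \<omega>) * (\<eta> n \<omega> * \<xi> \<omega>) = 1"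
      using random_sign_AE[OF \<xi>(2)] random_sign_AE[OF \<eta>_sign[of n]] by eventually_elim auto
    then show ?case using eta_mult_H'[OF \<xi>(1)] H_random_sign[OF eta_mult_H'[OF \<xi>(1)]] Suc.IH by metis
  qed blast
  then obtain \<xi>\<^sub>0 where \<xi>\<^sub>0: "\<xi>\<^sub>0 \<in> H 0" "random_sign M \<xi>\<^sub>0" by blast
  \<comment> \<open>All signs are derived from a single one at level 0, so their prefactors agree
    automatically.\<close>
  define \<xi> where "\<xi> = (\<lambda>n \<omega>. (\<Prod>k<n. \<eta> k \<omega>) * \<xi>\<^sub>0 \<omega>)"
  have rec: "\<xi> (Suc n) = (\<lambda>\<omega>. \<eta> n \<omega> * \<xi> n \<omega>)" for n by (simp add: \<xi>_def mult_ac)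
  have \<xi>: "\<xi> n \<in> H n \<and> random_sign M (\<xi> n)" for n
  proof (induction n)
    case 0
    then show ?case using \<xi>\<^sub>0 by (simp add: \<xi>_def)
  next
    case (Suc n)
    have "\<xi> (Suc n) \<in> H (Suc n)" unfolding rec using Suc by (intro eta_mult_H) blast
    moreover have "AE \<omega> in M. \<xi> (Suc n) \<omega> * \<xi> (Suc n) \<omega> = 1"
      using random_sign_AE[OF conjunct2[OF Suc]] random_sign_AE[OF \<eta>_sign[of n]]
      unfolding rec by eventually_elim auto
    ultimately show ?case using H_random_sign by blast
  qed
  have line: "H n = L2_line M (\<xi> n)" for n using \<xi>[of n] by (intro H_eq_line) auto
  have unique: "\<zeta> \<doteq> \<xi> n \<or> (AE \<omega> in M. \<zeta> \<omega> = - \<xi> n \<omega>)" if "random_sign M \<zeta> \<and> H n = L2_line M \<zeta>" for \<zeta> n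
  proof (rule sign_line_unique)
    show "\<zeta> \<in> L2_line M (\<xi> n)" using sign_in_line[of \<zeta>] that line[of n] by simp
  qed (use \<xi>[of n] that in auto)
  have "AE \<omega> in M. \<xi> n \<omega> = \<eta> n \<omega> * \<xi> (Suc n) \<omega>" for n
    using random_sign_square[OF \<eta>_sign[of n]]
  proof eventually_elim
    case (elim \<omega>)
    have "\<eta> n \<omega> * \<xi> (Suc n) \<omega> = (\<eta> n \<omega> * \<eta> n \<omega>) * \<xi> n \<omega>" by (simp add: rec)
    then show ?case using elim by simp
  qed
  then show ?thesis using \<xi> line unique by (intro disjI2 exI[of _ \<xi>]) simp
qed simp

section \<open>The spaces of all elements of the algebra as products of signs\<close>

lemma L2_circ_trivial:
  "f \<in> L2_circ M B (trivial_field M) \<longleftrightarrow> f \<in> borel_measurable M \<and> (\<exists>c. f \<doteq> (\<lambda>_. c))"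
proof -
  have "\<not> w \<subset> trivial_field M" if "w \<in> B" for w using CS_trivial[OF B_in_CS[OF that]] by blast
  then show ?thesis by (auto simp: L2_circ_iff_B[OF trivial_in_B] L2_sub_trivial)
qed

text \<open>Iterates \<open>L2_circ_Join_y\<close> over A. Since J is empty or {Suc n}, the
  remaining factor is a constant or an element of \<open>H (Suc n)\<close>.\<close>

lemma L2_circ_G:
  assumes A: "A \<subseteq> {..n}" and J: "J \<subseteq> {Suc n}"
  shows "f \<in> L2_circ M B (G n (A \<union> J)) \<longleftrightarrow>
    f \<in> borel_measurable M \<and> (\<exists>h\<in>L2_circ M B (G n J). f \<doteq> (\<lambda>\<omega>. (\<Prod>i\<in>A. \<eta> i \<omega>) * h \<omega>))"
proof -
  have "finite A" using A by (rule finite_subset) simp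
  then show ?thesis
    using A
  proof (induction A arbitrary: f)
    case empty
    show ?case
      unfolding prod.empty mult_1 Un_empty_left
    proof
      assume f: "f \<in> L2_circ M B (G n J)"
      show "f \<in> borel_measurable M \<and> (\<exists>h\<in>L2_circ M B (G n J). f \<doteq> h)"
        using L2_measurable[OF L2_circ_L2[OF G_CS f]] f by (intro conjI bexI[of _ f]) simp_all
    next
      assume "f \<in> borel_measurable M \<and> (\<exists>h\<in>L2_circ M B (G n J). f \<doteq> h)"
      then obtain h where f: "f \<in> borel_measurable M" and h: "h \<in> L2_circ M B (G n J)" and fh: "f \<doteq> h"
        by (elim conjE bexE)
      show "f \<in> L2_circ M B (G n J)" by (rule L2_circ_cong[OF G_CS h f AE_symmetric[OF fh]])
    qed
  next
    case (insert i A)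
    have AJ: "A \<union> J \<subseteq> {..Suc n}" "i \<notin> A \<union> J" "{i} \<subseteq> {..Suc n}" using insert J by auto
    have yi: "y i = G n {i}" using insert.prems by (simp add: G_singleton g_def)
    have "\<not> y i \<subseteq> G n (A \<union> J)" unfolding yi using AJ by (simp add: G_subset_iff)
    moreover have "Join M {G n (A \<union> J), y i} = G n (insert i A \<union> J)" unfolding yi G_Join by simp
    ultimately have step: "f \<in> L2_circ M B (G n (insert i A \<union> J)) \<longleftrightarrow>
        f \<in> borel_measurable M \<and> (\<exists>h\<in>L2_circ M B (G n (A \<union> J)). f \<doteq> (\<lambda>\<omega>. \<eta> i \<omega> * h \<omega>))"
      using L2_circ_Join_y[OF G_in_B[OF AJ(1)], of i f] by simp
    have IH: "h \<in> L2_circ M B (G n (A \<union> J)) \<longleftrightarrow>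
        h \<in> borel_measurable M \<and> (\<exists>k\<in>L2_circ M B (G n J). h \<doteq> (\<lambda>\<omega>. (\<Prod>i\<in>A. \<eta> i \<omega>) * k \<omega>))" for h
      using insert by simp
    have prod: "(\<Prod>j\<in>insert i A. \<eta> j \<omega>) * k = \<eta> i \<omega> * ((\<Prod>j\<in>A. \<eta> j \<omega>) * k)" for \<omega> k
      using insert.hyps by simp
    show ?case
    proof
      assume "f \<in> L2_circ M B (G n (insert i A \<union> J))"
      then obtain h where f: "f \<in> borel_measurable M" and h: "h \<in> L2_circ M B (G n (A \<union> J))"
        and fh: "f \<doteq> (\<lambda>\<omega>. \<eta> i \<omega> * h \<omega>)"
        unfolding step by (elim conjE bexE)
      from h obtain k where k: "k \<in> L2_circ M B (G n J)" and hk: "h \<doteq> (\<lambda>\<omega>. (\<Prod>i\<in>A. \<eta> i \<omega>) * k \<omega>)"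
        unfolding IH by (elim conjE bexE)
      from fh hk have "f \<doteq> (\<lambda>\<omega>. (\<Prod>j\<in>insert i A. \<eta> j \<omega>) * k \<omega>)" unfolding prod by eventually_elim simp
      then show "f \<in> borel_measurable M \<and>
          (\<exists>h\<in>L2_circ M B (G n J). f \<doteq> (\<lambda>\<omega>. (\<Prod>i\<in>insert i A. \<eta> i \<omega>) * h \<omega>))"
        using f k by (intro conjI bexI[of _ k])
    next
      assume "f \<in> borel_measurable M \<and>
          (\<exists>h\<in>L2_circ M B (G n J). f \<doteq> (\<lambda>\<omega>. (\<Prod>i\<in>insert i A. \<eta> i \<omega>) * h \<omega>))"
      then obtain k where f: "f \<in> borel_measurable M" and k: "k \<in> L2_circ M B (G n J)"
        and fk: "f \<doteq> (\<lambda>\<omega>. \<eta> i \<omega> * ((\<Prod>j\<in>A. \<eta> j \<omega>) * k \<omega>))" unfolding prod by (elim conjE bexE)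
      let ?h = "\<lambda>\<omega>. (\<Prod>j\<in>A. \<eta> j \<omega>) * k \<omega>"
      have "?h \<in> borel_measurable M"
        using L2_measurable[OF L2_circ_L2[OF G_CS k]] random_sign_measurable[OF \<eta>_sign]
        by (intro borel_measurable_times borel_measurable_prod)
      then have "?h \<in> L2_circ M B (G n (A \<union> J))" unfolding IH using k by (intro conjI bexI[of _ k]) simp_all
      then show "f \<in> L2_circ M B (G n (insert i A \<union> J))"
        unfolding step using f fk by (intro conjI bexI[of _ ?h])
    qed
  qed
qed

lemma B_cases:
  assumes "z \<in> B"
  obtains n A where "A \<subseteq> {..n}" "z = G n A" | n A where "A \<subseteq> {..n}" "z = G n (A \<union> {Suc n})"
proof -
  obtain n J where J: "J \<subseteq> {..Suc n}" "z = G n J" using B_common_level[OF assms assms, of 0] by metis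
  show thesis
  proof (cases "Suc n \<in> J")
    case True
    then have "J = (J - {Suc n}) \<union> {Suc n}" by blast
    moreover have "J - {Suc n} \<subseteq> {..n}" using J(1) by (auto simp: atMost_Suc)
    ultimately show thesis using that(2)[of "J - {Suc n}" n] J(2) by simp
  next
    case False
    then have "J \<subseteq> {..n}" using J(1) by (auto simp: atMost_Suc)
    then show thesis using that(1) J(2) by blast
  qed
qed

lemma y_prod_circ_L2_sub:
  assumes u: "u \<in> CS" and \<eta>u: "\<And>i. \<eta> i \<in> L2_sub M u" and hu: "L2_circ M B (G n J) \<subseteq> L2_sub M u"
    and A: "A \<subseteq> {..n}" and J: "J \<subseteq> {Suc n}"
  shows "L2_circ M B (G n (A \<union> J)) \<subseteq> L2_sub M u"
proof
  fix f assume "f \<in> L2_circ M B (G n (A \<union> J))"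
  then obtain h where f: "f \<in> borel_measurable M" and h: "h \<in> L2_circ M B (G n J)"
    and fh: "f \<doteq> (\<lambda>\<omega>. (\<Prod>i\<in>A. \<eta> i \<omega>) * h \<omega>)" unfolding L2_circ_G[OF A J] by (elim conjE bexE)
  have P: "(\<lambda>\<omega>. \<Prod>i\<in>A. \<eta> i \<omega>) \<in> L2_sub M u" by (rule sign_prod_in_L2_sub[OF u \<eta>_sign \<eta>u])
  have "(\<lambda>\<omega>. (\<Prod>i\<in>A. \<eta> i \<omega>) * h \<omega>) \<in> L2_sub M u"
    using h hu by (intro L2_sub_bounded_mult[OF u _ P AE_abs_sign_prod_le[OF \<eta>_sign]]) blast
  then show "f \<in> L2_sub M u" by (rule L2_sub_cong_AE[OF u _ f AE_symmetric[OF fh]])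
qed

text \<open>Serves both alternatives of \<open>H_dichotomy\<close>: a field that carries all \<eta>
  i and all spaces \<open>H n\<close> carries the products of which the other spaces
  consist.\<close>

lemma circ_subset_L2_sub:
  assumes u: "u \<in> CS" and \<eta>u: "\<And>i. \<eta> i \<in> L2_sub M u" and Hu: "\<And>n. H n \<subseteq> L2_sub M u" and z: "z \<in> B"
  shows "L2_circ M B z \<subseteq> L2_sub M u"
  using z
proof (cases rule: B_cases)
  case (1 n A)
  have "L2_circ M B (G n {}) \<subseteq> L2_sub M u"
    using L2_sub_mono[OF trivial_in_CS u CS_trivial[OF u]] by (auto simp: G_empty L2_circ_def)
  from y_prod_circ_L2_sub[OF u \<eta>u this 1(1)] show ?thesis using 1(2) by simp
next
  case (2 n A)
  have "L2_circ M B (G n {Suc n}) \<subseteq> L2_sub M u" using Hu[of "Suc n"] by (simp add: G_singleton g_def)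
  from y_prod_circ_L2_sub[OF u \<eta>u this 2(1)] show ?thesis using 2(2) by simp
qed

lemma eta_orthogonal: "v \<in> L2_sub M (x (Suc n)) \<Longrightarrow> L2_inner M (\<eta> n) v = 0"
  using indep_L2_inner[OF y_CS x_CS y_indep eta_y] random_sign_expectation[OF \<eta>_sign] by simp

text \<open>\<open>y n\<close> is non-trivial and independent of \<open>x (Suc n)\<close>, so
  \<open>x (Suc n)\<close> lies strictly below \<open>x n\<close> and kills f.\<close>

lemma H_orthogonal:
  assumes f: "f \<in> H n" and v: "v \<in> L2_sub M (x (Suc n))"
  shows "L2_inner M f v = 0"
proof -
  have "x (Suc n) \<noteq> x n"
    using indep_Int_trivial[OF y_CS y_indep, of n] y_nontrivial[of n] y_x[of n] by auto
  then have "cexp M (x (Suc n)) f \<doteq> (\<lambda>_. 0)"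
    using f x_dec[of n] x_in_B[of "Suc n"] by (simp add: L2_circ_iff_B[OF x_in_B] psubset_eq)
  then show ?thesis using v cexp_eq_0_iff[OF x_CS H_L2[OF f]] by blast
qed

text \<open>When all \<open>H n\<close> vanish, only products of the \<eta> i are left in the spaces
  of \<open>B\<close>, and \<open>star_imp_sets\<close> applies to the field of the \<eta>
  i.\<close>

lemma sigma_eta_generates:
  assumes res: "spectral_resolution M B S V ip \<Gamma> \<Psi>" and star: "star_condition M B S"
    and H0: "\<And>n. H n = L2_zero M"
  shows "sigma_rv M \<eta> UNIV = sets M"
proof -
  interpret R: spectrally_resolved M B S V ip \<Gamma> \<Psi> by unfold_locales (rule res)
  have \<sigma>: "sigma_rv M \<eta> UNIV \<in> CS" using random_sign_measurable[OF \<eta>_sign] by (rule sigma_rv_in_CS)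
  have \<eta>\<sigma>: "\<eta> i \<in> L2_sub M (sigma_rv M \<eta> UNIV)" for i
    using random_sign_measurable[OF \<eta>_sign] random_sign_L2[OF \<eta>_sign] by (intro sigma_rv_L2_sub) auto
  have "H n \<subseteq> L2_sub M (sigma_rv M \<eta> UNIV)" for n
    \<comment> \<open>With the empty family in place of \<open>B\<close>, this just says that null
      functions are in \<open>L2_sub\<close>.\<close>
    using L2_zero_subset_circ[OF \<sigma>, of "{}"] unfolding H0 by (auto simp: L2_circ_def)
  then have "L2_circ M B z \<subseteq> L2_sub M (sigma_rv M \<eta> UNIV)" if "z \<in> B" for z
    by (rule circ_subset_L2_sub[OF \<sigma> \<eta>\<sigma> _ that])
  then show ?thesis by (rule R.star_imp_sets[OF star \<sigma>])
qed

text \<open>The \<xi> n are any signs spanning the lines \<open>H n\<close>, with no coherent choice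
  of prefactors. So \<xi> n and the product of \<eta> n with \<xi> (n + 1) are related only up to a
  constant, which is carried along in the lemmas below.\<close>

context
  fixes \<xi> :: "nat \<Rightarrow> 'a \<Rightarrow> real"
  assumes \<xi>_sign: "\<And>n. random_sign M (\<xi> n)" and \<xi>_line: "\<And>n. H n = L2_line M (\<xi> n)"
begin

text \<open>One sign for each generator \<open>g n j\<close>, with \<xi> (n + 1) for the
  tail.\<close>

definition \<gamma> :: "nat \<Rightarrow> nat \<Rightarrow> 'a \<Rightarrow> real" where "\<gamma> n j = (if j \<le> n then \<eta> j else \<xi> (Suc n))"

lemma \<gamma>_sign: "random_sign M (\<gamma> n j)"
  using \<eta>_sign \<xi>_sign by (simp add: \<gamma>_def)

lemma \<xi>_H: "\<xi> n \<in> H n"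
  unfolding \<xi>_line by (rule sign_in_line[OF \<xi>_sign])

lemma \<eta>_\<xi>:
  obtains c where "AE \<omega> in M. \<eta> n \<omega> = c * (\<xi> n \<omega> * \<xi> (Suc n) \<omega>)"
proof -
  have "(\<lambda>\<omega>. \<eta> n \<omega> * \<xi> (Suc n) \<omega>) \<in> L2_line M (\<xi> n)"
    using eta_mult_H'[OF \<xi>_H] unfolding \<xi>_line .
  then obtain c where c: "AE \<omega> in M. \<eta> n \<omega> * \<xi> (Suc n) \<omega> = c * \<xi> n \<omega>" by (auto simp: L2_line_def)
  have "AE \<omega> in M. \<eta> n \<omega> = c * (\<xi> n \<omega> * \<xi> (Suc n) \<omega>)"
    using c random_sign_square[OF \<xi>_sign[of "Suc n"]]
  proof eventually_elim
    case (elim \<omega>)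
    have "c * (\<xi> n \<omega> * \<xi> (Suc n) \<omega>) = (c * \<xi> n \<omega>) * \<xi> (Suc n) \<omega>" by simp
    also have "\<dots> = \<eta> n \<omega> * (\<xi> (Suc n) \<omega> * \<xi> (Suc n) \<omega>)" unfolding elim(1)[symmetric] by simp
    finally show ?case unfolding elim(2) by simp
  qed
  then show thesis by (rule that)
qed

lemma \<xi>_rec:
  obtains c where "AE \<omega> in M. \<xi> n \<omega> = c * (\<eta> n \<omega> * \<xi> (Suc n) \<omega>)"
proof -
  obtain h where "h \<in> H (Suc n)" and h: "\<xi> n \<doteq> (\<lambda>\<omega>. \<eta> n \<omega> * h \<omega>)" using \<xi>_H[of n] unfolding H_iff[of _ n] by blast
  then obtain c where "h \<doteq> (\<lambda>\<omega>. c * \<xi> (Suc n) \<omega>)" by (auto simp: \<xi>_line L2_line_def)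
  with h have "AE \<omega> in M. \<xi> n \<omega> = c * (\<eta> n \<omega> * \<xi> (Suc n) \<omega>)" by eventually_elim simp
  then show thesis by (rule that)
qed

text \<open>The factors with index at most n are signs \<eta> j, adjoined by
  \<open>L2_circ_G\<close>. What remains is a constant or a multiple of \<xi> (n + 1), which spans
  \<open>H (Suc n)\<close>; the scalar c is absorbed there.\<close>

lemma \<gamma>_prod_circ:
  assumes J: "J \<subseteq> {..Suc n}" and f: "f \<in> borel_measurable M" and fJ: "f \<doteq> (\<lambda>\<omega>. c * (\<Prod>j\<in>J. \<gamma> n j \<omega>))"
  shows "f \<in> L2_circ M B (G n J)"
proof -
  define A where "A = J \<inter> {..n}"
  define J' where "J' = J \<inter> {Suc n}"
  have AJ: "A \<subseteq> {..n}" "J' \<subseteq> {Suc n}" "A \<union> J' = J" "A \<inter> J' = {}" "finite A" "finite J'"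
    using J by (auto simp: A_def J'_def atMost_Suc)
  let ?h = "\<lambda>\<omega>. c * (\<Prod>j\<in>J'. \<xi> j \<omega>)"
  have hm: "?h \<in> borel_measurable M"
    using random_sign_measurable[OF \<xi>_sign]
    by (intro borel_measurable_times borel_measurable_const borel_measurable_prod)
  have "?h \<in> L2_circ M B (G n J')"
  proof (cases "Suc n \<in> J")
    case True
    then have J': "J' = {Suc n}" by (auto simp: J'_def)
    show ?thesis using L2_circ_cmult[OF x_CS \<xi>_H] by (simp add: J' G_singleton g_def)
  next
    case False
    then have J': "J' = {}" by (auto simp: J'_def)
    show ?thesis unfolding J' G_empty L2_circ_trivial by simp
  qed
  moreover have "(\<Prod>j\<in>J. \<gamma> n j \<omega>) = (\<Prod>i\<in>A. \<eta> i \<omega>) * (\<Prod>j\<in>J'. \<xi> j \<omega>)" for \<omega>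
  proof -
    have "(\<Prod>j\<in>J. \<gamma> n j \<omega>) = (\<Prod>j\<in>A. \<gamma> n j \<omega>) * (\<Prod>j\<in>J'. \<gamma> n j \<omega>)"
      using prod.union_disjoint[OF AJ(5,6,4)] AJ(3) by simp
    moreover have "(\<Prod>j\<in>A. \<gamma> n j \<omega>) = (\<Prod>j\<in>A. \<eta> j \<omega>)" using AJ(1) by (intro prod.cong) (auto simp: \<gamma>_def)
    moreover have "(\<Prod>j\<in>J'. \<gamma> n j \<omega>) = (\<Prod>j\<in>J'. \<xi> j \<omega>)" using AJ(2) by (intro prod.cong) (auto simp: \<gamma>_def)
    ultimately show ?thesis by simp
  qed
  then have "f \<doteq> (\<lambda>\<omega>. (\<Prod>i\<in>A. \<eta> i \<omega>) * ?h \<omega>)" using fJ by (simp add: mult_ac)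
  ultimately have "f \<in> L2_circ M B (G n (A \<union> J'))"
    unfolding L2_circ_G[OF AJ(1,2)] using f by (intro conjI bexI[of _ ?h])
  then show ?thesis unfolding AJ(3) .
qed

text \<open>Up to a constant, \<xi> k is the product of \<eta> k, ..., \<eta> n and \<xi> (n + 1).
  Multiplying by it toggles the indices from n + 1 down to k one after the other, which is the
  downward induction on k.\<close>

lemma \<xi>_mult_\<gamma>_prod:
  assumes "k \<le> Suc n" "J \<subseteq> {..Suc n}"
  shows "\<exists>J'\<subseteq>{..Suc n}. \<exists>c. AE \<omega> in M. \<xi> k \<omega> * (\<Prod>j\<in>J. \<gamma> n j \<omega>) = c * (\<Prod>j\<in>J'. \<gamma> n j \<omega>)"
proof -
  have toggle: "\<exists>J'\<subseteq>{..Suc n}. AE \<omega> in M. \<gamma> n i \<omega> * (\<Prod>j\<in>J. \<gamma> n j \<omega>) = (\<Prod>j\<in>J'. \<gamma> n j \<omega>)"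
    if "i \<le> Suc n" "J \<subseteq> {..Suc n}" for i J
    using sign_prod_toggle[of "\<gamma> n", OF \<gamma>_sign finite_subset[OF that(2) finite_atMost], of i] that
    by (intro exI[of _ "if i \<in> J then J - {i} else insert i J"]) auto
  show ?thesis
    using assms
  proof (induction k arbitrary: J rule: inc_induct)
    case base
    obtain J' where J': "J' \<subseteq> {..Suc n}"
      and eq: "AE \<omega> in M. \<gamma> n (Suc n) \<omega> * (\<Prod>j\<in>J. \<gamma> n j \<omega>) = (\<Prod>j\<in>J'. \<gamma> n j \<omega>)"
      using toggle[OF order_refl base] by (elim exE conjE)
    have "AE \<omega> in M. \<xi> (Suc n) \<omega> * (\<Prod>j\<in>J. \<gamma> n j \<omega>) = 1 * (\<Prod>j\<in>J'. \<gamma> n j \<omega>)"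
      using eq by eventually_elim (simp add: \<gamma>_def)
    then show ?case using J' by (intro exI[of _ J'] exI[of _ 1] conjI)
  next
    case (step k)
    obtain J' c where J': "J' \<subseteq> {..Suc n}"
      and c: "AE \<omega> in M. \<xi> (Suc k) \<omega> * (\<Prod>j\<in>J. \<gamma> n j \<omega>) = c * (\<Prod>j\<in>J'. \<gamma> n j \<omega>)"
      using step.IH[OF step.prems] by (elim exE conjE)
    obtain J'' where J'': "J'' \<subseteq> {..Suc n}"
      and eq: "AE \<omega> in M. \<gamma> n k \<omega> * (\<Prod>j\<in>J'. \<gamma> n j \<omega>) = (\<Prod>j\<in>J''. \<gamma> n j \<omega>)"
      using toggle[OF less_imp_le[OF step.hyps(2)] J'] by (elim exE conjE)
    obtain d where d: "AE \<omega> in M. \<xi> k \<omega> = d * (\<eta> k \<omega> * \<xi> (Suc k) \<omega>)" using \<xi>_rec[of k] .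
    have \<gamma>k: "\<gamma> n k = \<eta> k" using step.hyps(2) by (simp add: \<gamma>_def)
    have "AE \<omega> in M. \<xi> k \<omega> * (\<Prod>j\<in>J. \<gamma> n j \<omega>) = (d * c) * (\<Prod>j\<in>J''. \<gamma> n j \<omega>)"
      using c eq d
    proof eventually_elim
      case (elim \<omega>)
      have "\<xi> k \<omega> * (\<Prod>j\<in>J. \<gamma> n j \<omega>) = d * \<eta> k \<omega> * (\<xi> (Suc k) \<omega> * (\<Prod>j\<in>J. \<gamma> n j \<omega>))"
        unfolding elim(3) by (simp only: mult_ac)
      also have "\<dots> = (d * c) * (\<gamma> n k \<omega> * (\<Prod>j\<in>J'. \<gamma> n j \<omega>))"
        unfolding elim(1) \<gamma>k by (simp only: mult_ac)
      finally show ?case unfolding elim(2) .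
    qed
    then show ?case using J'' by (intro exI[of _ J''] exI[of _ "d * c"] conjI)
  qed
qed

text \<open>At a level n beyond K, multiplying by the \<xi> k one at a time keeps the product a
  multiple of a product of the signs \<open>\<gamma> n j\<close>, and each of these belongs to one
  element of \<open>B\<close>.\<close>

lemma \<xi>_prod_circ:
  assumes K: "finite K"
  shows "\<exists>z\<in>B. (\<lambda>\<omega>. \<Prod>k\<in>K. \<xi> k \<omega>) \<in> L2_circ M B z"
proof -
  obtain n where n: "K \<subseteq> {..n}" using K finite_nat_iff_bounded_le by blast
  have "\<exists>J\<subseteq>{..Suc n}. \<exists>c. AE \<omega> in M. (\<Prod>k\<in>K. \<xi> k \<omega>) = c * (\<Prod>j\<in>J. \<gamma> n j \<omega>)"
    using K n
  proof (induction K)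
    case empty
    show ?case by (intro exI[of _ "{}"] exI[of _ 1]) simp
  next
    case (insert k K)
    then obtain J c where J: "J \<subseteq> {..Suc n}" and c: "AE \<omega> in M. (\<Prod>k\<in>K. \<xi> k \<omega>) = c * (\<Prod>j\<in>J. \<gamma> n j \<omega>)"
      by (metis insert_subset)
    have "k \<le> Suc n" using insert.prems by simp
    then obtain J' c' where J': "J' \<subseteq> {..Suc n}"
      and c': "AE \<omega> in M. \<xi> k \<omega> * (\<Prod>j\<in>J. \<gamma> n j \<omega>) = c' * (\<Prod>j\<in>J'. \<gamma> n j \<omega>)"
      using \<xi>_mult_\<gamma>_prod[OF _ J] by metis
    have "AE \<omega> in M. (\<Prod>k\<in>insert k K. \<xi> k \<omega>) = (c * c') * (\<Prod>j\<in>J'. \<gamma> n j \<omega>)"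
      using c c'
    proof eventually_elim
      case (elim \<omega>)
      have "(\<Prod>k\<in>insert k K. \<xi> k \<omega>) = \<xi> k \<omega> * (\<Prod>k\<in>K. \<xi> k \<omega>)" using insert.hyps by simp
      also have "\<dots> = c * (\<xi> k \<omega> * (\<Prod>j\<in>J. \<gamma> n j \<omega>))" unfolding elim(1) by (simp only: mult_ac)
      finally show ?case unfolding elim(2) by (simp only: mult_ac)
    qed
    then show ?case using J' by (intro exI[of _ J'] exI[of _ "c * c'"] conjI)
  qed
  then obtain J c where J: "J \<subseteq> {..Suc n}" and c: "AE \<omega> in M. (\<Prod>k\<in>K. \<xi> k \<omega>) = c * (\<Prod>j\<in>J. \<gamma> n j \<omega>)"
    by (elim exE conjE)
  have "(\<lambda>\<omega>. \<Prod>k\<in>K. \<xi> k \<omega>) \<in> borel_measurable M"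
    using random_sign_measurable[OF \<xi>_sign] by (intro borel_measurable_prod)
  then have "(\<lambda>\<omega>. \<Prod>k\<in>K. \<xi> k \<omega>) \<in> L2_circ M B (G n J)" by (rule \<gamma>_prod_circ[OF J _ c])
  then show ?thesis using G_in_B[OF J] by (rule bexI)
qed

text \<open>The product of the level signs over J has absolute value one, so it is a non-zero
  element of the space of \<open>G n J\<close>.\<close>

lemma circ_eq_B: "circ M B = B"
proof -
  have "z \<in> Cl_circ M B" if z: "z \<in> B" for z
  proof -
    obtain n J where J: "J \<subseteq> {..Suc n}" and zJ: "z = G n J" using B_common_level[OF z z, of 0] by metis
    let ?f = "\<lambda>\<omega>. \<Prod>j\<in>J. \<gamma> n j \<omega>"
    have fm: "?f \<in> borel_measurable M" using random_sign_measurable[OF \<gamma>_sign] by (intro borel_measurable_prod)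
    have "?f \<in> L2_circ M B z" unfolding zJ by (rule \<gamma>_prod_circ[OF J fm, of 1]) simp
    moreover have "?f \<notin> L2_zero M"
    proof
      assume "?f \<in> L2_zero M"
      then have "?f \<doteq> (\<lambda>_. 0)" by (simp add: L2_zero_def)
      with AE_sign_prod[of J "\<gamma> n", OF random_sign_AE[OF \<gamma>_sign]]
      have "AE \<omega> in M. False" by eventually_elim simp
      then show False by simp
    qed
    ultimately show ?thesis using B_in_Cl[OF z] by (auto simp: Cl_circ_def)
  qed
  then show ?thesis by (auto simp: circ_def)
qed

lemma \<sigma>_CS: "sigma_rv M \<xi> I \<in> CS"
  using random_sign_measurable[OF \<xi>_sign] by (rule sigma_rv_in_CS)

lemma \<xi>_\<sigma>: "\<xi> n \<in> L2_sub M (sigma_rv M \<xi> UNIV)"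
  using random_sign_measurable[OF \<xi>_sign] random_sign_L2[OF \<xi>_sign] by (intro sigma_rv_L2_sub) auto

lemma \<eta>_\<sigma>: "\<eta> n \<in> L2_sub M (sigma_rv M \<xi> UNIV)"
proof -
  obtain c where c: "AE \<omega> in M. \<eta> n \<omega> = c * (\<xi> n \<omega> * \<xi> (Suc n) \<omega>)" using \<eta>_\<xi> .
  have "(\<lambda>\<omega>. c * (\<xi> n \<omega> * \<xi> (Suc n) \<omega>)) \<in> L2_sub M (sigma_rv M \<xi> UNIV)"
    by (intro L2_sub_cmult \<sigma>_CS L2_sub_bounded_mult[OF \<sigma>_CS \<xi>_\<sigma> \<xi>_\<sigma> random_sign_AE_abs[OF \<xi>_sign]])
  then show ?thesis by (rule L2_sub_cong_AE[OF \<sigma>_CS _ random_sign_measurable[OF \<eta>_sign] AE_symmetric[OF c]])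
qed

lemma circ_\<sigma>:
  assumes z: "z \<in> B"
  shows "L2_circ M B z \<subseteq> L2_sub M (sigma_rv M \<xi> UNIV)"
proof (rule circ_subset_L2_sub[OF \<sigma>_CS \<eta>_\<sigma> _ z])
  fix n
  show "H n \<subseteq> L2_sub M (sigma_rv M \<xi> UNIV)"
  proof
    fix f assume "f \<in> H n"
    then obtain c where fm: "f \<in> borel_measurable M" and c: "f \<doteq> (\<lambda>\<omega>. c * \<xi> n \<omega>)"
      unfolding \<xi>_line L2_line_def by blast
    show "f \<in> L2_sub M (sigma_rv M \<xi> UNIV)"
      by (rule L2_sub_cong_AE[OF \<sigma>_CS L2_sub_cmult[OF \<sigma>_CS \<xi>_\<sigma>] fm AE_symmetric[OF c]])
  qed
qed

lemma circ_direct_sum: "is_L2_direct_sum M B (L2_circ M B) (L2_sub M (sigma_rv M \<xi> UNIV))"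
  unfolding is_L2_direct_sum_def
proof (intro conjI ballI impI)
  fix z w f h assume "z \<in> B" "w \<in> B" "z \<noteq> w" "f \<in> L2_circ M B z" "h \<in> L2_circ M B w"
  then show "L2_inner M f h = 0" by (intro L2_circ_orthogonal[of z f w h] B_in_Cl)
next
  show "L2_closure M (lin_span (\<Union>z\<in>B. L2_circ M B z)) = L2_sub M (sigma_rv M \<xi> UNIV)"
  proof (rule sigma_rv_span[OF \<xi>_sign])
    fix K :: "nat set" assume "finite K"
    then show "(\<lambda>\<omega>. \<Prod>k\<in>K. \<xi> k \<omega>) \<in> (\<Union>z\<in>B. L2_circ M B z)" using \<xi>_prod_circ by blast
  next
    show "(\<Union>z\<in>B. L2_circ M B z) \<subseteq> L2_sub M (sigma_rv M \<xi> UNIV)" using circ_\<sigma> by blast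
  qed
qed

lemma sigma_xi_eq_sets_iff:
  assumes res: "spectral_resolution M B S V ip \<Gamma> \<Psi>"
  shows "sigma_rv M \<xi> UNIV = sets M \<longleftrightarrow> star_condition M B S"
proof -
  interpret R: spectrally_resolved M B S V ip \<Gamma> \<Psi> by unfold_locales (rule res)
  show ?thesis
  proof
    assume gen: "sigma_rv M \<xi> UNIV = sets M"
    show "star_condition M B S"
    proof (rule R.total_imp_star)
      fix f assume f: "f \<in> L2 M"
        and orth: "\<And>z e. z \<in> B \<Longrightarrow> e \<in> L2_circ M B z \<Longrightarrow> L2_inner M f e = 0"
      show "f \<doteq> (\<lambda>_. 0)"
      proof (rule orthogonal_sign_prods_imp_zero[OF \<xi>_sign])
        show "f \<in> L2_sub M (sigma_rv M \<xi> UNIV)" unfolding gen L2_sub_sets by (rule f)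
        fix K :: "nat set" assume "finite K"
        then show "L2_inner M f (\<lambda>\<omega>. \<Prod>k\<in>K. \<xi> k \<omega>) = 0" using \<xi>_prod_circ orth by blast
      qed
    qed
  next
    assume "star_condition M B S"
    then show "sigma_rv M \<xi> UNIV = sets M" by (rule R.star_imp_sets[OF _ \<sigma>_CS circ_\<sigma>])
  qed
qed

end

text \<open>The independent generators are the \<eta> n if all \<open>H n\<close> vanish, and the
  \<xi> n otherwise; both families are orthogonal to the next tail.\<close>

theorem star_product_type:
  assumes res: "spectral_resolution M B S V ip \<Gamma> \<Psi>" and star: "star_condition M B S"
  shows "product_type M x"
  using H_dichotomy
proof
  assume "\<forall>n. H n = L2_zero M"
  then have gen: "sigma_rv M \<eta> UNIV = sets M" by (intro sigma_eta_generates[OF res star]) blast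
  show ?thesis
    by (rule tail_generation_product_type[OF x_CS x_dec \<eta>_sign L2_sub_mono[OF y_CS x_CS y_x eta_y]
          eta_orthogonal gen])
next
  assume "\<exists>\<xi>. (\<forall>n. random_sign M (\<xi> n) \<and> H n = L2_line M (\<xi> n) \<and>
             (\<forall>\<zeta>. random_sign M \<zeta> \<and> H n = L2_line M \<zeta> \<longrightarrow> \<zeta> \<doteq> \<xi> n \<or> (AE \<omega> in M. \<zeta> \<omega> = - \<xi> n \<omega>))) \<and>
        (\<forall>n. AE \<omega> in M. \<xi> n \<omega> = \<eta> n \<omega> * \<xi> (Suc n) \<omega>)"
  then obtain \<xi> where \<xi>: "\<And>n. random_sign M (\<xi> n)" and line: "\<And>n. H n = L2_line M (\<xi> n)" by blast
  have gen: "sigma_rv M \<xi> UNIV = sets M" using sigma_xi_eq_sets_iff[OF \<xi> line res] star by blast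
  note \<xi>H = \<xi>_H[OF \<xi> line]
  show ?thesis
    by (rule tail_generation_product_type[OF x_CS x_dec \<xi> H_L2_sub[OF \<xi>H] H_orthogonal[OF \<xi>H] gen])
qed

end

theorem theorem5p23:
  fixes M :: "'a measure"
    and x y :: "nat \<Rightarrow> 'a set set"
    and \<eta> :: "nat \<Rightarrow> 'a \<Rightarrow> real"
    and B :: "'a set set set"
    and H :: "nat \<Rightarrow> ('a \<Rightarrow> real) set"
  defines "B \<equiv> sequence_algebra M x y"
    and "H \<equiv> \<lambda>n. L2_circ M B (x n)"
  assumes "prob_space M"
    and "essentially_separable M"
    and "\<And>n. x n \<in> complete_subfields M"
    and "\<And>n. y n \<in> complete_subfields M"
    and "x 0 = sets M"
    and "\<And>n. y n \<noteq> trivial_field M"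
    and "\<And>n. prob_space.indep_set M (y n) (x (Suc n))"
    and "\<And>n. x n = Join M {x (Suc n), y n}"
    and "\<And>n. random_sign M (\<eta> n)"
    and "\<And>n. y n = sigma_rv M \<eta> {n}"
    and "(\<Inter>n. x n) = trivial_field M"
  shows
    "noise_Boolean_algebra M B
     \<and>
     \<comment> \<open>(i)\<close>
     ((\<forall>n. H n = L2_zero M) \<or>
      (\<exists>\<xi>. (\<forall>n. random_sign M (\<xi> n) \<and> H n = L2_line M (\<xi> n) \<and>
                (\<forall>\<zeta>. random_sign M \<zeta> \<and> H n = L2_line M \<zeta> \<longrightarrow>
                   (AE \<omega> in M. \<zeta> \<omega> = \<xi> n \<omega>) \<or> (AE \<omega> in M. \<zeta> \<omega> = - \<xi> n \<omega>))) \<and>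
           (\<forall>n. AE \<omega> in M. \<xi> n \<omega> = \<eta> n \<omega> * \<xi> (Suc n) \<omega>)))
     \<and>
     \<comment> \<open>(ii)\<close>
     (\<forall>\<xi>. (\<forall>n. random_sign M (\<xi> n) \<and> H n = L2_line M (\<xi> n)) \<longrightarrow>
        circ M B = B \<and>
        is_L2_direct_sum M B (L2_circ M B) (L2_sub M (sigma_rv M \<xi> UNIV)) \<and>
        (\<forall>(S :: 's measure) (V :: 's \<Rightarrow> 'h::real_vector set) ip \<Gamma> \<Psi>.
           spectral_resolution M B S V ip \<Gamma> \<Psi> \<longrightarrow>
           (sigma_rv M \<xi> UNIV = sets M \<longleftrightarrow> star_condition M B S) \<and>
           (star_condition M B S \<longrightarrow> (\<forall>n. x n = sigma_rv M \<xi> {n..}))))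
     \<and>
     \<comment> \<open>(iii)\<close>
     (\<forall>(S :: 's measure) (V :: 's \<Rightarrow> 'h::real_vector set) ip \<Gamma> \<Psi>.
        spectral_resolution M B S V ip \<Gamma> \<Psi> \<longrightarrow> star_condition M B S \<longrightarrow> product_type M x)"
proof -
  interpret prob_space M by fact
  interpret sign_sequence M x y \<eta> by unfold_locales (fact assms)+
  show ?thesis
    unfolding B_def H_def
  proof (intro conjI allI impI)
    show "noise_Boolean_algebra M (sequence_algebra M x y)" by (rule noise_Boolean_algebra_sequence)
  next
    show "(\<forall>n. L2_circ M (sequence_algebra M x y) (x n) = L2_zero M) \<or>
      (\<exists>\<xi>. (\<forall>n. random_sign M (\<xi> n) \<and> L2_circ M (sequence_algebra M x y) (x n) = L2_line M (\<xi> n) \<and>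
                (\<forall>\<zeta>. random_sign M \<zeta> \<and> L2_circ M (sequence_algebra M x y) (x n) = L2_line M \<zeta> \<longrightarrow>
                   (AE \<omega> in M. \<zeta> \<omega> = \<xi> n \<omega>) \<or> (AE \<omega> in M. \<zeta> \<omega> = - \<xi> n \<omega>))) \<and>
           (\<forall>n. AE \<omega> in M. \<xi> n \<omega> = \<eta> n \<omega> * \<xi> (Suc n) \<omega>))"
      by (rule H_dichotomy)
  next
    fix \<xi> :: "nat \<Rightarrow> 'a \<Rightarrow> real"
    assume "\<forall>n. random_sign M (\<xi> n) \<and> L2_circ M (sequence_algebra M x y) (x n) = L2_line M (\<xi> n)"
    then have \<xi>: "\<And>n. random_sign M (\<xi> n)"
      and line: "\<And>n. L2_circ M (sequence_algebra M x y) (x n) = L2_line M (\<xi> n)" by auto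
    show "circ M (sequence_algebra M x y) = sequence_algebra M x y" by (rule circ_eq_B[OF \<xi> line])
    show "is_L2_direct_sum M (sequence_algebra M x y) (L2_circ M (sequence_algebra M x y))
      (L2_sub M (sigma_rv M \<xi> UNIV))" by (rule circ_direct_sum[OF \<xi> line])
    fix S :: "'s measure" and V :: "'s \<Rightarrow> 'h set" and ip \<Gamma> \<Psi>
    assume "spectral_resolution M (sequence_algebra M x y) S V ip \<Gamma> \<Psi>"
    then show iff: "sigma_rv M \<xi> UNIV = sets M \<longleftrightarrow> star_condition M (sequence_algebra M x y) S"
      by (rule sigma_xi_eq_sets_iff[OF \<xi> line])
    fix n assume "star_condition M (sequence_algebra M x y) S"
    then have gen: "sigma_rv M \<xi> UNIV = sets M" using iff by blast
    note \<xi>H = \<xi>_H[OF \<xi> line]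
    show "x n = sigma_rv M \<xi> {n..}"
      by (rule tail_generation[OF x_CS x_dec \<xi> H_L2_sub[OF \<xi>H] H_orthogonal[OF \<xi>H] gen])
  next
    fix S :: "'s measure" and V :: "'s \<Rightarrow> 'h set" and ip \<Gamma> \<Psi>
    assume "spectral_resolution M (sequence_algebra M x y) S V ip \<Gamma> \<Psi>"
      "star_condition M (sequence_algebra M x y) S"
    then show "product_type M x" by (rule star_product_type)
  qed
qed

end
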